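(* Let $\mathfrak C=\{P(x,y)=0\}\subset\mathbb C^2$ and $\mathfrak C'=\{P'(x,y)=0\}\subset\mathbb C^2$ be two irreducible nondegenerate affine curves whose Newton polygons $\Delta(P)$ and $\Delta(P')$ belong to the same strong equivalence class, and assume that this class does not contain a long diagonal. Let $\mathcal S$ and $\mathcal S'$ be corresponding compact spectral curves (for some choices of fundamental bidifferentials). Then $\mathcal S$ is globally admissible if and only if $\mathcal S'$ is globally admissible.
   Context: **Local parameters.** Let $\Sigma$ be a disjoint union of Riemann surfaces with holomorphic $x:\Sigma\to\mathbb P^1$ and meromorphic 1-form $\omega_{0,1}$. At $p\in\Sigma$, $r_p$ is the ramification order of $x$; a standard coordinate $\zeta$ is a local coordinate centred at $p$ with $x=x(p)+\zeta^{r_p}$, or $x=\zeta^{-r_p}$ if $x(p)=\infty$. Write $\omega_{0,1}=\sum_{l\ge\bar s_p}\tau_{p,l}\zeta^l\frac{d\zeta}\zeta$, $\tau_p:=\tau_{p,\bar s_p}\ne0$, $s_p=\min\{l:\tau_{p,l}\ne0,r_p\nmid l\}$ ($\infty$ if empty), $\nu_p=\bar s_p/r_p$. The curve is locally admissible at $p$ if $r_p=1$, or $r_p\ge2$ and: $s_p,r_p$ coprime; $s_p\le-1$, or $s_p\in\{1,\dots,r_p+1\}$ and $r_p\equiv\pm1\pmod{s_p}$; $\bar s_p\in\{s_p,s_p-1\}$. **Compact spectral curve.** For $P$ of degrees $d_x,d_y>0$ in $x,y$, let $C=\{X_1^{d_x}Y_1^{d_y}P(X_0/X_1,Y_0/Y_1)=0\}\subset\mathbb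 P^1\times\mathbb P^1$, $\eta:\tilde C\to C$ its normalisation, $\pi_X([X_0:X_1],[Y_0:Y_1])=[X_0:X_1]$. The compact spectral curve associated to $\mathfrak C$ and a fundamental bidifferential $\omega_{0,2}$ on $\tilde C$ (symmetric meromorphic bidifferential on $\tilde C\times\tilde C$ whose only poles are a double pole on the diagonal with biresidue 1) is $(\tilde C,x=\pi_X\circ\eta,\ \omega_{0,1}=\eta^*(\frac{Y_0}{Y_1}d\frac{X_0}{X_1}),\omega_{0,2})$. **Global admissibility.** $E'=\big((\mathbb P^1\times\{\infty\})\cup\{(\infty,0)\}\big)\cap C$. For a pair $p_1,p_2$ in the same $x$-fibre, labelled with $\nu_1\le\nu_2$, $r_{12}=\max(r_1,r_2)$: (C-i) $\nu_1\le\frac1m\le\nu_2$ for some integer $m\in\{1,\dots,r_{12}-1\}$; (C-ii) $\nu_1\le\frac1{r_{12}}$; the pair is non-resonant if $\nu_1\ne\nu_2$, or $\nu_1=\nu_2$ and $\left(\frac{\tau_1/r_1}{\tau_2/r_2}\right)^{r'}\ne1$ with $r'=\frac{r_1}{\gcd(r_1,\bar s_1)}=\frac{r_2}{\gcd(r_2,\bar s_2)}$. $\mathcal S$ is globally admissible if for every singular point $p$ of $C$: $p\in E'$; $\mathcal S$ is locally admissible at all points of $\eta^{-1}(p)$; every pair in $\eta^{-1}(p)$ is non-resonant and satisfies (C-i) or (C-ii). **Nondegenerate.** The Newton polygon $\Delta(P)$ of $P=\sum c_{ij}x^iy^j$ is the convex hull of $\{(i,j):c_{ij}\ne0\}$.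 An edge is a closed segment in the boundary of $\Delta(P)$ whose only integral points are its endpoints; a maximal edge is a closed segment obtained as a maximal union of edges. For $\tau$ a maximal edge or $\tau=\Delta(P)$ put $P_\tau=\sum_{(i,j)\in\tau}c_{ij}x^iy^j$. $\{P=0\}$ is nondegenerate if for every such $\tau$ the system $P_\tau=\partial_xP_\tau=\partial_yP_\tau=0$ has no solution in $(\mathbb C^* )^2$. **Strong equivalence of polygons.** A polygon is a non-empty subset of $\mathbb R^2$ which is the convex hull of finitely many points in $\mathbb Z_{\ge0}^2$. It is inscribed, of bidegree $(d_x,d_y)\in\mathbb Z_{>0}^2$, if $\Delta\subseteq\square(d_x,d_y):=[0,d_x]\times[0,d_y]$ and $\Delta$ meets each of the four closed sides of this rectangle. Its interior points are the points of $\mathbb Z^2$ in the interior of $\Delta$. Two inscribed polygons are equivalent if they have the same bidegree and the same interior points. For $\Delta$ inscribed in $\square(d_x,d_y)$ and $v\in\square(d_x,d_y)\cap\mathbb Z^2$: $v\notin\Delta$ is addible to $\Delta$ if the convex hull $\Delta_+[v]$ of $\Delta\cup\{v\}$ is an inscribed polygon equivalent to $\Delta$; $v$ is removable from $\Delta$ if $\Delta=\Delta'_+[v]$ for an inscribed polygon $\Delta'$ equivalent to $\Delta$ (removing $v$ gives $\Delta'$). Two inscribed polygons are strongly equivalent if one can be transformed into the other by a finite sequence of additions/removals of addible/removable vertices. A long diagonal is a polygon $[(0,0),(d_x,d_y)]$ or $[(d_x,0),(0,d_y)]$ with $d_x,d_y$ not coprime. *)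

theory Defs
  imports
    "HOL-Complex_Analysis.Complex_Analysis"
    "HOL-Computational_Algebra.Computational_Algebra"
    "HOL-Library.Extended"
    "HOL-Number_Theory.Cong"
begin

section \<open>Lattice polygons\<close>

type_synonym plane = "real \<times> real"

definition lattice :: "plane set" where
  "lattice = {(of_int a, of_int b) | a b :: int. True}"

definition nat_lattice :: "plane set" where
  "nat_lattice = {(real a, real b) | a b :: nat. True}"

definition rectangle :: "nat \<Rightarrow> nat \<Rightarrow> plane set" where
  "rectangle dx dy = {0..real dx} \<times> {0..real dy}"

definition polygon :: "plane set \<Rightarrow> bool" where
  "polygon D \<longleftrightarrow> (\<exists>V. finite V \<and> V \<noteq> {} \<and> V \<subseteq> nat_lattice \<and> D = convex hull V)"

definition inscribed :: "nat \<Rightarrow> nat \<Rightarrow> plane set \<Rightarrow> bool" where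
  "inscribed dx dy D \<longleftrightarrow> 0 < dx \<and> 0 < dy \<and> polygon D \<and> D \<subseteq> rectangle dx dy
     \<and> (\<exists>p\<in>D. fst p = 0) \<and> (\<exists>p\<in>D. fst p = real dx)
     \<and> (\<exists>p\<in>D. snd p = 0) \<and> (\<exists>p\<in>D. snd p = real dy)"

text \<open>The interior is taken in the plane, so a segment has no interior points.\<close>

definition interior_points :: "plane set \<Rightarrow> plane set" where
  "interior_points D = lattice \<inter> interior D"

definition equivalent :: "plane set \<Rightarrow> plane set \<Rightarrow> bool" where
  "equivalent D D' \<longleftrightarrow>
     (\<exists>dx dy. inscribed dx dy D \<and> inscribed dx dy D') \<and> interior_points D = interior_points D'"

definition add_point :: "plane set \<Rightarrow> plane \<Rightarrow> plane set" where
  "add_point D v = convex hull (insert v D)"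

definition addible :: "plane set \<Rightarrow> plane \<Rightarrow> bool" where
  "addible D v \<longleftrightarrow>
     (\<exists>dx dy. inscribed dx dy D \<and> v \<in> rectangle dx dy \<inter> lattice) \<and> v \<notin> D
     \<and> equivalent D (add_point D v)"

definition removal :: "plane set \<Rightarrow> plane \<Rightarrow> plane set \<Rightarrow> bool" where
  "removal D v D' \<longleftrightarrow>
     (\<exists>dx dy. inscribed dx dy D \<and> v \<in> rectangle dx dy \<inter> lattice)
     \<and> equivalent D D' \<and> D = add_point D' v"

definition polygon_step :: "plane set \<Rightarrow> plane set \<Rightarrow> bool" where
  "polygon_step D D' \<longleftrightarrow> (\<exists>v. addible D v \<and> D' = add_point D v) \<or> (\<exists>v. removal D v D')"

definition strongly_equivalent :: "plane set \<Rightarrow> plane set \<Rightarrow> bool" where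
  "strongly_equivalent D D' \<longleftrightarrow>
     (\<exists>dx dy. inscribed dx dy D) \<and> (\<exists>dx dy. inscribed dx dy D') \<and> polygon_step\<^sup>*\<^sup>* D D'"

definition long_diagonal :: "plane set \<Rightarrow> bool" where
  "long_diagonal D \<longleftrightarrow> (\<exists>dx dy :: nat. 0 < dx \<and> 0 < dy \<and> \<not> coprime dx dy \<and>
     (D = closed_segment (0, 0) (real dx, real dy) \<or> D = closed_segment (real dx, 0) (0, real dy)))"

definition edge :: "plane set \<Rightarrow> plane set \<Rightarrow> bool" where
  "edge D e \<longleftrightarrow> (\<exists>a b. a \<noteq> b \<and> e = closed_segment a b \<and> e \<subseteq> frontier D \<and> e \<inter> lattice = {a, b})"

definition edge_union :: "plane set \<Rightarrow> plane set \<Rightarrow> bool" where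
  "edge_union D s \<longleftrightarrow>
     (\<exists>a b. a \<noteq> b \<and> s = closed_segment a b) \<and> (\<exists>E. (\<forall>e\<in>E. edge D e) \<and> s = \<Union>E)"

definition maximal_edge :: "plane set \<Rightarrow> plane set \<Rightarrow> bool" where
  "maximal_edge D s \<longleftrightarrow> edge_union D s \<and> (\<forall>s'. edge_union D s' \<and> s \<subseteq> s' \<longrightarrow> s' = s)"

section \<open>Polynomials in two variables\<close>

text \<open>An element \<open>P\<close> of \<open>\<complex>[x,y]\<close> is a polynomial in \<open>y\<close> whose coefficients are polynomials
  in \<open>x\<close>; \<open>irreducible P\<close> is irreducibility in \<open>\<complex>[x][y] = \<complex>[x,y]\<close>.\<close>

type_synonym poly_xy = "complex poly poly"

definition coeff_xy :: "poly_xy \<Rightarrow> nat \<Rightarrow> nat \<Rightarrow> complex" where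
  "coeff_xy P i j = coeff (coeff P j) i"

definition deg_y :: "poly_xy \<Rightarrow> nat" where
  "deg_y P = degree P"

definition deg_x :: "poly_xy \<Rightarrow> nat" where
  "deg_x P = Max ((\<lambda>j. degree (coeff P j)) ` {..degree P})"

definition support :: "poly_xy \<Rightarrow> (nat \<times> nat) set" where
  "support P = {(i, j). coeff_xy P i j \<noteq> 0}"

definition newton_polygon :: "poly_xy \<Rightarrow> plane set" where
  "newton_polygon P = convex hull ((\<lambda>(i, j). (real i, real j)) ` support P)"

text \<open>The value of \<open>P\<^sub>\<tau>\<close> at \<open>(x, y)\<close>.\<close>

definition restricted :: "poly_xy \<Rightarrow> plane set \<Rightarrow> complex \<Rightarrow> complex \<Rightarrow> complex" where
  "restricted P t x y =
     (\<Sum>(i, j) \<in> {(i, j) \<in> support P. (real i, real j) \<in> t}. coeff_xy P i j * x ^ i * y ^ j)"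

definition nondegenerate :: "poly_xy \<Rightarrow> bool" where
  "nondegenerate P \<longleftrightarrow>
     (\<forall>t. maximal_edge (newton_polygon P) t \<or> t = newton_polygon P \<longrightarrow>
        \<not> (\<exists>x y. x \<noteq> 0 \<and> y \<noteq> 0 \<and> restricted P t x y = 0
              \<and> deriv (\<lambda>u. restricted P t u y) x = 0
              \<and> deriv (\<lambda>v. restricted P t x v) y = 0))"

section \<open>The projective line and curves in its square\<close>

definition proportional :: "complex \<times> complex \<Rightarrow> complex \<times> complex \<Rightarrow> bool" where
  "proportional v w \<longleftrightarrow> v \<noteq> (0, 0) \<and> (\<exists>c. c \<noteq> 0 \<and> w = (c * fst v, c * snd v))"

lemma proportional_part_equivp: "part_equivp proportional"
proof (rule part_equivpI)
  have "proportional (1, 1) (1, 1)"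
    unfolding proportional_def by (auto intro!: exI[of _ 1])
  then show "\<exists>v. proportional v v" by blast
  show "symp proportional"
  proof (rule sympI)
    fix v w assume "proportional v w"
    then obtain c where c: "v \<noteq> (0, 0)" "c \<noteq> 0" and w: "w = (c * fst v, c * snd v)"
      unfolding proportional_def by blast
    have "(c * fst v, c * snd v) \<noteq> (0, 0)"
      using c by (simp add: prod_eq_iff)
    moreover have "v = (inverse c * fst (c * fst v, c * snd v), inverse c * snd (c * fst v, c * snd v))"
      using c by (simp add: prod_eq_iff)
    ultimately show "proportional w v"
      unfolding proportional_def w using c(2) by (meson nonzero_imp_inverse_nonzero)
  qed
  show "transp proportional"
  proof (rule transpI)
    fix u v w assume "proportional u v" "proportional v w"
    then obtain c d where cd: "u \<noteq> (0, 0)" "c \<noteq> 0" "d \<noteq> 0"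
      and v: "v = (c * fst u, c * snd u)" and w: "w = (d * fst v, d * snd v)"
      unfolding proportional_def by blast
    have "w = (d * c * fst u, d * c * snd u)"
      unfolding w v by simp
    with cd show "proportional u w"
      unfolding proportional_def by (intro conjI exI[of _ "d * c"]) simp_all
  qed
qed

quotient_type proj1 = "complex \<times> complex" / partial: proportional
  by (rule proportional_part_equivp)

text \<open>\<open>homog X0 X1\<close> is \<open>[X0 : X1]\<close>, meaningful when \<open>(X0, X1) \<noteq> (0, 0)\<close>.\<close>

definition homog :: "complex \<Rightarrow> complex \<Rightarrow> proj1" where
  "homog X0 X1 = abs_proj1 (X0, X1)"

definition proj_inf :: proj1 where
  "proj_inf = homog 1 0"

lemma homog_eq_iff:
  assumes "(X0, X1) \<noteq> (0, 0)" "(Y0, Y1) \<noteq> (0, 0)"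
  shows "homog X0 X1 = homog Y0 Y1 \<longleftrightarrow> (\<exists>c. c \<noteq> 0 \<and> Y0 = c * X0 \<and> Y1 = c * X1)"
proof -
  have refl: "proportional v v" if "v \<noteq> (0, 0)" for v
    unfolding proportional_def using that by (intro conjI exI[of _ 1]) auto
  have "homog X0 X1 = homog Y0 Y1 \<longleftrightarrow> proportional (X0, X1) (Y0, Y1)"
    unfolding homog_def
    using Quotient3_rel[OF Quotient3_proj1, of "(X0, X1)" "(Y0, Y1)"]
      refl[OF assms(1)] refl[OF assms(2)] by simp
  then show ?thesis
    using assms by (auto simp: proportional_def)
qed

text \<open>The affine coordinate \<open>X0 / X1\<close>, with junk value \<open>0\<close> at infinity, and the coordinate
  \<open>X1 / X0\<close> at infinity, with junk value \<open>0\<close> at the origin.\<close>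

definition aff :: "proj1 \<Rightarrow> complex" where
  "aff p = fst (rep_proj1 p) / snd (rep_proj1 p)"

definition coaff :: "proj1 \<Rightarrow> complex" where
  "coaff p = snd (rep_proj1 p) / fst (rep_proj1 p)"

lemma rep_proj1_homog:
  assumes "(X0, X1) \<noteq> (0, 0)"
  obtains c where "c \<noteq> 0" "rep_proj1 (homog X0 X1) = (c * X0, c * X1)"
proof -
  have "proportional (X0, X1) (X0, X1)"
    unfolding proportional_def using assms by (intro conjI exI[of _ 1]) auto
  then have "proportional (X0, X1) (rep_proj1 (homog X0 X1))"
    unfolding homog_def by (rule rep_abs_rsp[OF Quotient3_proj1])
  then show ?thesis
    unfolding proportional_def by (auto intro: that)
qed

lemma aff_homog: "X1 \<noteq> 0 \<Longrightarrow> aff (homog X0 X1) = X0 / X1"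
  by (rule rep_proj1_homog[of X0 X1]) (auto simp: aff_def)

lemma coaff_homog: "X0 \<noteq> 0 \<Longrightarrow> coaff (homog X0 X1) = X1 / X0"
  by (rule rep_proj1_homog[of X0 X1]) (auto simp: coaff_def)

definition bihom :: "poly_xy \<Rightarrow> complex \<times> complex \<Rightarrow> complex \<times> complex \<Rightarrow> complex" where
  "bihom P X Y = (\<Sum>i\<le>deg_x P. \<Sum>j\<le>deg_y P.
     coeff_xy P i j * fst X ^ i * snd X ^ (deg_x P - i) * fst Y ^ j * snd Y ^ (deg_y P - j))"

definition proj_curve :: "poly_xy \<Rightarrow> (proj1 \<times> proj1) set" where
  "proj_curve P = {(homog X0 X1, homog Y0 Y1) | X0 X1 Y0 Y1.
     (X0, X1) \<noteq> (0, 0) \<and> (Y0, Y1) \<noteq> (0, 0) \<and> bihom P (X0, X1) (Y0, Y1) = 0}"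

text \<open>The two standard affine charts of the projective line, in homogeneous coordinates.\<close>

definition affine_charts :: "(complex \<Rightarrow> complex \<times> complex) set" where
  "affine_charts = {\<lambda>u. (u, 1), \<lambda>u. (1, u)}"

definition singular_points :: "poly_xy \<Rightarrow> (proj1 \<times> proj1) set" where
  "singular_points P = {(abs_proj1 (a u), abs_proj1 (b v)) | a b u v.
     a \<in> affine_charts \<and> b \<in> affine_charts \<and> bihom P (a u) (b v) = 0
     \<and> deriv (\<lambda>u'. bihom P (a u') (b v)) u = 0
     \<and> deriv (\<lambda>v'. bihom P (a u) (b v')) v = 0}"

section \<open>Riemann surfaces\<close>

text \<open>A local coordinate is a pair of its domain and the coordinate function; the values of
  the function outside the domain are irrelevant.\<close>

type_synonym 'a coord = "'a set \<times> ('a \<Rightarrow> complex)"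

abbreviation img :: "'a coord \<Rightarrow> complex set" where
  "img c \<equiv> snd c ` fst c"

definition param :: "'a coord \<Rightarrow> complex \<Rightarrow> 'a" where
  "param c = inv_into (fst c) (snd c)"

definition transition :: "'a coord \<Rightarrow> 'a coord \<Rightarrow> complex \<Rightarrow> complex" where
  "transition c d z = snd d (param c z)"

definition is_coord :: "'a topology \<Rightarrow> 'a coord \<Rightarrow> bool" where
  "is_coord X c \<longleftrightarrow> openin X (fst c) \<and> open (img c)
     \<and> homeomorphic_map (subtopology X (fst c)) (top_of_set (img c)) (snd c)"

definition compatible :: "'a coord \<Rightarrow> 'a coord \<Rightarrow> bool" where
  "compatible c d \<longleftrightarrow> transition c d holomorphic_on snd c ` (fst c \<inter> fst d)
     \<and> transition d c holomorphic_on snd d ` (fst c \<inter> fst d)"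

text \<open>Surfaces are not required to be connected. The atlas is maximal, i.e. it consists of all
  holomorphic local coordinates.\<close>

definition riemann_surface :: "'a topology \<Rightarrow> 'a coord set \<Rightarrow> bool" where
  "riemann_surface X A \<longleftrightarrow> Hausdorff_space X
     \<and> (\<forall>c\<in>A. is_coord X c) \<and> \<Union> (fst ` A) = topspace X
     \<and> (\<forall>c\<in>A. \<forall>d\<in>A. compatible c d)
     \<and> (\<forall>c. is_coord X c \<and> (\<forall>d\<in>A. compatible c d) \<longrightarrow> c \<in> A)"

definition holomorphic_to_proj1 :: "'a coord set \<Rightarrow> ('a \<Rightarrow> proj1) \<Rightarrow> bool" where
  "holomorphic_to_proj1 A f \<longleftrightarrow> (\<forall>c\<in>A. \<forall>p\<in>fst c. \<exists>W g.
     open W \<and> snd c p \<in> W \<and> W \<subseteq> img c \<and> g holomorphic_on W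
     \<and> ((\<forall>z\<in>W. f (param c z) = homog (g z) 1) \<or> (\<forall>z\<in>W. f (param c z) = homog 1 (g z))))"

definition holomorphic2_on ::
    "(complex \<Rightarrow> complex \<Rightarrow> complex) \<Rightarrow> (complex \<times> complex) set \<Rightarrow> bool" where
  "holomorphic2_on f D \<longleftrightarrow> continuous_on D (\<lambda>(z, w). f z w)
     \<and> (\<forall>w. (\<lambda>z. f z w) holomorphic_on {z. (z, w) \<in> D})
     \<and> (\<forall>z. (\<lambda>w. f z w) holomorphic_on {w. (z, w) \<in> D})"

text \<open>A bidifferential is given by its coefficients \<open>B c d z w\<close> in all pairs of local coordinates,
  i.e. it is \<open>B c d z w dz dw\<close>; values on the diagonal are irrelevant.\<close>

definition off_diagonal :: "'a coord \<Rightarrow> 'a coord \<Rightarrow> (complex \<times> complex) set" where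
  "off_diagonal c d = {(z, w). z \<in> img c \<and> w \<in> img d \<and> param c z \<noteq> param d w}"

definition fundamental_bidifferential ::
    "'a coord set \<Rightarrow> ('a coord \<Rightarrow> 'a coord \<Rightarrow> complex \<Rightarrow> complex \<Rightarrow> complex) \<Rightarrow> bool" where
  "fundamental_bidifferential A B \<longleftrightarrow>
     (\<forall>c\<in>A. \<forall>d\<in>A. holomorphic2_on (B c d) (off_diagonal c d))
   \<and> (\<forall>c\<in>A. \<forall>d\<in>A. \<forall>c'\<in>A. \<forall>d'\<in>A. \<forall>(z, w) \<in> off_diagonal c d.
        param c z \<in> fst c' \<and> param d w \<in> fst d' \<longrightarrow>
        B c d z w = B c' d' (transition c c' z) (transition d d' w)
                      * deriv (transition c c') z * deriv (transition d d') w)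
   \<and> (\<forall>c\<in>A. \<forall>d\<in>A. \<forall>(z, w) \<in> off_diagonal c d. B c d z w = B d c w z)
   \<and> (\<forall>c\<in>A. \<exists>h. holomorphic2_on h (img c \<times> img c) \<and> (\<forall>z\<in>img c. h z z = 1)
        \<and> (\<forall>(z, w) \<in> off_diagonal c c. B c c z w = h z w / (z - w)\<^sup>2))"

section \<open>Spectral curves and their local parameters\<close>

text \<open>Differentials are given by their coefficients in all local coordinates.\<close>

record 'a spectral_curve =
  surface :: "'a topology"
  coords :: "'a coord set"
  xmap :: "'a \<Rightarrow> proj1"
  om01 :: "'a coord \<Rightarrow> complex \<Rightarrow> complex"
  om02 :: "'a coord \<Rightarrow> 'a coord \<Rightarrow> complex \<Rightarrow> complex \<Rightarrow> complex"

definition some_coord :: "('a, 'm) spectral_curve_scheme \<Rightarrow> 'a \<Rightarrow> 'a coord" where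
  "some_coord S p = (SOME c. c \<in> coords S \<and> p \<in> fst c)"

text \<open>The order of vanishing at \<open>p\<close> of \<open>x - x(p)\<close>, respectively of \<open>1 / x\<close>; it does not depend
  on the coordinate chosen.\<close>

definition ram_order :: "('a, 'm) spectral_curve_scheme \<Rightarrow> 'a \<Rightarrow> nat" where
  "ram_order S p = (let c = some_coord S p in
     nat (zorder (\<lambda>z. if xmap S p = proj_inf then coaff (xmap S (param c z))
                      else aff (xmap S (param c z)) - aff (xmap S p)) (snd c p)))"

definition standard_coord :: "('a, 'm) spectral_curve_scheme \<Rightarrow> 'a \<Rightarrow> 'a coord \<Rightarrow> bool" where
  "standard_coord S p c \<longleftrightarrow> c \<in> coords S \<and> p \<in> fst c \<and> snd c p = 0
     \<and> (\<forall>q\<in>fst c. xmap S q =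
          (if xmap S p = proj_inf then homog 1 (snd c q ^ ram_order S p)
           else homog (aff (xmap S p) + snd c q ^ ram_order S p) 1))"

text \<open>A standard coordinate is unique up to shrinking the domain and multiplication by an
  \<open>r\<^sub>p\<close>-th root of unity. The coefficients \<open>\<tau>\<^bsub>p,l\<^esub>\<close> depend on this choice, but no notion
  defined from them below does, except \<open>tau_lead\<close>, which enters the non-resonance condition
  only through a power which is insensitive to the choice.\<close>

definition tau :: "('a, 'm) spectral_curve_scheme \<Rightarrow> 'a \<Rightarrow> int \<Rightarrow> complex" where
  "tau S p l = (let c = (SOME c. standard_coord S p c) in
     fls_nth (laurent_expansion (\<lambda>z. z * om01 S c z) 0) l)"

definition sbar :: "('a, 'm) spectral_curve_scheme \<Rightarrow> 'a \<Rightarrow> int" where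
  "sbar S p = (LEAST l. tau S p l \<noteq> 0)"

definition tau_lead :: "('a, 'm) spectral_curve_scheme \<Rightarrow> 'a \<Rightarrow> complex" where
  "tau_lead S p = tau S p (sbar S p)"

definition s_param :: "('a, 'm) spectral_curve_scheme \<Rightarrow> 'a \<Rightarrow> int extended" where
  "s_param S p =
     (if \<exists>l. tau S p l \<noteq> 0 \<and> \<not> int (ram_order S p) dvd l
      then Fin (LEAST l. tau S p l \<noteq> 0 \<and> \<not> int (ram_order S p) dvd l) else Pinf)"

definition nu :: "('a, 'm) spectral_curve_scheme \<Rightarrow> 'a \<Rightarrow> real" where
  "nu S p = of_int (sbar S p) / real (ram_order S p)"

definition locally_admissible :: "('a, 'm) spectral_curve_scheme \<Rightarrow> 'a \<Rightarrow> bool" where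
  "locally_admissible S p \<longleftrightarrow> (let r = ram_order S p in
     r = 1 \<or>
     (r \<ge> 2 \<and> (\<exists>s. s_param S p = Fin s \<and> coprime s (int r)
        \<and> (s \<le> -1 \<or> (s \<in> {1..int r + 1} \<and> ([int r = 1] (mod s) \<or> [int r = -1] (mod s))))
        \<and> sbar S p \<in> {s, s - 1})))"

text \<open>In the next two definitions \<open>nu S p1 \<le> nu S p2\<close> is understood. If equality holds, both
  conditions are symmetric in the two points.\<close>

definition non_resonant :: "('a, 'm) spectral_curve_scheme \<Rightarrow> 'a \<Rightarrow> 'a \<Rightarrow> bool" where
  "non_resonant S p1 p2 \<longleftrightarrow>
     nu S p1 \<noteq> nu S p2 \<or>
     (nu S p1 = nu S p2 \<and>
      ((tau_lead S p1 / of_nat (ram_order S p1)) / (tau_lead S p2 / of_nat (ram_order S p2)))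
        ^ nat (int (ram_order S p1) div gcd (int (ram_order S p1)) (sbar S p1)) \<noteq> 1)"

definition condition_C :: "('a, 'm) spectral_curve_scheme \<Rightarrow> 'a \<Rightarrow> 'a \<Rightarrow> bool" where
  "condition_C S p1 p2 \<longleftrightarrow> (let r12 = max (ram_order S p1) (ram_order S p2) in
     (\<exists>m\<in>{1..<r12}. nu S p1 \<le> 1 / real m \<and> 1 / real m \<le> nu S p2)
     \<or> nu S p1 \<le> 1 / real r12)"

section \<open>Compact spectral curves and global admissibility\<close>

text \<open>The normalisation of an irreducible curve as a compact Riemann surface mapping
  holomorphically onto the curve, injectively outside finitely many points lying over the
  singular points. Connectedness of the surface follows for irreducible \<open>P\<close>.\<close>

definition normalisation ::
    "poly_xy \<Rightarrow> 'a topology \<Rightarrow> 'a coord set \<Rightarrow> ('a \<Rightarrow> proj1 \<times> proj1) \<Rightarrow> bool" where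
  "normalisation P X A \<eta> \<longleftrightarrow> riemann_surface X A \<and> compact_space X
     \<and> holomorphic_to_proj1 A (fst \<circ> \<eta>) \<and> holomorphic_to_proj1 A (snd \<circ> \<eta>)
     \<and> \<eta> ` topspace X = proj_curve P
     \<and> finite {q \<in> topspace X. \<eta> q \<in> singular_points P}
     \<and> inj_on \<eta> {q \<in> topspace X. \<eta> q \<notin> singular_points P}"

text \<open>\<open>\<omega>\<^bsub>0,1\<^esub> = \<eta>\<^sup>*(y dx)\<close> is required where \<open>x\<close> and \<open>y\<close> are finite; this determines
  its germ at every point, up to its irrelevant value at the poles.\<close>

definition compact_spectral_curve ::
    "poly_xy \<Rightarrow> ('a \<Rightarrow> proj1 \<times> proj1) \<Rightarrow> 'a spectral_curve \<Rightarrow> bool" where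
  "compact_spectral_curve P \<eta> S \<longleftrightarrow>
     0 < deg_x P \<and> 0 < deg_y P
   \<and> normalisation P (surface S) (coords S) \<eta>
   \<and> (\<forall>q\<in>topspace (surface S). xmap S q = fst (\<eta> q))
   \<and> (\<forall>c\<in>coords S. \<forall>z\<in>img c.
        fst (\<eta> (param c z)) \<noteq> proj_inf \<and> snd (\<eta> (param c z)) \<noteq> proj_inf \<longrightarrow>
        om01 S c z = aff (snd (\<eta> (param c z))) * deriv (\<lambda>z'. aff (fst (\<eta> (param c z')))) z)
   \<and> fundamental_bidifferential (coords S) (om02 S)"

definition E_set :: "poly_xy \<Rightarrow> (proj1 \<times> proj1) set" where
  "E_set P = (UNIV \<times> {proj_inf} \<union> {(proj_inf, homog 0 1)}) \<inter> proj_curve P"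

definition globally_admissible ::
    "poly_xy \<Rightarrow> ('a \<Rightarrow> proj1 \<times> proj1) \<Rightarrow> 'a spectral_curve \<Rightarrow> bool" where
  "globally_admissible P \<eta> S \<longleftrightarrow>
     (\<forall>p\<in>singular_points P. p \<in> E_set P \<and>
        (let F = {q \<in> topspace (surface S). \<eta> q = p} in
           (\<forall>q\<in>F. locally_admissible S q)
         \<and> (\<forall>q1\<in>F. \<forall>q2\<in>F. q1 \<noteq> q2 \<and> nu S q1 \<le> nu S q2 \<longrightarrow>
              non_resonant S q1 q2 \<and> condition_C S q1 q2)))"

end

theory Submission imports Defs begin

text \<open>A nondegenerate curve is singular at most at the four corners of \<open>\<P>\<^sup>1 \<times> \<P>\<^sup>1\<close>. Its branches
  at a corner are Puiseux series, one for each compact edge of the Newton polygon facing the corner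
  and each root of the edge polynomial up to roots of unity, and all local data are read off the
  primitive normal of the edge. With \<open>h f = Min f\<close> on the polygon, admissibility at \<open>(0, 0)\<close> is
  \<open>h (f + g) \<le> h f + h g + 1\<close> for the two coordinate functionals \<open>f, g\<close>. At \<open>(\<infinity>, 0)\<close>
  and \<open>(0, \<infinity>)\<close> it is the same inequality for consecutive functionals \<open>f, g\<close> of a fixed list,
  which cut the normals into the cones \<open>1 / (k + 1) < \<nu> < 1 / k\<close>: in each cone there is at most one
  branch, and it is locally admissible. At \<open>(\<infinity>, \<infinity>)\<close> nothing is required. If a lattice
  point is added to the polygon and makes one of these inequalities fail or hold, then the lattice
  triangle it spans with two other points has a new interior point, or the polygon is a long
  diagonal. Hence the inequalities are invariants of the strong equivalence class.\<close>

section \<open>Admissible polygons and strong equivalence\<close>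

text \<open>The corner (0, 0) lies outside E', so it must not be singular, that is, there is a
  monomial of degree at most 1. At a mixed corner a branch of primitive normal (r, n) has leading
  exponent N = \<plusminus>(n - r), coprime to r. If N \<ge> 2, divide r = \<kappa> N + \<beta> and
  put \<alpha> = N - \<beta>: then \<alpha> and \<beta> are the coordinates of (r, n) in the
  unimodular cone \<kappa>. Local admissibility means \<alpha> = 1 or \<beta> = 1, and two such
  branches satisfy (C-i) or (C-ii) iff their \<kappa> differ; non-resonance comes from uniqueness of
  branches. In cone coordinates the inequality says that some support point has X + Y \<le> 1. It
  holds at every smooth mixed corner, so it can be required without asking for a singularity. The
  obstacle to invariance is a new vertex that lowers functionals of the list: then the inequality is
  not carried from one polygon to the other but proved for both. On the analytic side, nondegeneracy
  makes the nonzero roots of edge polynomials simple; this gives uniqueness of branches by a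
  difference quotient, and Hurwitz with compactness gives existence.\<close>

definition lin :: "real \<Rightarrow> real \<Rightarrow> plane \<Rightarrow> real" where
  "lin a b p = a * fst p + b * snd p"

lemma lin_eq_inner: "lin a b p = (a, b) \<bullet> p"
  by (cases p) (simp add: lin_def)

text \<open>A small step from an interior point against the direction \<open>(a, b)\<close> stays in
  the set. Conversely, a convex set with empty interior lies in a line, which the condition for a
  normal and its negative excludes; otherwise a point outside the interior is separated from it by a
  functional, and the inequality passes to the closure.\<close>

lemma mem_interior_convex_iff:
  assumes S: "convex S"
  shows "p \<in> interior S \<longleftrightarrow> (\<forall>a b. (a, b) \<noteq> (0, 0) \<longrightarrow> (\<exists>q\<in>S. lin a b q < lin a b p))"
proof (intro iffI allI impI)
  fix a b :: real
  assume p: "p \<in> interior S" and ab: "(a, b) \<noteq> (0, 0)"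
  obtain e where e: "e > 0" "ball p e \<subseteq> S"
    using p mem_interior by blast
  define q where "q = p - (e / 2 / norm (a, b)) *\<^sub>R (a, b)"
  have n: "norm (a, b) > 0" using ab by (simp only: zero_less_norm_iff) (simp add: zero_prod_def)
  have "dist p q = norm ((e / 2 / norm (a, b)) *\<^sub>R (a, b))" by (simp only: q_def dist_norm) simp
  also have "\<dots> = e / 2" using n e(1) by (simp only: norm_scaleR) simp
  finally have "dist p q = e / 2" .
  then have "q \<in> S" using e by auto
  moreover have "lin a b q < lin a b p"
  proof -
    have "(a, b) \<bullet> q = (a, b) \<bullet> p - e / 2 / norm (a, b) * ((a, b) \<bullet> (a, b))"
      by (simp only: q_def inner_diff_right inner_scaleR_right)
    moreover have "(a, b) \<bullet> (a, b) > 0" using ab by (simp only: inner_gt_zero_iff) (simp add: zero_prod_def)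
    ultimately show "lin a b q < lin a b p" using n e(1) unfolding lin_eq_inner by simp
  qed
  ultimately show "\<exists>q\<in>S. lin a b q < lin a b p" by blast
next
  assume *: "\<forall>a b. (a, b) \<noteq> (0, 0) \<longrightarrow> (\<exists>q\<in>S. lin a b q < lin a b p)"
  have *: "\<exists>q\<in>S. c \<bullet> q < c \<bullet> p" if "c \<noteq> 0" for c
    using *[rule_format, of "fst c" "snd c"] that by (simp add: lin_eq_inner zero_prod_def)
  have ne: "interior S \<noteq> {}"
  proof
    assume "interior S = {}"
    then obtain a b where ab: "a \<noteq> 0" "S \<subseteq> {x. a \<bullet> x = b}"
      using empty_interior_subset_hyperplane[OF S] by blast
    obtain q where "q \<in> S" "a \<bullet> q < a \<bullet> p" using *[OF ab(1)] by blast
    moreover obtain q' where "q' \<in> S" "(-a) \<bullet> q' < (-a) \<bullet> p" using *[of "-a"] ab(1) by auto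
    moreover have "a \<bullet> x = b" if "x \<in> S" for x using ab(2) that by auto
    ultimately show False by fastforce
  qed
  show "p \<in> interior S"
  proof (rule ccontr)
    assume np: "p \<notin> interior S"
    have "convex (interior S)" using S by (rule convex_interior)
    then obtain a b where ab: "a \<noteq> 0" "a \<bullet> p \<le> b" "\<forall>x\<in>interior S. b \<le> a \<bullet> x"
      using separating_hyperplane_sets[of "{p}" "interior S"] ne np by auto
    have "closure (interior S) \<subseteq> {x. b \<le> a \<bullet> x}"
      by (rule closure_minimal) (use ab(3) closed_halfspace_ge[of b a] in auto)
    then have "S \<subseteq> {x. b \<le> a \<bullet> x}"
      using convex_closure_interior[OF S ne] closure_subset by blast
    with *[OF ab(1)] ab(2) show False by fastforce
  qed
qed

lemma lin_convex_hull_ge: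
  assumes "q \<in> convex hull V"
  shows "\<exists>v\<in>V. lin a b v \<le> lin a b q"
proof (rule ccontr)
  assume "\<not> ?thesis"
  then have "V \<subseteq> {x. lin a b q < (a, b) \<bullet> x}" by (auto simp: lin_eq_inner not_le)
  then have "convex hull V \<subseteq> {x. lin a b q < (a, b) \<bullet> x}"
    by (intro hull_minimal) (auto simp: convex_halfspace_gt)
  with assms show False by (auto simp: lin_eq_inner)
qed

text \<open>On a finite set or its hull this is h (f + g) \<le> h f + h g + 1, with the two minima
  on the right replaced by universally quantified points, so that no minimum has to be shown to
  exist. Adding constants to \<open>f\<close> or \<open>g\<close> does not change it.\<close>

definition good :: "(plane \<Rightarrow> real) \<Rightarrow> (plane \<Rightarrow> real) \<Rightarrow> plane set \<Rightarrow> bool" where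
  "good f g D \<longleftrightarrow> (\<exists>p\<in>D. \<forall>q\<in>D. \<forall>q'\<in>D. f p + g p \<le> f q + g q' + 1)"

text \<open>Each of f, g and f + g has a generator at least as low as any given point of the hull,
  so every quantifier can be moved to the generators.\<close>

lemma good_convex_hull:
  "good (lin a b) (lin c d) (convex hull V) \<longleftrightarrow> good (lin a b) (lin c d) V"
proof
  assume "good (lin a b) (lin c d) (convex hull V)"
  then obtain p where p: "p \<in> convex hull V"
    and *: "\<And>q q'. q \<in> convex hull V \<Longrightarrow> q' \<in> convex hull V \<Longrightarrow> lin a b p + lin c d p \<le> lin a b q + lin c d q' + 1"
    unfolding good_def by blast
  obtain v where v: "v \<in> V" "lin (a + c) (b + d) v \<le> lin (a + c) (b + d) p"
    using lin_convex_hull_ge[OF p] by blast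
  have "lin a b v + lin c d v \<le> lin a b p + lin c d p"
    using v(2) by (simp add: lin_def algebra_simps)
  then show "good (lin a b) (lin c d) V"
    unfolding good_def using * v(1) by (meson hull_inc order_trans)
next
  assume "good (lin a b) (lin c d) V"
  then obtain p where p: "p \<in> V"
    and *: "\<And>q q'. q \<in> V \<Longrightarrow> q' \<in> V \<Longrightarrow> lin a b p + lin c d p \<le> lin a b q + lin c d q' + 1"
    unfolding good_def by blast
  have "lin a b p + lin c d p \<le> lin a b q + lin c d q' + 1"
    if "q \<in> convex hull V" "q' \<in> convex hull V" for q q'
    using lin_convex_hull_ge[OF that(1), of a b] lin_convex_hull_ge[OF that(2), of c d] *
    by force
  then show "good (lin a b) (lin c d) (convex hull V)"
    unfolding good_def using p by (meson hull_inc)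
qed

section \<open>Lattice points forced by a new vertex\<close>

definition cross :: "plane \<Rightarrow> plane \<Rightarrow> real" where
  "cross p q = fst p * snd q - snd p * fst q"

text \<open>A polygon inside a line that touches all four sides of its rectangle is a diagonal of
  it; the sign of the slope decides which. If the degrees were coprime, \<open>dx\<close> would
  divide the first coordinate of the lattice point \<open>p\<close>, which lies strictly between 0
  and \<open>dx\<close>.\<close>

lemma long_diagonal_of_collinear:
  assumes D: "inscribed dx dy D" and f: "(f1, f2) \<noteq> (0, 0)"
    and line: "\<And>q. q \<in> D \<Longrightarrow> lin f1 f2 q = c"
    and p: "p \<in> lattice" "p \<in> open_segment u w" and uw: "u \<in> D" "w \<in> D"
  shows "long_diagonal D"
proof -
  have d: "0 < dx" "0 < dy" and pol: "polygon D" and sub: "D \<subseteq> rectangle dx dy"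
    using D by (auto simp: inscribed_def)
  obtain l r b t where lrbt: "l \<in> D" "fst l = 0" "r \<in> D" "fst r = real dx"
      "b \<in> D" "snd b = 0" "t \<in> D" "snd t = real dy"
    using D by (auto simp: inscribed_def)
  have f1: "f1 \<noteq> 0"
  proof
    assume "f1 = 0"
    with line[OF lrbt(5)] line[OF lrbt(7)] lrbt d f show False by (auto simp: lin_def)
  qed
  have f2: "f2 \<noteq> 0"
  proof
    assume "f2 = 0"
    with line[OF lrbt(1)] line[OF lrbt(3)] lrbt d f show False by (auto simp: lin_def)
  qed
  define m where "m = - f1 / f2"
  have m0: "m \<noteq> 0" using f1 f2 by (simp add: m_def)
  have slope: "snd q - snd q' = m * (fst q - fst q')" if "q \<in> D" "q' \<in> D" for q q'
    using line[OF that(1)] line[OF that(2)] f2 unfolding lin_def m_def by (simp add: field_simps)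
  have bd: "0 \<le> fst q" "fst q \<le> dx" "0 \<le> snd q" "snd q \<le> dy" if "q \<in> D" for q
    using sub that by (auto simp: rectangle_def)
  have conv: "convex D" using pol by (auto simp: polygon_def)
  have pD: "p \<in> D"
    using p(2) uw conv by (meson convex_contains_open_segment subsetD)
  have pne: "p \<noteq> u" "p \<noteq> w" "u \<noteq> w" using p(2) by (auto simp: open_segment_def)
  have one: "\<exists>s. 0 < s \<and> s < 1 \<and> p = (1 - s) *\<^sub>R u + s *\<^sub>R w"
    using p(2) by (auto simp: in_segment)
  then obtain s where s: "0 < s" "s < 1" "p = (1 - s) *\<^sub>R u + s *\<^sub>R w" by blast
  have fuw: "fst u \<noteq> fst w"
    using slope[OF uw] pne(3) by (auto simp: prod_eq_iff)
  have fp: "0 < fst p" "fst p < dx"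
  proof -
    have "fst p = fst u + s * (fst w - fst u)" by (simp add: s(3) algebra_simps)
    moreover have "fst p = fst w - (1 - s) * (fst w - fst u)" by (simp add: s(3) algebra_simps)
    moreover have "fst u < fst w \<or> fst w < fst u" using fuw by linarith
    ultimately show "0 < fst p" "fst p < dx"
      using bd[OF uw(1)] bd[OF uw(2)] s(1,2)
      by (smt (verit) mult_pos_pos mult_pos_neg mult_less_0_iff)+
  qed
  obtain i j :: int where ij: "p = (of_int i, of_int j)" using p(1) by (auto simp: lattice_def)
  have i: "0 < i" "i < int dx" using fp by (auto simp: ij)
  have ncop: "\<not> coprime dx dy" if "j * int dx = i * int dy \<or> (int dy - j) * int dx = i * int dy"
  proof
    assume "coprime dx dy"
    then have "coprime (int dx) (int dy)" by simp
    moreover have "int dx dvd i * int dy" using that by (metis dvd_triv_right)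
    ultimately have "int dx dvd i" by (simp add: coprime_dvd_mult_left_iff)
    with i show False by (simp add: zdvd_not_zless)
  qed
  show ?thesis
  proof (cases "m > 0")
    case True
    \<comment> \<open>Positive slope: comparison with the point \<open>b\<close> on the bottom side
      shows that the leftmost point is also lowest; likewise the rightmost is highest.\<close>
    have "snd l \<le> 0" using slope[OF lrbt(5,1)] bd[OF lrbt(5)] True lrbt
      by (smt (verit) mult_nonneg_nonneg)
    then have l: "l = (0, 0)" using bd[OF lrbt(1)] lrbt by (simp add: prod_eq_iff)
    have "snd r \<ge> dy" using slope[OF lrbt(7,3)] bd[OF lrbt(7)] True lrbt
      by (smt (verit) mult_nonneg_nonpos)
    then have r: "r = (real dx, real dy)" using bd[OF lrbt(3)] lrbt by (simp add: prod_eq_iff)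
    have m: "real dy = m * real dx" using slope[OF lrbt(3,1)] by (simp add: l r)
    have sp: "snd q = m * fst q" if "q \<in> D" for q using slope[OF that lrbt(1)] by (simp add: l)
    have "D = closed_segment (0, 0) (real dx, real dy)"
    proof
      show "closed_segment (0, 0) (real dx, real dy) \<subseteq> D"
        using closed_segment_subset[OF lrbt(1,3) conv] by (simp add: l r)
      show "D \<subseteq> closed_segment (0, 0) (real dx, real dy)"
      proof
        fix q assume q: "q \<in> D"
        show "q \<in> closed_segment (0, 0) (real dx, real dy)"
          unfolding in_segment using bd[OF q] d sp[OF q] m
          by (intro exI[of _ "fst q / dx"]) (auto simp: prod_eq_iff)
      qed
    qed
    moreover have "real_of_int (j * int dx) = real_of_int (i * int dy)"
      using sp[OF pD] m by (simp add: ij)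
    then have "\<not> coprime dx dy" using ncop by (simp only: of_int_eq_iff) simp
    ultimately show ?thesis unfolding long_diagonal_def using d by blast
  next
    case False
    then have neg: "m < 0" using m0 by simp
    have "snd l \<ge> dy" using slope[OF lrbt(7,1)] bd[OF lrbt(7)] neg lrbt
      by (smt (verit) mult_nonpos_nonneg mult_nonneg_nonpos2)
    then have l: "l = (0, real dy)" using bd[OF lrbt(1)] lrbt by (simp add: prod_eq_iff)
    have "snd r \<le> 0" using slope[OF lrbt(5,3)] bd[OF lrbt(5)] neg lrbt
      by (smt (verit) mult_nonpos_nonpos)
    then have r: "r = (real dx, 0)" using bd[OF lrbt(3)] lrbt by (simp add: prod_eq_iff)
    have m: "real dy = - m * real dx" using slope[OF lrbt(3,1)] by (simp add: l r)
    have sp: "snd q = dy + m * fst q" if "q \<in> D" for q using slope[OF that lrbt(1)] by (simp add: l)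
    have "D = closed_segment (real dx, 0) (0, real dy)"
    proof
      show "closed_segment (real dx, 0) (0, real dy) \<subseteq> D"
        using closed_segment_subset[OF lrbt(3,1) conv] by (simp add: l r)
      show "D \<subseteq> closed_segment (real dx, 0) (0, real dy)"
      proof
        fix q assume q: "q \<in> D"
        define s where "s = fst q / dx"
        have s: "fst q = s * dx" using d by (simp add: s_def)
        have "0 \<le> s" "s \<le> 1" using bd[OF q] d by (auto simp: s_def)
        then show "q \<in> closed_segment (real dx, 0) (0, real dy)"
          unfolding in_segment using sp[OF q] m
          by (intro exI[of _ "1 - s"]) (auto simp: prod_eq_iff s algebra_simps)
      qed
    qed
    moreover have "real_of_int ((int dy - j) * int dx) = real_of_int (i * int dy)"
      using sp[OF pD] m by (simp add: ij)
    then have "\<not> coprime dx dy" using ncop by (simp only: of_int_eq_iff) simp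
    ultimately show ?thesis unfolding long_diagonal_def using d by blast
  qed
qed

text \<open>\<open>p\<close> lies in the open cone at \<open>v\<close> spanned by \<open>u\<close>
  and \<open>w\<close>, and a line through \<open>p\<close> separates \<open>v\<close> from
  \<open>D\<close>. Hence \<open>p\<close> is in the triangle \<open>v\<close>, \<open>u\<close>,
  \<open>w\<close> and not in the interior of \<open>D\<close>. If it is not interior to the larger
  hull either, a supporting line at \<open>p\<close> has to contain \<open>u\<close> and
  \<open>w\<close>; it then bounds \<open>D\<close> from the side opposite to the separating line,
  and \<open>D\<close> is a segment. \<open>e\<close> carries the orientation.\<close>

lemma no_new_interior_point:
  assumes D: "inscribed dx dy D" and uw: "u \<in> D" "w \<in> D" and p: "p \<in> lattice"
    and cr: "cross (w - v) (p - v) * e > 0" "cross (p - v) (u - v) * e > 0" "cross (w - v) (u - v) * e > 0"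
    and f: "lin f1 f2 v < lin f1 f2 p" "\<And>q. q \<in> D \<Longrightarrow> lin f1 f2 p \<le> lin f1 f2 q"
    and int: "interior_points (convex hull (insert v D)) = interior_points D"
  shows "long_diagonal D"
proof -
  have cD: "convex D" using D by (auto simp: inscribed_def polygon_def)
  have f0: "(f1, f2) \<noteq> (0, 0)" using f(1) by (auto simp: lin_def)
  have "p \<notin> interior D"
  proof
    assume "p \<in> interior D"
    then obtain q where "q \<in> D" "lin f1 f2 q < lin f1 f2 p"
      using f0 mem_interior_convex_iff[OF cD, of p] by metis
    with f(2)[of q] show False by simp
  qed
  then have "p \<notin> interior (convex hull (insert v D))"
    using int p by (auto simp: interior_points_def)
  then obtain a b where ab: "(a, b) \<noteq> (0, 0)"
    and nL: "\<not> (\<exists>q\<in>convex hull (insert v D). lin a b q < lin a b p)"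
    unfolding mem_interior_convex_iff[OF convex_convex_hull] not_all not_imp by (elim exE conjE) rule
  have L: "lin a b p \<le> lin a b q" if "q \<in> insert v D" for q
    using nL hull_inc[OF that, of convex] by (meson not_less)
  define \<Delta> where "\<Delta> = cross (w - v) (u - v)"
  have \<Delta>0: "\<Delta> \<noteq> 0" using cr(3) by (auto simp: \<Delta>_def)
  \<comment> \<open>Cramer's rule for p - v = \<alpha> (u - v) + \<beta> (w - v).\<close>
  define \<alpha> \<beta> where "\<alpha> = cross (w - v) (p - v) / \<Delta>" and "\<beta> = cross (p - v) (u - v) / \<Delta>"
  have pos: "\<alpha> > 0" "\<beta> > 0"
    using cr unfolding \<alpha>_def \<beta>_def \<Delta>_def[symmetric]
    by (auto simp: zero_less_divide_iff zero_less_mult_iff)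
  have rel: "fst p - fst v = \<alpha> * (fst u - fst v) + \<beta> * (fst w - fst v)"
            "snd p - snd v = \<alpha> * (snd u - snd v) + \<beta> * (snd w - snd v)"
    using \<Delta>0 unfolding \<alpha>_def \<beta>_def
    by (simp_all add: field_simps) (simp_all add: \<Delta>_def cross_def algebra_simps)
  have linrel: "lin c d p - lin c d v = \<alpha> * (lin c d u - lin c d v) + \<beta> * (lin c d w - lin c d v)" for c d
  proof -
    have "lin c d p - lin c d v = c * (fst p - fst v) + d * (snd p - snd v)"
      by (simp add: lin_def algebra_simps)
    then show ?thesis unfolding rel by (simp add: lin_def algebra_simps)
  qed
  have nondeg: "c = 0 \<and> d = 0" if "lin c d u = lin c d v" "lin c d w = lin c d v" for c d
  proof -
    have "c * (fst u - fst v) + d * (snd u - snd v) = 0" "c * (fst w - fst v) + d * (snd w - snd v) = 0"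
      using that by (simp_all add: lin_def algebra_simps)
    then have "c * \<Delta> = 0" "d * \<Delta> = 0" unfolding \<Delta>_def cross_def by (simp_all, algebra+)
    then show ?thesis using \<Delta>0 by simp
  qed
  have fu: "lin f1 f2 u \<ge> lin f1 f2 p" "lin f1 f2 w \<ge> lin f1 f2 p" using f(2) uw by auto
  \<comment> \<open>The separating functional is at least as high at \<open>u\<close> and
    \<open>w\<close> as at \<open>p\<close>, but lower at \<open>v\<close>; this forces \<alpha> +
    \<beta> \<le> 1, so \<open>p\<close> is in the triangle.\<close>
  have "\<alpha> * (lin f1 f2 p - lin f1 f2 v) \<le> \<alpha> * (lin f1 f2 u - lin f1 f2 v)"
       "\<beta> * (lin f1 f2 p - lin f1 f2 v) \<le> \<beta> * (lin f1 f2 w - lin f1 f2 v)"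
    using fu pos by (auto intro!: mult_left_mono)
  then have "(\<alpha> + \<beta>) * (lin f1 f2 p - lin f1 f2 v) \<le> lin f1 f2 p - lin f1 f2 v"
    unfolding distrib_right using linrel[of f1 f2] by linarith
  then have ab1: "\<alpha> + \<beta> \<le> 1" using f(1) by simp
  have Lle: "lin a b p \<le> lin a b v" "lin a b p \<le> lin a b u" "lin a b p \<le> lin a b w"
    using L uw by auto
  \<comment> \<open>\<open>p\<close> is a convex combination of \<open>u\<close>, \<open>w\<close>
    and \<open>v\<close>, and \<open>lin a b\<close> is minimal at \<open>p\<close>, so every term
    of this sum vanishes.\<close>
  have Leq: "\<alpha> * (lin a b u - lin a b p) + \<beta> * (lin a b w - lin a b p) + (1 - \<alpha> - \<beta>) * (lin a b v - lin a b p) = 0"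
    using linrel[of a b] by (simp add: algebra_simps)
  have nn: "\<alpha> * (lin a b u - lin a b p) \<ge> 0" "\<beta> * (lin a b w - lin a b p) \<ge> 0"
       "(1 - \<alpha> - \<beta>) * (lin a b v - lin a b p) \<ge> 0"
    using pos ab1 Lle by (auto intro!: mult_nonneg_nonneg)
  have "\<alpha> * (lin a b u - lin a b p) = 0" "\<beta> * (lin a b w - lin a b p) = 0"
       and z: "(1 - \<alpha> - \<beta>) * (lin a b v - lin a b p) = 0"
    using Leq nn by linarith+
  then have Luw: "lin a b u = lin a b p" "lin a b w = lin a b p" using pos by auto
  have Lv: "lin a b v \<noteq> lin a b p" using nondeg[of a b] Luw ab by auto
  then have ab2: "\<alpha> + \<beta> = 1" using z by simp
  have "\<alpha> * (lin f1 f2 u - lin f1 f2 p) + \<beta> * (lin f1 f2 w - lin f1 f2 p) = 0"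
    using linrel[of f1 f2] ab2 by (simp add: algebra_simps) (simp add: ab2 flip: distrib_right)
  moreover have "\<alpha> * (lin f1 f2 u - lin f1 f2 p) \<ge> 0" "\<beta> * (lin f1 f2 w - lin f1 f2 p) \<ge> 0"
    using pos fu by (auto intro!: mult_nonneg_nonneg)
  ultimately have "\<alpha> * (lin f1 f2 u - lin f1 f2 p) = 0" "\<beta> * (lin f1 f2 w - lin f1 f2 p) = 0"
    by linarith+
  then have fuw: "lin f1 f2 u = lin f1 f2 p" "lin f1 f2 w = lin f1 f2 p" using pos by auto
  have line: "lin f1 f2 q = lin f1 f2 p" if q: "q \<in> D" for q
  proof -
    \<comment> \<open>With this \<mu> the functional \<open>lin a b\<close> minus \<mu> times
      \<open>lin f1 f2\<close> takes equal values at \<open>u\<close>, \<open>w\<close> and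
      \<open>v\<close>, so it is zero by \<open>nondeg\<close>. As \<mu> is negative, the two
      functionals bound \<open>D\<close> from opposite sides.\<close>
    define \<mu> where "\<mu> = (lin a b v - lin a b p) / (lin f1 f2 v - lin f1 f2 p)"
    have \<mu>: "\<mu> < 0" using f(1) Lle(1) Lv unfolding \<mu>_def by (simp add: divide_pos_neg)
    have mul: "\<mu> * (lin f1 f2 v - lin f1 f2 p) = lin a b v - lin a b p"
      unfolding \<mu>_def using f(1) by simp
    have sub: "lin (a - \<mu> * f1) (b - \<mu> * f2) r = lin a b r - \<mu> * lin f1 f2 r" for r
      by (simp add: lin_def algebra_simps)
    have "lin (a - \<mu> * f1) (b - \<mu> * f2) u = lin (a - \<mu> * f1) (b - \<mu> * f2) v"
         "lin (a - \<mu> * f1) (b - \<mu> * f2) w = lin (a - \<mu> * f1) (b - \<mu> * f2) v"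
      unfolding sub Luw fuw using mul by (simp_all add: algebra_simps)
    from nondeg[OF this] have *: "lin a b r = \<mu> * lin f1 f2 r" for r using sub[of r] by (simp add: lin_def)
    have "\<mu> * lin f1 f2 p \<le> \<mu> * lin f1 f2 q" using L[of q] q by (simp flip: *)
    then have "lin f1 f2 q \<le> lin f1 f2 p" using \<mu> by (simp add: mult_le_cancel_left)
    then show ?thesis using f(2)[OF q] by simp
  qed
  have uwne: "u \<noteq> w" using \<Delta>0 by (auto simp: \<Delta>_def cross_def)
  have "p = (1 - \<beta>) *\<^sub>R u + \<beta> *\<^sub>R w"
  proof -
    have \<alpha>: "\<alpha> = 1 - \<beta>" using ab2 by simp
    show ?thesis using rel unfolding \<alpha> by (simp add: prod_eq_iff algebra_simps)
  qed
  then have "p \<in> open_segment u w"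
    unfolding in_segment using uwne pos ab2 by (intro conjI exI[of _ \<beta>]) auto
  from long_diagonal_of_collinear[OF D f0 line p this uw] show ?thesis by blast
qed

lemma lin_lattice_Ints: "q \<in> lattice \<Longrightarrow> a \<in> \<int> \<Longrightarrow> b \<in> \<int> \<Longrightarrow> lin a b q \<in> \<int>"
  by (auto simp: lattice_def lin_def)

lemma Ints_less_imp_add_one_le: "x \<in> \<int> \<Longrightarrow> y \<in> \<int> \<Longrightarrow> x < y \<Longrightarrow> x + 1 \<le> (y::real)"
  by (auto elim!: Ints_cases)

lemma convex_hull_insert_hull: "convex hull (insert v (convex hull V)) = convex hull (insert v V)"
proof
  show "convex hull (insert v (convex hull V)) \<subseteq> convex hull (insert v V)"
    by (intro hull_minimal convex_convex_hull) (auto simp: hull_inc intro: subsetD[OF hull_mono, rotated])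
  show "convex hull (insert v V) \<subseteq> convex hull (insert v (convex hull V))"
    by (intro hull_mono) (auto simp: hull_inc)
qed

text \<open>One addition step. The polygon is kept as the hull of a finite lattice set
  \<open>V\<close>, so that minima are attained at lattice points and integrality can be
  used.\<close>

locale polygon_extension =
  fixes dx dy :: nat and V :: "plane set" and v :: plane
  assumes V: "finite V" "V \<noteq> {}" "V \<subseteq> lattice" and v: "v \<in> lattice"
    and insc: "inscribed dx dy (convex hull V)"
    and int: "interior_points (convex hull (insert v V)) = interior_points (convex hull V)"
    and nld: "\<not> long_diagonal (convex hull V)"
begin

text \<open>\<open>no_new_interior_point\<close> in affine coordinates centred at \<open>v\<close>:
  x and z are linear functionals with nonzero determinant, by which cross products change. This
  determinant takes the place of \<open>e\<close> there.\<close>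

lemma no_new_point:
  assumes uw: "u \<in> V" "w \<in> V" and p: "p \<in> lattice" and e: "x1 * z2 - x2 * z1 \<noteq> (0::real)"
    and v': "lin x1 x2 v = X" "lin z1 z2 v = Z"
    and u': "lin x1 x2 u = X + ux" "lin z1 z2 u = Z + uz"
    and w': "lin x1 x2 w = X + wx" "lin z1 z2 w = Z + wz"
    and p': "lin x1 x2 p = X + px" "lin z1 z2 p = Z + pz"
    and cr: "wx * pz - wz * px > 0" "px * uz - pz * ux > 0" "wx * uz - wz * ux > 0"
    and f: "lin fx fy v < lin fx fy p" "\<And>q. q \<in> V \<Longrightarrow> lin fx fy p \<le> lin fx fy q"
  shows False
proof -
  define e where "e = x1 * z2 - x2 * z1"
  have c: "cross q r * e = lin x1 x2 q * lin z1 z2 r - lin z1 z2 q * lin x1 x2 r" for q r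
    by (simp add: e_def cross_def lin_def algebra_simps)
  have d: "lin a b (q - r) = lin a b q - lin a b r" for a b q r
    by (simp add: lin_def algebra_simps)
  have cD: "lin fx fy p \<le> lin fx fy q" if "q \<in> convex hull V" for q
    using lin_convex_hull_ge[OF that, of fx fy] f(2) by (meson order_trans)
  have "long_diagonal (convex hull V)"
    by (rule no_new_interior_point[OF insc hull_inc[OF uw(1)] hull_inc[OF uw(2)] p, of v e fx fy])
       (use cr f cD int in \<open>simp_all add: c d u' w' p' v' convex_hull_insert_hull\<close>)
  then show False using nld by simp
qed

text \<open>Here \<open>v\<close> lowers neither minimum, so a witness in \<open>V\<close> survives.
  Suppose only \<open>v\<close> is a witness. In the unimodular coordinates that measure
  \<open>f\<close> and \<open>g\<close> above their minima, every point of \<open>V\<close> has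
  coordinate sum at least 2 while \<open>v\<close> is (0, 0), (1, 0) or (0, 1). The point (1, 1),
  the minimisers of \<open>f\<close> and \<open>g\<close>, and the separating functional f + g then
  contradict \<open>no_new_point\<close>.\<close>

lemma good_insert_iff:
  assumes Ints: "f1 \<in> \<int>" "f2 \<in> \<int>" "g1 \<in> \<int>" "g2 \<in> \<int>" and det: "\<bar>f1 * g2 - f2 * g1\<bar> = 1"
    and f: "\<exists>q\<in>V. lin f1 f2 q \<le> lin f1 f2 v" and g: "\<exists>q\<in>V. lin g1 g2 q \<le> lin g1 g2 v"
  shows "good (lin f1 f2) (lin g1 g2) (insert v V) \<longleftrightarrow> good (lin f1 f2) (lin g1 g2) V"
proof
  assume "good (lin f1 f2) (lin g1 g2) V"
  then obtain p where p: "p \<in> V"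
    and *: "\<And>q q'. q \<in> V \<Longrightarrow> q' \<in> V \<Longrightarrow> lin f1 f2 p + lin g1 g2 p \<le> lin f1 f2 q + lin g1 g2 q' + 1"
    unfolding good_def by blast
  have F: "\<exists>q'\<in>V. lin f1 f2 q' \<le> lin f1 f2 q" if "q \<in> insert v V" for q using f that by auto
  have G: "\<exists>q'\<in>V. lin g1 g2 q' \<le> lin g1 g2 q" if "q \<in> insert v V" for q using g that by auto
  have "lin f1 f2 p + lin g1 g2 p \<le> lin f1 f2 q + lin g1 g2 q' + 1"
    if "q \<in> insert v V" "q' \<in> insert v V" for q q'
    using F[OF that(1)] G[OF that(2)] * by force
  then show "good (lin f1 f2) (lin g1 g2) (insert v V)" unfolding good_def using p by blast
next
  assume good: "good (lin f1 f2) (lin g1 g2) (insert v V)"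
  show "good (lin f1 f2) (lin g1 g2) V"
  proof (rule ccontr)
    assume bad: "\<not> good (lin f1 f2) (lin g1 g2) V"
    obtain u where u: "u \<in> V" "\<And>q. q \<in> V \<Longrightarrow> lin f1 f2 u \<le> lin f1 f2 q"
      using ex_is_arg_min_if_finite[OF V(1,2), of "lin f1 f2"] by (auto simp: is_arg_min_linorder)
    obtain w where w: "w \<in> V" "\<And>q. q \<in> V \<Longrightarrow> lin g1 g2 w \<le> lin g1 g2 q"
      using ex_is_arg_min_if_finite[OF V(1,2), of "lin g1 g2"] by (auto simp: is_arg_min_linorder)
    have Z: "lin f1 f2 q \<in> \<int>" "lin g1 g2 q \<in> \<int>" if "q \<in> insert v V" for q
      using that V(3) v Ints by (auto intro!: lin_lattice_Ints)
    have large: "lin f1 f2 p + lin g1 g2 p \<ge> lin f1 f2 u + lin g1 g2 w + 2" if p: "p \<in> V" for p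
    proof -
      obtain q q' where q: "q \<in> V" "q' \<in> V" "lin f1 f2 p + lin g1 g2 p > lin f1 f2 q + lin g1 g2 q' + 1"
        using bad p unfolding good_def by (meson not_le)
      have "lin f1 f2 u + lin g1 g2 w + 1 < lin f1 f2 p + lin g1 g2 p"
        using q u(2)[OF q(1)] w(2)[OF q(2)] by linarith
      moreover have "lin f1 f2 u + lin g1 g2 w + 1 \<in> \<int>" "lin f1 f2 p + lin g1 g2 p \<in> \<int>"
        using Z u(1) w(1) p by (auto intro!: Ints_add)
      ultimately show ?thesis using Ints_less_imp_add_one_le by fastforce
    qed
    obtain p where p: "p \<in> insert v V" "lin f1 f2 p + lin g1 g2 p \<le> lin f1 f2 u + lin g1 g2 w + 1"
      using good u(1) w(1) unfolding good_def by blast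
    have "p \<notin> V"
    proof
      assume "p \<in> V"
      from large[OF this] p(2) show False by linarith
    qed
    then have v1: "lin f1 f2 v + lin g1 g2 v \<le> lin f1 f2 u + lin g1 g2 w + 1" using p by simp
    have v0: "lin f1 f2 u \<le> lin f1 f2 v" "lin g1 g2 w \<le> lin g1 g2 v" using f g u(2) w(2) by (meson order_trans)+
    obtain a where a: "lin f1 f2 v = lin f1 f2 u + of_int a"
      using Ints_diff[OF Z(1)[of v] Z(1)[of u]] u(1) by (auto elim!: Ints_cases simp: algebra_simps)
    obtain b where b: "lin g1 g2 v = lin g1 g2 w + of_int b"
      using Ints_diff[OF Z(2)[of v] Z(2)[of w]] w(1) by (auto elim!: Ints_cases simp: algebra_simps)
    have ab: "0 \<le> a" "0 \<le> b" "a + b \<le> 1" using v0 v1 by (simp_all add: a b)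
    define e where "e = f1 * g2 - f2 * g1"
    have "e = 1 \<or> e = -1" using det by (auto simp: e_def)
    then have e: "e * e = 1" "e \<in> \<int>" by auto
    define h h' where "h = lin f1 f2 u + 1" and "h' = lin g1 g2 w + 1"
    have hh: "h \<in> \<int>" "h' \<in> \<int>" using Z u w by (auto simp: h_def h'_def)
    \<comment> \<open>The point at which both functionals are one above their minima. As
      \<open>e\<close> is 1 or -1, it is its own inverse in Cramer's rule, so the point is
      integral.\<close>
    define p where "p = (e * (g2 * h - f2 * h'), e * (f1 * h' - g1 * h))"
    have p: "p \<in> lattice"
    proof -
      have "fst p \<in> \<int>" "snd p \<in> \<int>" using e(2) Ints hh by (auto simp: p_def)
      then show ?thesis unfolding lattice_def by (cases p) (auto elim!: Ints_cases)
    qed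
    have "lin f1 f2 p = e * e * h" "lin g1 g2 p = e * e * h'"
      by (simp_all add: p_def lin_def e_def algebra_simps)
    then have pv: "lin f1 f2 p = h" "lin g1 g2 p = h'" by (simp_all add: e(1))
    have sum: "lin (f1 + g1) (f2 + g2) q = lin f1 f2 q + lin g1 g2 q" for q
      by (simp add: lin_def algebra_simps)
    have e0: "f1 * g2 - f2 * g1 \<noteq> 0" using det by auto
    have uu: "lin g1 g2 u \<ge> lin g1 g2 w + 2" using large[OF u(1)] by simp
    have ww: "lin f1 f2 w \<ge> lin f1 f2 u + 2" using large[OF w(1)] by simp
    have ab': "a = 0 \<and> b = 0 \<or> a = 1 \<and> b = 0 \<or> a = 0 \<and> b = 1" using ab by auto
    have large': "2 + (lin f1 f2 u + lin g1 g2 w) \<le> lin f1 f2 p + lin g1 g2 p" if "p \<in> V" for p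
      using large[OF that] by simp
    show False
      apply (rule no_new_point[OF u(1) w(1) p e0 refl refl, where fx = "f1 + g1" and fy = "f2 + g2"
        and ux = "- of_int a" and uz = "lin g1 g2 u - lin g1 g2 w - of_int b"
        and wx = "lin f1 f2 w - lin f1 f2 u - of_int a" and wz = "- of_int b"
        and px = "1 - of_int a" and pz = "1 - of_int b"])
      using ab' uu ww
      by (auto simp: a b pv h_def h'_def sum intro: mult_pos_pos large')
  qed
qed

text \<open>Write L k = j + k Z with Z = j - i. If \<open>v\<close> lowers L k or L (k + 1), let
  \<open>K\<close> be the first index whose functional is lowered, and use x = L K and z = Z, both
  taken relative to \<open>v\<close>, as coordinates. Ruling out new lattice points confines
  \<open>V\<close> to the cone 0 \<le> z \<le> x, x \<ge> 1, with a point on the ray x = z. There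
  both sets are good: \<open>v\<close> is a witness for the larger one, and a case distinction on
  the small lattice points of the cone finds a witness in \<open>V\<close>. The point
  \<open>w0\<close> contributes the bound x \<ge> (K + 1) z at one place.\<close>

lemma good_cones_insert_iff:
  fixes i1 i2 j1 j2 :: real
  defines "L \<equiv> \<lambda>k. lin (real (Suc k) * j1 - real k * i1) (real (Suc k) * j2 - real k * i2)"
  assumes axes: "(i1, i2, j1, j2) = (1, 0, 0, 1) \<or> (i1, i2, j1, j2) = (0, 1, 1, 0)"
    and b: "\<exists>q\<in>V. lin j1 j2 q \<le> lin j1 j2 v" and w0: "w0 \<in> V" "lin i1 i2 v \<le> lin i1 i2 w0"
  shows "good (L k) (L (Suc k)) (insert v V) \<longleftrightarrow> good (L k) (L (Suc k)) V"
proof -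
  define Z where "Z = lin (j1 - i1) (j2 - i2)"
  have Ints: "i1 \<in> \<int>" "i2 \<in> \<int>" "j1 \<in> \<int>" "j2 \<in> \<int>" using axes by auto
  have LZ: "L k q = lin j1 j2 q + real k * Z q" for k q
    by (simp add: L_def Z_def lin_def algebra_simps)
  have det: "\<bar>(real (Suc k) * j1 - real k * i1) * (real (Suc (Suc k)) * j2 - real (Suc k) * i2)
         - (real (Suc k) * j2 - real k * i2) * (real (Suc (Suc k)) * j1 - real (Suc k) * i1)\<bar> = 1" for k
    using axes by (auto simp: algebra_simps)
  show ?thesis
  proof (cases "(\<exists>q\<in>V. L k q \<le> L k v) \<and> (\<exists>q\<in>V. L (Suc k) q \<le> L (Suc k) v)")
    case True
    then show ?thesis
      unfolding L_def by (intro good_insert_iff det) (use Ints in \<open>auto simp del: of_nat_Suc\<close>)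
  next
    case False
    define low where "low = (\<lambda>K. \<forall>q\<in>V. L K v < L K q)"
    define K where "K = (LEAST K. low K)"
    have ex: "low k \<or> low (Suc k)" using False by (auto simp: low_def not_le)
    have K: "low K" unfolding K_def using ex by (metis LeastI)
    have Kk: "K \<le> Suc k" unfolding K_def using ex by (metis Least_le le_SucI)
    \<comment> \<open>Index 0 is the functional j, which \<open>v\<close> does not lower; so
      \<open>K\<close> has a predecessor, and \<open>u\<close> shows that this one is not
      lowered.\<close>
    have "\<not> low 0" using b by (auto simp: low_def LZ not_less)
    then obtain K' where K': "K = Suc K'" using K by (cases K) auto
    have "\<not> low K'" using not_less_Least[of K' low] unfolding K_def[symmetric] K' by simp
    then obtain u where u: "u \<in> V" "L K' u \<le> L K' v" by (auto simp: low_def not_less)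
    define X where "X = L K"
    have Xlin: "X = lin (real (Suc K) * j1 - real K * i1) (real (Suc K) * j2 - real K * i2)"
      by (simp add: X_def L_def)
    have Xdef: "X q = lin j1 j2 q + real K * Z q" for q by (simp add: X_def LZ)
    have XI: "X q = lin i1 i2 q + real (Suc K) * Z q" for q
      unfolding Xdef by (simp add: Z_def lin_def algebra_simps)
    have LX: "L n q = X q + (real n - real K) * Z q" for n q
      unfolding Xdef LZ by (simp add: algebra_simps)
    have XZi: "X q \<in> \<int>" "Z q \<in> \<int>" if "q \<in> insert v V" for q
      using that V(3) v Ints unfolding X_def L_def Z_def by (auto intro!: lin_lattice_Ints)
    have "\<exists>a::int. X q = X v + of_int a" if "q \<in> V" for q
      using Ints_diff[OF XZi(1)[of q] XZi(1)[of v]] that by (auto elim!: Ints_cases simp: algebra_simps)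
    then obtain x :: "plane \<Rightarrow> int" where x: "\<And>q. q \<in> V \<Longrightarrow> X q = X v + of_int (x q)" by metis
    have "\<exists>a::int. Z q = Z v + of_int a" if "q \<in> V" for q
      using Ints_diff[OF XZi(2)[of q] XZi(2)[of v]] that by (auto elim!: Ints_cases simp: algebra_simps)
    then obtain z :: "plane \<Rightarrow> int" where z: "\<And>q. q \<in> V \<Longrightarrow> Z q = Z v + of_int (z q)" by metis
    have point: "\<exists>P\<in>lattice. X P = X v + of_int a \<and> Z P = Z v + of_int c" for a c :: int
    proof -
      define P where "P = (if i1 = 1 then v + (of_int (a - (int K + 1) * c), of_int (a - int K * c))
          else v + (of_int (a - int K * c), of_int (a - (int K + 1) * c)))"
      obtain v1 v2 :: int where v12: "v = (of_int v1, of_int v2)" using v by (auto simp: lattice_def)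
      have "P \<in> lattice"
        unfolding lattice_def P_def v12 by (auto simp flip: of_int_add simp del: of_int_diff of_int_mult)
      moreover have "X P = X v + of_int a" "Z P = Z v + of_int c"
        using axes by (auto simp: Xdef Z_def lin_def P_def v12 algebra_simps)
      ultimately show ?thesis by blast
    qed
    have e: "(real (Suc K) * j1 - real K * i1) * (j2 - i2) - (real (Suc K) * j2 - real K * i2) * (j1 - i1) \<noteq> 0"
      using axes by (auto simp: algebra_simps)
    \<comment> \<open>A lattice point (a, c) strictly between the rays from \<open>v\<close> through
      \<open>q\<close> and \<open>p\<close> is excluded, provided all of \<open>V\<close> lies at or
      beyond the positive level x = a or z = c.\<close>
    have new: False if "p \<in> V" "q \<in> V"
      and cr: "x q * c - z q * a > 0" "a * z p - c * x p > 0" "x q * z p - z q * x p > 0"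
      and f: "(0 < a \<and> (\<forall>r\<in>V. a \<le> x r)) \<or> (0 < c \<and> (\<forall>r\<in>V. c \<le> z r))" for p q and a c :: int
    proof -
      obtain P where P: "P \<in> lattice" "X P = X v + of_int a" "Z P = Z v + of_int c" using point by blast
      have cr': "real_of_int (x q) * of_int c - of_int (z q) * of_int a > 0"
         "real_of_int a * of_int (z p) - of_int c * of_int (x p) > 0"
         "real_of_int (x q) * of_int (z p) - of_int (z q) * of_int (x p) > 0"
        using cr by (simp_all flip: of_int_mult of_int_diff)
      note np = no_new_point[OF that(1,2) P(1) e, folded Xlin Z_def,
          OF refl refl x[OF that(1)] z[OF that(1)] x[OF that(2)] z[OF that(2)] P(2,3) cr']
      from f show False
      proof
        assume "0 < a \<and> (\<forall>r\<in>V. a \<le> x r)"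
        then show False
          by (intro np[of "real (Suc K) * j1 - real K * i1" "real (Suc K) * j2 - real K * i2"])
             (simp_all add: Xlin[symmetric] P x del: of_nat_Suc)
      next
        assume "0 < c \<and> (\<forall>r\<in>V. c \<le> z r)"
        then show False
          by (intro np[of "j1 - i1" "j2 - i2"]) (simp_all add: Z_def[symmetric] P z)
      qed
    qed
    have x1: "x q \<ge> 1" if "q \<in> V" for q
      using K that x[OF that] by (auto simp: low_def X_def)
    have ux: "x u \<le> z u" using u(2) x[OF u(1)] z[OF u(1)] by (simp add: LX K')
    have wx: "x w0 \<ge> (int K + 1) * z w0"
    proof -
      have "real_of_int (x w0) \<ge> real_of_int ((int K + 1) * z w0)"
        using w0(2) x[OF w0(1)] z[OF w0(1)] XI[of w0] XI[of v] by (simp add: algebra_simps)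
      then show ?thesis by (simp only: of_int_le_iff)
    qed
    \<comment> \<open>Otherwise (1, 0) would be a new point between \<open>q\<close> and
      \<open>u\<close>.\<close>
    have z0: "z q \<ge> 0" if q: "q \<in> V" for q
    proof (rule ccontr)
      assume "\<not> z q \<ge> 0"
      then show False
        using new[OF u(1) q, of 0 1] x1[OF q] x1[OF u(1)] ux x1
        by (smt (verit) mult_pos_pos mult_neg_pos)
    qed
    have wz: "x w0 > z w0"
    proof -
      have "(int K + 1) * z w0 \<ge> 2 * z w0" using K' z0[OF w0(1)] by (intro mult_right_mono) auto
      then show ?thesis using wx x1[OF w0(1)] z0[OF w0(1)] by linarith
    qed
    \<comment> \<open>Otherwise (1, 1) would be a new point between \<open>w0\<close> and
      \<open>q\<close>.\<close>
    have xz: "z q \<le> x q" if q: "q \<in> V" for q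
    proof (rule ccontr)
      assume *: "\<not> z q \<le> x q"
      have "z w0 * x q < x w0 * z q"
        using * wz x1[OF q] z0[OF w0(1)] by (intro mult_strict_mono') auto
      then show False
        using new[OF q w0(1), of 1 1] * wz x1 by simp
    qed
    have uxz: "x u = z u" using ux xz[OF u(1)] by simp
    \<comment> \<open>Up to constants, L k and L (k + 1) are x + m z and x + (m + 1) z. The first
      lowered index may be k + 1, so m can be -1, which needs its own treatment below.\<close>
    define m where "m = int k - int K"
    have m: "m \<ge> -1" using Kk by (simp add: m_def)
    have Lk: "L k q = L k v + of_int (x q + m * z q)" "L (Suc k) q = L (Suc k) v + of_int (x q + (m + 1) * z q)"
      if "q \<in> V" for q
      using x[OF that] z[OF that] by (simp_all add: LX m_def algebra_simps)
    have lower: "x q + m * z q \<ge> 0" "x q + (m + 1) * z q \<ge> 1" if "q \<in> V" for q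
    proof -
      have "m * z q \<ge> - z q" "(m + 1) * z q \<ge> 0"
        using mult_right_mono[OF m z0[OF that]] z0[OF that] m by simp_all
      then show "x q + m * z q \<ge> 0" "x q + (m + 1) * z q \<ge> 1"
        using xz[OF that] x1[OF that] by linarith+
    qed
    have vle: "L k v \<le> L k q" "L (Suc k) v \<le> L (Suc k) q" if "q \<in> insert v V" for q
      using that Lk lower by auto (smt (verit, ccfv_threshold) Lk(1) Lk(2) lower of_int_nonneg)+
    have "good (L k) (L (Suc k)) (insert v V)"
      unfolding good_def
    proof (intro bexI[of _ v] ballI)
      fix q q' assume "q \<in> insert v V" "q' \<in> insert v V"
      from vle(1)[OF this(1)] vle(2)[OF this(2)]
      show "L k v + L (Suc k) v \<le> L k q + L (Suc k) q' + 1" by linarith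
    qed simp
    moreover have "good (L k) (L (Suc k)) V"
    proof -
      have goodI: "good (L k) (L (Suc k)) V" if p: "p \<in> V"
        and le: "\<And>q q'. q \<in> V \<Longrightarrow> q' \<in> V \<Longrightarrow>
          (x p + m * z p) + (x p + (m + 1) * z p) \<le> (x q + m * z q) + (x q' + (m + 1) * z q') + 1" for p
        unfolding good_def
      proof (intro bexI[OF _ p] ballI)
        fix q q' assume q: "q \<in> V" "q' \<in> V"
        have "real_of_int ((x p + m * z p) + (x p + (m + 1) * z p)) \<le> of_int ((x q + m * z q) + (x q' + (m + 1) * z q') + 1)"
          using le[OF q] by (simp only: of_int_le_iff)
        then show "L k p + L (Suc k) p \<le> L k q + L (Suc k) q' + 1"
          unfolding Lk[OF p] Lk[OF q(1)] Lk[OF q(2)] by simp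
      qed
      have goodI': "good (L k) (L (Suc k)) V" if p: "p \<in> V"
        and le: "\<And>q. q \<in> V \<Longrightarrow>
          x p + m * z p \<le> x q + m * z q \<and> x p + (m + 1) * z p \<le> x q + (m + 1) * z q" for p
      proof (rule goodI[OF p])
        fix q q' assume "q \<in> V" "q' \<in> V"
        from le[OF this(1)] le[OF this(2)]
        show "x p + m * z p + (x p + (m + 1) * z p) \<le> x q + m * z q + (x q' + (m + 1) * z q') + 1"
          by linarith
      qed
      have mz: "m * z q \<ge> m" if "q \<in> V" "z q \<ge> 1" "m \<ge> 0" for q
        using that by (metis mult_left_mono mult.right_neutral)
      have mz': "(m + 1) * z q \<ge> m + 1" if "q \<in> V" "z q \<ge> 1" for q
        using that m mult_left_mono[of 1 "z q" "m + 1"] by simp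
      \<comment> \<open>(1, 0) and (1, 1) are the only lattice points of the cone with x =
        1.\<close>
      consider (a) p where "p \<in> V" "x p = 1" "z p = 0" | (b) p where "p \<in> V" "x p = 1" "z p = 1"
        | (c) "\<And>q. q \<in> V \<Longrightarrow> x q \<ge> 2"
        using x1 z0 xz by (smt (verit))
      then show ?thesis
      proof cases
        case a
        show ?thesis
        proof (rule goodI[OF a(1)])
          fix q q' assume "q \<in> V" "q' \<in> V"
          with lower(1)[of q] lower(2)[of q'] a
          show "x p + m * z p + (x p + (m + 1) * z p) \<le> x q + m * z q + (x q' + (m + 1) * z q') + 1" by simp
        qed
      next
        case b
        show ?thesis
        proof (cases "m = -1")
          case True
          show ?thesis
          proof (rule goodI[OF b(1)])
            fix q q' assume "q \<in> V" "q' \<in> V"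
            with lower(1)[of q] lower(2)[of q'] b True
            show "x p + m * z p + (x p + (m + 1) * z p) \<le> x q + m * z q + (x q' + (m + 1) * z q') + 1" by simp
          qed
        next
          case False
          then have m0: "m \<ge> 0" using m by simp
          show ?thesis
          \<comment> \<open>A point with z = 0 and x \<le> m + 1 is at most as high as every point
            with z \<ge> 1, so the lowest such point minimises both functionals. Without such a
            point, (1, 1) does.\<close>
          proof (cases "\<exists>q\<in>V. z q = 0 \<and> x q \<le> m + 1")
            case True
            define W where "W = {q\<in>V. z q = 0}"
            have W: "finite W" "W \<noteq> {}" using True V(1) by (auto simp: W_def)
            obtain g where g: "g \<in> W" "\<And>q. q \<in> W \<Longrightarrow> x g \<le> x q"
              using ex_is_arg_min_if_finite[OF W, of x] by (auto simp: is_arg_min_linorder)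
            have g': "g \<in> V" "z g = 0" "x g \<le> m + 1" using g True by (auto simp: W_def intro: order_trans)
            have "x g \<le> x q + m * z q \<and> x g \<le> x q + (m + 1) * z q" if "q \<in> V" for q
            proof (cases "z q = 0")
              case True
              then show ?thesis using g(2)[of q] that by (simp add: W_def)
            next
              case False
              then have "z q \<ge> 1" using z0[OF that] by simp
              then show ?thesis using mz[OF that _ m0] mz'[OF that] g'(3) x1[OF that] by force
            qed
            then show ?thesis by (intro goodI'[OF g'(1)]) (use g'(2) in simp)
          next
            case no: False
            have "1 + m \<le> x q + m * z q \<and> 2 + m \<le> x q + (m + 1) * z q" if "q \<in> V" for q
            proof (cases "z q = 0")
              case True
              then show ?thesis using no that by auto
            next
              case False
              then have "z q \<ge> 1" using z0[OF that] by simp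
              then show ?thesis using mz[OF that _ m0] mz'[OF that] x1[OF that] by force
            qed
            then show ?thesis by (intro goodI'[OF b(1)]) (use b in simp)
          qed
        qed
      next
        case c
        \<comment> \<open>Otherwise (2, 1) would be a new point between \<open>q\<close> and
          \<open>u\<close>.\<close>
        have x2: "x q \<le> 2 * z q" if q: "q \<in> V" for q
        proof (rule ccontr)
          assume *: "\<not> x q \<le> 2 * z q"
          have "z q * x u < x q * x u" using * x1[OF u(1)] z0[OF q] by (intro mult_strict_right_mono) auto
          then show False
            using new[OF u(1) q, of 1 2] * x1[OF u(1)] c by (simp add: uxz)
        qed
        have z1: "z q \<ge> 1" if "q \<in> V" for q using x2[OF that] c[OF that] by simp
        \<comment> \<open>The bound at \<open>w0\<close> is compatible with x \<le> 2 z only for K =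
          1, and then \<open>w0\<close> lies on the ray x = 2 z.\<close>
        have "(int K + 1) * z w0 \<le> 2 * z w0" using wx x2[OF w0(1)] by linarith
        then have K1: "K = 1" using z1[OF w0(1)] K' by (simp add: mult_le_cancel_right)
        then have w2: "x w0 = 2 * z w0" using wx x2[OF w0(1)] by simp
        show ?thesis
        proof (cases "\<exists>p\<in>V. x p = 2 \<and> z p = 1")
          case True
          then obtain p where p: "p \<in> V" "x p = 2" "z p = 1" by blast
          show ?thesis
          proof (cases "m = -1")
            case True
            show ?thesis
            proof (rule goodI[OF p(1)])
              fix q q' assume "q \<in> V" "q' \<in> V"
              with lower(1)[of q] c[of q'] p True
              show "x p + m * z p + (x p + (m + 1) * z p) \<le> x q + m * z q + (x q' + (m + 1) * z q') + 1" by simp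
            qed
          next
            case False
            then have m0: "m \<ge> 0" using m by simp
            have "2 + m \<le> x q + m * z q \<and> 3 + m \<le> x q + (m + 1) * z q" if "q \<in> V" for q
              using mz[OF that z1[OF that] m0] mz'[OF that z1[OF that]] c[OF that] by linarith
            then show ?thesis by (intro goodI'[OF p(1)]) (use p in simp)
          qed
        next
          case False
          have z2: "z q \<ge> 2" if q: "q \<in> V" for q
          proof (rule ccontr)
            assume "\<not> z q \<ge> 2"
            then have "z q = 1" using z1[OF q] by simp
            moreover from this have "x q = 2" using x2[OF q] c[OF q] by simp
            ultimately show False using False q by blast
          qed
          \<comment> \<open>All of \<open>V\<close> now has z \<ge> 2, and (3, 2) lies strictly
            between the ray x = z through \<open>u\<close> and the ray x = 2 z through
            \<open>w0\<close>, so it would be a new point.\<close>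
          have "z u * z w0 > 0" using z1[OF u(1)] z1[OF w0(1)] by (intro mult_pos_pos) auto
          then have False
            using new[OF u(1) w0(1), of 2 3] z1[OF u(1)] z1[OF w0(1)] z2 by (simp add: uxz w2 algebra_simps)
          then show ?thesis ..
        qed
      qed
    qed
    ultimately show ?thesis by blast
  qed
qed

end

text \<open>The three conditions belong to the corners (0, 0), (\<infinity>, 0) and (0,
  \<infinity>). At infinity the local exponent is d - i, hence the minus signs; the constants d drop
  out of \<open>good\<close>. Consecutive functionals of a list have determinant 1 or -1.\<close>

definition admissible_polygon :: "plane set \<Rightarrow> bool" where
  "admissible_polygon D \<longleftrightarrow> good (lin 1 0) (lin 0 1) D
     \<and> (\<forall>k. good (lin (- real k) (real (Suc k))) (lin (- real (Suc k)) (real (Suc (Suc k)))) D)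
     \<and> (\<forall>k. good (lin (real (Suc k)) (- real k)) (lin (real (Suc (Suc k))) (- real (Suc k))) D)"

lemma inscribed_convex_hullD:
  assumes "inscribed dx dy (convex hull V)"
  shows "\<exists>p\<in>V. fst p = 0" "\<exists>p\<in>V. fst p = real dx" "\<exists>p\<in>V. snd p = 0" "\<exists>p\<in>V. snd p = real dy"
    and "V \<subseteq> rectangle dx dy"
proof -
  have VD: "V \<subseteq> convex hull V" by (rule hull_subset)
  have sub: "V \<subseteq> rectangle dx dy" using assms VD by (auto simp: inscribed_def)
  have bd: "0 \<le> fst p \<and> fst p \<le> dx \<and> 0 \<le> snd p \<and> snd p \<le> dy" if "p \<in> V" for p
    using sub that by (auto simp: rectangle_def)
  have *: "\<exists>v\<in>V. lin a b v = c" if "\<exists>p\<in>convex hull V. lin a b p = c" "\<And>p. p \<in> V \<Longrightarrow> c \<le> lin a b p" for a b c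
    using that lin_convex_hull_ge[of _ V a b] by (metis order_antisym)
  show "V \<subseteq> rectangle dx dy" by (fact sub)
  have "\<exists>p\<in>V. lin 1 0 p = 0" by (rule *) (use assms bd in \<open>auto simp: inscribed_def lin_def\<close>)
  then show "\<exists>p\<in>V. fst p = 0" by (simp add: lin_def)
  have "\<exists>p\<in>V. lin (-1) 0 p = - real dx"
    by (rule *) (use assms bd in \<open>auto simp: inscribed_def lin_def\<close>)
  then show "\<exists>p\<in>V. fst p = real dx" by (simp add: lin_def)
  have "\<exists>p\<in>V. lin 0 1 p = 0" by (rule *) (use assms bd in \<open>auto simp: inscribed_def lin_def\<close>)
  then show "\<exists>p\<in>V. snd p = 0" by (simp add: lin_def)
  have "\<exists>p\<in>V. lin 0 (-1) p = - real dy"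
    by (rule *) (use assms bd in \<open>auto simp: inscribed_def lin_def\<close>)
  then show "\<exists>p\<in>V. snd p = real dy" by (simp add: lin_def)
qed

lemma nat_lattice_subset: "nat_lattice \<subseteq> lattice"
proof
  fix x assume "x \<in> nat_lattice"
  then obtain a b :: nat where "x = (real a, real b)" by (auto simp: nat_lattice_def)
  then have "x = (of_int (int a), of_int (int b))" by simp
  then show "x \<in> lattice" unfolding lattice_def by blast
qed

text \<open>The generators on the right and upper sides are the far points \<open>w0\<close> of
  \<open>good_cones_insert_iff\<close>; those on the left and lower sides show that \<open>v\<close>
  lowers neither coordinate.\<close>

lemma admissible_polygon_add_point:
  assumes D: "inscribed dx dy D" and ext: "v \<in> rectangle dx' dy' \<inter> lattice" "inscribed dx' dy' (add_point D v)"
    and D': "inscribed dx' dy' D"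
    and int: "interior_points D = interior_points (add_point D v)" and nld: "\<not> long_diagonal D"
  shows "admissible_polygon (add_point D v) \<longleftrightarrow> admissible_polygon D"
proof -
  obtain V where V: "finite V" "V \<noteq> {}" "V \<subseteq> nat_lattice" "D = convex hull V"
    using D by (auto simp: inscribed_def polygon_def)
  have add: "add_point D v = convex hull (insert v V)"
    unfolding add_point_def V(4) by (rule convex_hull_insert_hull)
  note DV = V(4)
  interpret polygon_extension dx' dy' V v
  proof
    show "interior_points (convex hull insert v V) = interior_points (convex hull V)"
      unfolding add[symmetric] V(4)[symmetric] using int by simp
  qed (use V ext D' nld nat_lattice_subset in auto)
  obtain l r b t where lrbt: "l \<in> V" "fst l = 0" "r \<in> V" "fst r = real dx'" "b \<in> V" "snd b = 0"
      "t \<in> V" "snd t = real dy'"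
    using inscribed_convex_hullD(1-4)[OF insc] by (elim bexE) rule
  have bv: "0 \<le> fst v" "fst v \<le> dx'" "0 \<le> snd v" "snd v \<le> dy'"
    using ext(1) by (auto simp: rectangle_def)
  have low: "\<exists>q\<in>V. fst q \<le> fst v" "\<exists>q\<in>V. snd q \<le> snd v"
    using lrbt bv by (auto intro: bexI[of _ l] bexI[of _ b])
  have "good (lin 1 0) (lin 0 1) (insert v V) \<longleftrightarrow> good (lin 1 0) (lin 0 1) V"
    by (rule good_insert_iff) (use low in \<open>auto simp: lin_def\<close>)
  moreover have "good (lin (- real k) (real (Suc k))) (lin (- real (Suc k)) (real (Suc (Suc k)))) (insert v V)
     \<longleftrightarrow> good (lin (- real k) (real (Suc k))) (lin (- real (Suc k)) (real (Suc (Suc k)))) V" for k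
    using good_cones_insert_iff[of 1 0 0 1 r k] lrbt bv low by (auto simp: lin_def simp del: of_nat_Suc)
  moreover have "good (lin (real (Suc k)) (- real k)) (lin (real (Suc (Suc k))) (- real (Suc k))) (insert v V)
     \<longleftrightarrow> good (lin (real (Suc k)) (- real k)) (lin (real (Suc (Suc k))) (- real (Suc k))) V" for k
    using good_cones_insert_iff[of 0 1 1 0 t k] lrbt bv low by (auto simp: lin_def simp del: of_nat_Suc)
  ultimately show ?thesis unfolding admissible_polygon_def add good_convex_hull unfolding DV good_convex_hull by blast
qed

lemma inscribed_unique:
  assumes "inscribed dx dy D" "inscribed dx' dy' D"
  shows "dx = dx'" "dy = dy'"
proof -
  have *: "real dx \<le> real dx' \<and> real dy \<le> real dy'" if a: "inscribed dx dy D" and b: "inscribed dx' dy' D" for dx dy dx' dy'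
  proof -
    obtain r t where "r \<in> D" "fst r = dx" "t \<in> D" "snd t = dy" using a unfolding inscribed_def by metis
    moreover from this have "r \<in> rectangle dx' dy'" "t \<in> rectangle dx' dy'"
      using b by (auto simp: inscribed_def)
    ultimately show ?thesis by (auto simp: rectangle_def)
  qed
  show "dx = dx'" "dy = dy'" using *[OF assms] *[OF assms(2,1)] by auto
qed

text \<open>A removal is an addition read backwards, with the smaller polygon as starting point; so
  either end may be the one that must not be a long diagonal.\<close>

lemma admissible_polygon_step:
  assumes "polygon_step D D'" "\<not> long_diagonal D" "\<not> long_diagonal D'"
  shows "admissible_polygon D \<longleftrightarrow> admissible_polygon D'"
  using assms(1) unfolding polygon_step_def
proof (elim disjE exE conjE)
  fix v assume a: "addible D v" and D': "D' = add_point D v"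
  obtain dx dy where d: "inscribed dx dy D" "v \<in> rectangle dx dy \<inter> lattice"
    using a by (auto simp: addible_def)
  obtain ex ey where e: "inscribed ex ey D" "inscribed ex ey (add_point D v)"
      "interior_points D = interior_points (add_point D v)"
    using a by (auto simp: addible_def equivalent_def)
  show ?thesis
    using admissible_polygon_add_point[OF d(1), of v ex ey] d e inscribed_unique[OF d(1) e(1)] assms D' by simp
next
  fix v assume a: "removal D v D'"
  obtain dx dy where d: "inscribed dx dy D" "v \<in> rectangle dx dy \<inter> lattice" and D: "D = add_point D' v"
    using a by (auto simp: removal_def)
  obtain ex ey where e: "inscribed ex ey D" "inscribed ex ey D'" "interior_points D = interior_points D'"
    using a by (auto simp: removal_def equivalent_def)
  show ?thesis
    using admissible_polygon_add_point[OF e(2), of v ex ey] d e inscribed_unique[OF d(1) e(1)] assms D by simp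
qed

lemma admissible_polygon_strongly_equivalent:
  assumes "strongly_equivalent D D'" "\<And>E. strongly_equivalent D E \<Longrightarrow> \<not> long_diagonal E"
  shows "admissible_polygon D \<longleftrightarrow> admissible_polygon D'"
proof -
  have ins: "\<exists>dx dy. inscribed dx dy D" and steps: "polygon_step\<^sup>*\<^sup>* D D'"
    using assms(1) by (auto simp: strongly_equivalent_def)
  have insE: "\<exists>dx dy. inscribed dx dy E'" if "polygon_step E E'" for E E'
    using that by (auto simp: polygon_step_def addible_def removal_def equivalent_def)
  from steps show ?thesis
  proof induction
    case (step E E')
    have "\<exists>dx dy. inscribed dx dy E" using step(1) ins insE by (cases rule: rtranclp.cases) auto
    then have "strongly_equivalent D E" "strongly_equivalent D E'"
      using ins step(1,2) insE[OF step(2)] by (auto simp: strongly_equivalent_def)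
    then show ?case using step assms(2) admissible_polygon_step by blast
  qed simp
qed

section \<open>Faces and corners of nondegenerate curves\<close>

definition primitive_segment :: "plane set \<Rightarrow> bool" where
  "primitive_segment e \<longleftrightarrow> (\<exists>p q. p \<noteq> q \<and> e = closed_segment p q \<and> e \<inter> lattice = {p, q})"

text \<open>Induction on the number of lattice points: one that is not an endpoint splits the
  segment into two with fewer.\<close>

lemma closed_segment_lattice_union:
  assumes "finite (closed_segment a b \<inter> lattice)" "a \<in> lattice" "b \<in> lattice" "a \<noteq> b"
  shows "\<exists>E. (\<forall>e\<in>E. primitive_segment e) \<and> closed_segment a b = \<Union> E"
  using assms
proof (induction "card (closed_segment a b \<inter> lattice)" arbitrary: a b rule: less_induct)
  case less
  show ?case
  proof (cases "closed_segment a b \<inter> lattice = {a, b}")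
    case True
    then have "primitive_segment (closed_segment a b)"
      unfolding primitive_segment_def using less.prems(4) by blast
    then show ?thesis by (intro exI[of _ "{closed_segment a b}"]) simp
  next
    case False
    then obtain c where c: "c \<in> closed_segment a b" "c \<in> lattice" "c \<noteq> a" "c \<noteq> b"
      using less.prems by auto
    have un: "closed_segment a b = closed_segment a c \<union> closed_segment c b"
      using Un_closed_segment[OF c(1)] by simp
    have b: "b \<notin> closed_segment a c" and a: "a \<notin> closed_segment c b"
      using c(1,3,4) by (metis between_antisym between_commute between_mem_segment)+
    have "card (closed_segment a c \<inter> lattice) < card (closed_segment a b \<inter> lattice)"
      by (rule psubset_card_mono[OF less.prems(1)]) (use un b less.prems in auto)
    moreover have "card (closed_segment c b \<inter> lattice) < card (closed_segment a b \<inter> lattice)"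
      by (rule psubset_card_mono[OF less.prems(1)]) (use un a less.prems in auto)
    moreover have "finite (closed_segment a c \<inter> lattice)" "finite (closed_segment c b \<inter> lattice)"
      using less.prems(1) un by (auto elim: rev_finite_subset)
    ultimately obtain E F where
      "\<forall>e\<in>E. primitive_segment e" "closed_segment a c = \<Union> E"
      "\<forall>e\<in>F. primitive_segment e" "closed_segment c b = \<Union> F"
      using less.hyps[of a c] less.hyps[of c b] less.prems c by metis
    then show ?thesis unfolding un by (intro exI[of _ "E \<union> F"]) blast
  qed
qed

lemma finite_lattice_bounded:
  assumes "bounded S"
  shows "finite (S \<inter> lattice)"
proof -
  obtain B where B: "\<And>x. x \<in> S \<Longrightarrow> norm x \<le> B" using assms bounded_iff by blast
  have "S \<inter> lattice \<subseteq> (\<lambda>(a, b). (of_int a, of_int b)) ` ({-\<lceil>B\<rceil>..\<lceil>B\<rceil>} \<times> {-\<lceil>B\<rceil>..\<lceil>B\<rceil>})"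
  proof
    fix x assume x: "x \<in> S \<inter> lattice"
    then obtain a b :: int where ab: "x = (of_int a, of_int b)" by (auto simp: lattice_def)
    have "\<bar>real_of_int a\<bar> \<le> B" "\<bar>real_of_int b\<bar> \<le> B"
      using B[of x] x norm_fst_le[of "real_of_int a" "real_of_int b"] norm_snd_le[of "real_of_int b" "real_of_int a"]
      by (auto simp: ab)
    then have "\<bar>a\<bar> \<le> \<lceil>B\<rceil>" "\<bar>b\<bar> \<le> \<lceil>B\<rceil>" by linarith+
    then show "x \<in> (\<lambda>(a, b). (of_int a, of_int b)) ` ({-\<lceil>B\<rceil>..\<lceil>B\<rceil>} \<times> {-\<lceil>B\<rceil>..\<lceil>B\<rceil>})"
      unfolding ab by (intro image_eqI[of _ _ "(a, b)"]) auto
  qed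
  then show ?thesis by (rule finite_subset) simp
qed

text \<open>The link between faces cut out by minimal functionals and the maximal edges in
  \<open>nondegenerate\<close>. The generators on the supporting line are ordered along it by
  \<open>g\<close>, so their hull is a segment between two lattice points and splits into primitive
  segments. A longer segment inside the polygon would stay on the line, hence in the face.\<close>

lemma maximal_edge_face:
  fixes V :: "plane set"
  assumes V: "finite V" "V \<subseteq> lattice" and pq: "p \<in> V" "q \<in> V" "p \<noteq> q"
    and f: "(f1, f2) \<noteq> (0, 0)" "lin f1 f2 p = h" "lin f1 f2 q = h" "\<And>r. r \<in> V \<Longrightarrow> h \<le> lin f1 f2 r"
  shows "maximal_edge (convex hull V) (convex hull V \<inter> {r. lin f1 f2 r = h})"
proof -
  define D where "D = convex hull V"
  define T where "T = D \<inter> {r. lin f1 f2 r = h}"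
  define W where "W = V \<inter> {r. lin f1 f2 r = h}"
  define g where "g = lin (- f2) f1"
  have cD: "convex D" "compact D" using V by (auto simp: D_def compact_convex_hull finite_imp_compact)
  have Dge: "h \<le> lin f1 f2 r" if "r \<in> D" for r
    using lin_convex_hull_ge[of r V f1 f2] that f(4) unfolding D_def by (meson order_trans)
  have n: "f1 * f1 + f2 * f2 > 0"
    using f(1) by (auto simp: sum_squares_gt_zero_iff)
  have gconv: "r = (1 - t) *\<^sub>R a + t *\<^sub>R b"
    if "lin f1 f2 r = h" "lin f1 f2 a = h" "lin f1 f2 b = h" "g r = (1 - t) * g a + t * g b" for r a b t
  proof -
    define z where "z = r - ((1 - t) *\<^sub>R a + t *\<^sub>R b)"
    have "lin f1 f2 z = lin f1 f2 r - ((1 - t) * lin f1 f2 a + t * lin f1 f2 b)"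
         "g z = g r - ((1 - t) * g a + t * g b)"
      by (simp_all add: z_def lin_def g_def algebra_simps)
    then have "lin f1 f2 z = 0" "g z = 0" using that by (simp_all add: algebra_simps)
    then have z: "f1 * fst z + f2 * snd z = 0" "f1 * snd z - f2 * fst z = 0"
      by (simp_all add: lin_def g_def)
    have "(f1 * f1 + f2 * f2) * fst z = 0" "(f1 * f1 + f2 * f2) * snd z = 0" using z by algebra+
    then have "z = 0" using n by (auto simp: prod_eq_iff)
    then show ?thesis by (simp add: z_def)
  qed
  have W: "finite W" "p \<in> W" "q \<in> W" using V pq f by (auto simp: W_def)
  obtain a where a: "a \<in> W" "\<And>r. r \<in> W \<Longrightarrow> g a \<le> g r"
    using ex_is_arg_min_if_finite[of W g] W by (auto simp: is_arg_min_linorder)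
  obtain b where b: "b \<in> W" "\<And>r. r \<in> W \<Longrightarrow> g r \<le> g b"
    using ex_is_arg_min_if_finite[of W "\<lambda>r. - g r"] W by (auto simp: is_arg_min_linorder)
  have ab: "a \<noteq> b"
  proof
    assume "a = b"
    then have "g p = g q" using a b W by (metis order_antisym)
    then have "p = q" using gconv[of p q q 0] f by simp
    then show False using pq by simp
  qed
  have gab: "g a < g b"
  proof -
    have "g a \<noteq> g b" using gconv[of a b b 0] a(1) b(1) ab by (auto simp: W_def)
    then show ?thesis using a(2)[OF b(1)] by simp
  qed
  have "T = D \<inter> {x. (f1, f2) \<bullet> x = h}" by (auto simp: T_def lin_eq_inner)
  then have "T face_of D"
    using face_of_Int_supporting_hyperplane_ge[OF cD(1), of h "(f1, f2)"] Dge by (simp add: lin_eq_inner)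
  then obtain S' where S': "S' \<subseteq> V" "T = convex hull S'"
    using face_of_convex_hull_subset[of V T] V(1) by (metis D_def finite_imp_compact)
  have S'W: "S' \<subseteq> W" using S' hull_subset[of S' convex] by (auto simp: W_def T_def)
  have WT: "W \<subseteq> T" by (auto simp: W_def T_def D_def hull_inc)
  have TW: "T = convex hull W"
  proof
    show "T \<subseteq> convex hull W" unfolding S'(2) using S'W by (rule hull_mono)
    show "convex hull W \<subseteq> T" using WT by (rule hull_minimal) (simp add: S'(2))
  qed
  have T: "T = closed_segment a b"
  proof
    show "closed_segment a b \<subseteq> T"
      using a(1) b(1) WT by (intro closed_segment_subset) (auto simp: TW)
    have "W \<subseteq> closed_segment a b"
    proof
      fix r assume r: "r \<in> W"
      define t where "t = (g r - g a) / (g b - g a)"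
      have t: "0 \<le> t" "t \<le> 1" using a(2)[OF r] b(2)[OF r] gab by (auto simp: t_def)
      have "t * (g b - g a) = g r - g a" using gab by (simp add: t_def)
      then have "g r = (1 - t) * g a + t * g b" by (simp add: algebra_simps)
      then have "r = (1 - t) *\<^sub>R a + t *\<^sub>R b" using gconv r a(1) b(1) by (auto simp: W_def)
      then show "r \<in> closed_segment a b" using t by (auto simp: in_segment)
    qed
    then show "T \<subseteq> closed_segment a b" unfolding TW by (rule hull_minimal) simp
  qed
  have fr: "T \<subseteq> frontier D"
  proof
    fix r assume r: "r \<in> T"
    have "r \<notin> interior D"
    proof
      assume "r \<in> interior D"
      then obtain x where "x \<in> D" "lin f1 f2 x < lin f1 f2 r"
        using f(1) mem_interior_convex_iff[OF cD(1), of r] by metis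
      with Dge[of x] r show False by (simp add: T_def)
    qed
    then show "r \<in> frontier D"
      using r cD(2) by (auto simp: frontier_def T_def compact_imp_closed)
  qed
  have abl: "a \<in> lattice" "b \<in> lattice" using a b V(2) by (auto simp: W_def)
  obtain E where E: "\<forall>e\<in>E. primitive_segment e"
      "closed_segment a b = \<Union> E"
    using closed_segment_lattice_union[OF finite_lattice_bounded[OF bounded_closed_segment] abl ab] by blast
  have "edge_union D T"
    unfolding edge_union_def
  proof (intro conjI)
    show "\<exists>a b. a \<noteq> b \<and> T = closed_segment a b" using T ab by blast
    show "\<exists>E. (\<forall>e\<in>E. edge D e) \<and> T = \<Union> E"
    proof (intro exI[of _ E] conjI ballI)
      fix e assume e: "e \<in> E"
      then have "e \<subseteq> frontier D" using E(2) fr T by blast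
      then show "edge D e" unfolding edge_def using E(1) e unfolding primitive_segment_def by metis
    qed (use E T in simp)
  qed
  moreover have "s = T" if s: "edge_union D s" "T \<subseteq> s" for s
  proof -
    obtain c d E where cd: "c \<noteq> d" "s = closed_segment c d" and E: "\<forall>e\<in>E. edge D e" "s = \<Union> E"
      using s(1) unfolding edge_union_def by blast
    have "s \<subseteq> D"
    proof -
      have "e \<subseteq> D" if "e \<in> E" for e
        using E(1) that frontier_subset_closed[OF compact_imp_closed[OF cD(2)]] by (auto simp: edge_def)
      then show ?thesis using E(2) by blast
    qed
    define \<phi> where "\<phi> t = lin f1 f2 c + t * (lin f1 f2 d - lin f1 f2 c)" for t
    have \<phi>: "lin f1 f2 ((1 - t) *\<^sub>R c + t *\<^sub>R d) = \<phi> t" for t by (simp add: \<phi>_def lin_def algebra_simps)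
    have "a \<in> s" "b \<in> s" using s(2) T by auto
    then obtain t t' where t: "0 \<le> t" "t \<le> 1" "a = (1 - t) *\<^sub>R c + t *\<^sub>R d"
      and t': "0 \<le> t'" "t' \<le> 1" "b = (1 - t') *\<^sub>R c + t' *\<^sub>R d"
      unfolding cd(2) in_segment by blast
    \<comment> \<open>An affine function of the parameter with equal values at two parameters is
      constant.\<close>
    have "t \<noteq> t'" using t t' ab by auto
    moreover have "\<phi> t = \<phi> t'" using a(1) b(1) t t' \<phi> by (simp add: W_def)
    ultimately have "lin f1 f2 d = lin f1 f2 c" by (auto simp: \<phi>_def)
    moreover have "\<phi> t = h" using a(1) t \<phi> by (simp add: W_def)
    ultimately have "lin f1 f2 c = h" "lin f1 f2 d = h" by (auto simp: \<phi>_def)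
    then have "lin f1 f2 r = h" if "r \<in> s" for r
      using that \<phi> unfolding cd(2) in_segment by (auto simp: \<phi>_def)
    with \<open>s \<subseteq> D\<close> have "s \<subseteq> T" by (auto simp: T_def)
    with s(2) show "s = T" by blast
  qed
  ultimately show ?thesis unfolding maximal_edge_def D_def[symmetric] T_def[symmetric] by blast
qed

text \<open>Local coordinates at the four corners of \<open>\<P>\<^sup>1 \<times> \<P>\<^sup>1\<close>: the flag \<open>True\<close> stands for
  infinity, and an exponent \<open>i\<close> of a coordinate becomes \<open>d - i\<close> there.\<close>

definition lexp :: "bool \<Rightarrow> nat \<Rightarrow> nat \<Rightarrow> nat" where
  "lexp b d i = (if b then d - i else i)"

definition lcoef :: "bool \<Rightarrow> bool \<Rightarrow> poly_xy \<Rightarrow> nat \<Rightarrow> nat \<Rightarrow> complex" where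
  "lcoef bx by P a b = coeff_xy P (lexp bx (deg_x P) a) (lexp by (deg_y P) b)"

text \<open>The bounds matter because d - i is truncated: at infinity every exponent beyond the
  degree would be read as the exponent 0 of \<open>P\<close>.\<close>

definition lsupp :: "bool \<Rightarrow> bool \<Rightarrow> poly_xy \<Rightarrow> (nat \<times> nat) set" where
  "lsupp bx by P = {(a, b). a \<le> deg_x P \<and> b \<le> deg_y P \<and> lcoef bx by P a b \<noteq> 0}"

definition lpoly :: "bool \<Rightarrow> bool \<Rightarrow> poly_xy \<Rightarrow> complex \<Rightarrow> complex \<Rightarrow> complex" where
  "lpoly bx by P u v = (\<Sum>(a, b)\<in>lsupp bx by P. lcoef bx by P a b * u ^ a * v ^ b)"

definition chart :: "bool \<Rightarrow> complex \<Rightarrow> complex \<times> complex" where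
  "chart b u = (if b then (1, u) else (u, 1))"

definition pt :: "bool \<Rightarrow> complex \<Rightarrow> proj1" where
  "pt b u = abs_proj1 (chart b u)"

text \<open>The normal (0, 0) is included and gives all of \<open>A\<close>, which stands for the
  Newton polygon itself; (1, 0) and (0, 1) give the faces on the axes once \<open>A\<close> meets
  them.\<close>

definition face :: "nat \<Rightarrow> nat \<Rightarrow> (nat \<times> nat) set \<Rightarrow> (nat \<times> nat) set" where
  "face m n A = {s \<in> A. \<forall>t\<in>A. m * fst s + n * snd s \<le> m * fst t + n * snd t}"

lemma lexp_le [simp]: "i \<le> d \<Longrightarrow> lexp b d i \<le> d"
  by (simp add: lexp_def)

lemma lexp_lexp [simp]: "i \<le> d \<Longrightarrow> lexp b d (lexp b d i) = i"
  by (simp add: lexp_def)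

lemma support_le:
  assumes "(i, j) \<in> support P"
  shows "i \<le> deg_x P" "j \<le> deg_y P"
proof -
  have c: "coeff (coeff P j) i \<noteq> 0" using assms by (simp add: support_def coeff_xy_def)
  then show j: "j \<le> deg_y P" unfolding deg_y_def by (intro le_degree) auto
  have "i \<le> degree (coeff P j)" using c by (rule le_degree)
  also have "\<dots> \<le> deg_x P" unfolding deg_x_def using j by (intro Max_ge) (auto simp: deg_y_def)
  finally show "i \<le> deg_x P" .
qed

lemma finite_support: "finite (support P)"
  by (rule finite_subset[of _ "{..deg_x P} \<times> {..deg_y P}"]) (use support_le in auto)

lemma finite_lsupp [simp]: "finite (lsupp bx by P)"
  by (rule finite_subset[of _ "{..deg_x P} \<times> {..deg_y P}"]) (auto simp: lsupp_def)

lemma lexp_in_lsupp_iff: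
  assumes "i \<le> deg_x P" "j \<le> deg_y P"
  shows "(lexp bx (deg_x P) i, lexp by (deg_y P) j) \<in> lsupp bx by P \<longleftrightarrow> (i, j) \<in> support P"
  using assms by (simp add: lsupp_def lcoef_def support_def)

text \<open>\<open>lexp\<close> is an involution up to the degree, so in each chart the form is the
  same sum with some exponents reversed.\<close>

lemma bihom_chart: "bihom P (chart bx u) (chart by v) = lpoly bx by P u v"
proof -
  let ?dx = "deg_x P" and ?dy = "deg_y P"
  have "bihom P (chart bx u) (chart by v) =
      (\<Sum>i\<le>?dx. \<Sum>j\<le>?dy. coeff_xy P i j * u ^ lexp bx ?dx i * v ^ lexp by ?dy j)"
    unfolding bihom_def by (intro sum.cong refl) (auto simp: chart_def lexp_def)
  also have "\<dots> = (\<Sum>i\<le>?dx. \<Sum>b\<le>?dy. coeff_xy P i (lexp by ?dy b) * u ^ lexp bx ?dx i * v ^ b)"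
    by (rule sum.cong[OF refl], rule sum.reindex_bij_witness[of _ "lexp by ?dy" "lexp by ?dy"]) auto
  also have "\<dots> = (\<Sum>a\<le>?dx. \<Sum>b\<le>?dy. lcoef bx by P a b * u ^ a * v ^ b)"
    by (rule sum.reindex_bij_witness[of _ "lexp bx ?dx" "lexp bx ?dx"]) (auto simp: lcoef_def)
  also have "\<dots> = (\<Sum>(a, b)\<in>{..?dx} \<times> {..?dy}. lcoef bx by P a b * u ^ a * v ^ b)"
    by (simp add: sum.cartesian_product)
  also have "\<dots> = lpoly bx by P u v"
    unfolding lpoly_def by (intro sum.mono_neutral_right) (auto simp: lsupp_def)
  finally show ?thesis .
qed

lemma chart_nonzero [simp]: "chart b u \<noteq> (0, 0)"
  by (simp add: chart_def)

lemma pt_homog: "pt b u = (if b then homog 1 u else homog u 1)"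
  by (simp add: pt_def chart_def homog_def)

lemma pt_inject [simp]: "pt b u = pt b v \<longleftrightarrow> u = v"
  by (auto simp: pt_homog homog_eq_iff)

lemma pt_eq_pt_0_iff: "pt b' u = pt b 0 \<longleftrightarrow> b' = b \<and> u = 0"
  by (auto simp: pt_homog homog_eq_iff)

lemma pt_neq_iff: "b \<noteq> b' \<Longrightarrow> pt b u = pt b' v \<longleftrightarrow> u * v = 1"
  by (cases b; cases b') (auto simp: pt_homog homog_eq_iff mult.commute)

lemma proj_inf_eq: "proj_inf = pt True 0"
  by (simp add: proj_inf_def pt_homog)

lemma pt_in_proj_curve_iff: "(pt bx u, pt by v) \<in> proj_curve P \<longleftrightarrow> lpoly bx by P u v = 0"
proof
  assume "(pt bx u, pt by v) \<in> proj_curve P"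
  then obtain X0 X1 Y0 Y1 where X: "(X0, X1) \<noteq> (0, 0)" "(Y0, Y1) \<noteq> (0, 0)"
      "bihom P (X0, X1) (Y0, Y1) = 0" "pt bx u = homog X0 X1" "pt by v = homog Y0 Y1"
    by (auto simp: proj_curve_def)
  have ptc: "pt b w = homog (fst (chart b w)) (snd (chart b w))" for b w by (simp add: pt_def homog_def)
  obtain c where c: "c \<noteq> 0" "X0 = c * fst (chart bx u)" "X1 = c * snd (chart bx u)"
    using X(4) homog_eq_iff[OF _ X(1), of "fst (chart bx u)" "snd (chart bx u)"] by (auto simp: ptc)
  obtain d where d: "d \<noteq> 0" "Y0 = d * fst (chart by v)" "Y1 = d * snd (chart by v)"
    using X(5) homog_eq_iff[OF _ X(2), of "fst (chart by v)" "snd (chart by v)"] by (auto simp: ptc)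
  have "bihom P (X0, X1) (Y0, Y1) = c ^ deg_x P * d ^ deg_y P * bihom P (chart bx u) (chart by v)"
  proof -
    have *: "c ^ deg_x P = c ^ i * c ^ (deg_x P - i)" if "i \<le> deg_x P" for i
      using that by (simp flip: power_add)
    have **: "d ^ deg_y P = d ^ i * d ^ (deg_y P - i)" if "i \<le> deg_y P" for i
      using that by (simp flip: power_add)
    show ?thesis unfolding bihom_def sum_distrib_left
    proof (intro sum.cong refl)
      fix i j assume "i \<in> {..deg_x P}" "j \<in> {..deg_y P}"
      then show "coeff_xy P i j * fst (X0, X1) ^ i * snd (X0, X1) ^ (deg_x P - i) * fst (Y0, Y1) ^ j *
           snd (Y0, Y1) ^ (deg_y P - j) =
           c ^ deg_x P * d ^ deg_y P * (coeff_xy P i j * fst (chart bx u) ^ i * snd (chart bx u) ^ (deg_x P - i) *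
            fst (chart by v) ^ j * snd (chart by v) ^ (deg_y P - j))"
        by (simp add: *[of i] **[of j] c(2,3) d(2,3) power_mult_distrib)
    qed
  qed
  then show "lpoly bx by P u v = 0" using X(3) c(1) d(1) by (simp add: bihom_chart)
next
  assume "lpoly bx by P u v = 0"
  then show "(pt bx u, pt by v) \<in> proj_curve P"
    unfolding proj_curve_def
    by (intro CollectI exI[of _ "fst (chart bx u)"] exI[of _ "snd (chart bx u)"]
          exI[of _ "fst (chart by v)"] exI[of _ "snd (chart by v)"])
       (simp add: bihom_chart pt_def homog_def)
qed

lemma deriv_sum_monomials:
  fixes c :: "'i \<Rightarrow> complex"
  assumes "finite A"
  shows "deriv (\<lambda>z. \<Sum>s\<in>A. c s * z ^ e s) x = (\<Sum>s\<in>A. c s * of_nat (e s) * x ^ (e s - 1))"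
proof (rule DERIV_imp_deriv)
  show "((\<lambda>z. \<Sum>s\<in>A. c s * z ^ e s) has_field_derivative (\<Sum>s\<in>A. c s * of_nat (e s) * x ^ (e s - 1))) (at x)"
    by (auto intro!: derivative_eq_intros sum.cong)
qed

text \<open>Nondegeneracy in local coordinates, with logarithmic derivatives in place of partial
  ones: they act diagonally on monomials and survive the reversal of an exponent. The normal (0, 0)
  is the case of the full polygon. For any other normal the face has at least two points, since a
  single monomial has no zero on the torus, and so it is a maximal edge.\<close>

lemma face_smooth:
  fixes m n :: nat and u v :: complex
  assumes P: "nondegenerate P" and ne: "lsupp bx by P \<noteq> {}" and uv: "u \<noteq> 0" "v \<noteq> 0"
    and F: "F = face m n (lsupp bx by P)"
    and s0: "(\<Sum>(a, b)\<in>F. lcoef bx by P a b * u ^ a * v ^ b) = 0"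
    and s1: "(\<Sum>(a, b)\<in>F. of_nat a * (lcoef bx by P a b * u ^ a * v ^ b)) = 0"
    and s2: "(\<Sum>(a, b)\<in>F. of_nat b * (lcoef bx by P a b * u ^ a * v ^ b)) = 0"
  shows False
proof -
  let ?dx = "deg_x P" and ?dy = "deg_y P"
  let ?V = "(\<lambda>(i, j). (real i, real j)) ` support P"
  define \<phi> where "\<phi> = (\<lambda>(i, j). (lexp bx ?dx i, lexp by ?dy j))"
  have \<phi>F: "\<phi> s \<in> lsupp bx by P" if "s \<in> support P" for s
    using that support_le by (auto simp: \<phi>_def lexp_in_lsupp_iff split: prod.splits)
  have \<phi>\<phi>: "\<phi> (\<phi> s) = s" if "s \<in> support P" for s
    using that support_le by (auto simp: \<phi>_def split: prod.splits)
  have \<phi>L: "\<phi> s \<in> support P" "\<phi> (\<phi> s) = s" if "s \<in> lsupp bx by P" for s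
    using that by (auto simp: \<phi>_def lsupp_def lcoef_def support_def split: prod.splits)
  \<comment> \<open>The same weight in the original exponents: reversed ones change sign, and
    \<open>c0\<close> collects the constants.\<close>
  define f1 f2 where "f1 = (if bx then - real m else real m)" and "f2 = (if by then - real n else real n)"
  define c0 where "c0 = (if bx then real m * ?dx else 0) + (if by then real n * ?dy else 0)"
  have lin\<phi>: "lin f1 f2 (real i, real j) = real (m * fst (\<phi> (i, j)) + n * snd (\<phi> (i, j))) - c0"
    if "(i, j) \<in> support P" for i j
    using support_le[OF that] by (auto simp: lin_def f1_def f2_def c0_def \<phi>_def lexp_def of_nat_diff algebra_simps)
  have Fsub: "F \<subseteq> lsupp bx by P" by (auto simp: F face_def)
  obtain s where s: "s \<in> F"
  proof -
    obtain s where "s \<in> lsupp bx by P" "\<And>t. t \<in> lsupp bx by P \<Longrightarrow> m * fst s + n * snd s \<le> m * fst t + n * snd t"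
      using ex_is_arg_min_if_finite[OF finite_lsupp ne, of "\<lambda>s. m * fst s + n * snd s"]
      unfolding is_arg_min_linorder by blast
    then have "s \<in> F" by (simp add: F face_def)
    then show ?thesis by (rule that)
  qed
  have "\<exists>t. (maximal_edge (newton_polygon P) t \<or> t = newton_polygon P) \<and>
      (\<forall>i j. (i, j) \<in> support P \<longrightarrow> ((real i, real j) \<in> t \<longleftrightarrow> \<phi> (i, j) \<in> F))"
  proof (cases "m = 0 \<and> n = 0")
    case True
    then have "F = lsupp bx by P" by (auto simp: F face_def)
    then show ?thesis using \<phi>F
      by (intro exI[of _ "newton_polygon P"]) (auto simp: newton_polygon_def intro!: hull_inc)
  next
    case False
    have "\<exists>s'\<in>F. s' \<noteq> s"
    proof (rule ccontr)
      assume "\<not> ?thesis"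
      then have "F = {s}" using s by blast
      with s0 have "lcoef bx by P (fst s) (snd s) = 0" using uv by (auto split: prod.splits)
      with s Fsub show False by (auto simp: lsupp_def split: prod.splits)
    qed
    then obtain s' where s': "s' \<in> F" "s' \<noteq> s" by blast
    define h where "h = real (m * fst s + n * snd s) - c0"
    define \<iota> where "\<iota> = (\<lambda>(i :: nat, j :: nat). (real i, real j))"
    have \<iota>: "\<iota> x = \<iota> y \<longleftrightarrow> x = y" for x y by (auto simp: \<iota>_def split: prod.splits)
    have lin\<iota>: "lin f1 f2 (\<iota> r) = real (m * fst (\<phi> r) + n * snd (\<phi> r)) - c0" if "r \<in> support P" for r
      using lin\<phi>[of "fst r" "snd r"] that by (simp add: \<iota>_def split_beta)
    have Fh: "\<phi> r \<in> F \<longleftrightarrow> lin f1 f2 (\<iota> r) = h" if r: "r \<in> support P" for r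
    proof -
      have "h \<le> lin f1 f2 (\<iota> r)"
        using s \<phi>F[OF r] unfolding lin\<iota>[OF r] h_def F face_def by (auto simp flip: of_nat_mult of_nat_add)
      moreover have "\<phi> r \<in> F \<longleftrightarrow> m * fst (\<phi> r) + n * snd (\<phi> r) \<le> m * fst s + n * snd s"
        using s \<phi>F[OF r] unfolding F face_def by (force intro: order_trans)
      then have "\<phi> r \<in> F \<longleftrightarrow> lin f1 f2 (\<iota> r) \<le> h"
        unfolding lin\<iota>[OF r] h_def by (simp flip: of_nat_mult of_nat_add)
      ultimately show ?thesis by auto
    qed
    have sF: "lin f1 f2 (\<iota> (\<phi> r)) = h" if "r \<in> F" for r
      using Fh[of "\<phi> r"] \<phi>L[of r] that Fsub by auto
    have ge: "h \<le> lin f1 f2 (\<iota> r)" if r: "r \<in> support P" for r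
      using s \<phi>F[OF r] unfolding lin\<iota>[OF r] h_def F face_def by (auto simp flip: of_nat_mult of_nat_add)
    define t where "t = convex hull ?V \<inter> {r. lin f1 f2 r = h}"
    have V\<iota>: "?V = \<iota> ` support P" by (simp add: \<iota>_def)
    have "maximal_edge (convex hull ?V) t"
      unfolding t_def
    proof (rule maximal_edge_face[where p = "\<iota> (\<phi> s)" and q = "\<iota> (\<phi> s')"])
      show "finite ?V" using finite_support by simp
      show "?V \<subseteq> lattice"
      proof
        fix x assume "x \<in> ?V"
        then obtain i j :: nat where "x = (of_int (int i), of_int (int j))" by auto
        then show "x \<in> lattice" unfolding lattice_def by blast
      qed
      show "\<iota> (\<phi> s) \<in> ?V" "\<iota> (\<phi> s') \<in> ?V" using \<phi>L(1)[OF subsetD[OF Fsub s]] \<phi>L(1)[OF subsetD[OF Fsub s'(1)]] unfolding V\<iota> by auto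
      show "\<iota> (\<phi> s) \<noteq> \<iota> (\<phi> s')" using s s' Fsub \<phi>L(2) unfolding \<iota> by (metis subsetD)
      show "(f1, f2) \<noteq> (0, 0)" using False by (auto simp: f1_def f2_def)
      show "lin f1 f2 (\<iota> (\<phi> s)) = h" "lin f1 f2 (\<iota> (\<phi> s')) = h" using sF s s' by auto
      show "h \<le> lin f1 f2 r" if "r \<in> ?V" for r using that ge unfolding V\<iota> by blast
    qed
    moreover have "(real i, real j) \<in> t \<longleftrightarrow> \<phi> (i, j) \<in> F" if "(i, j) \<in> support P" for i j
    proof -
      have "\<iota> (i, j) \<in> convex hull ?V" using that unfolding V\<iota> by (intro hull_inc) blast
      then show ?thesis unfolding Fh[OF that] t_def by (simp add: \<iota>_def)
    qed
    ultimately show ?thesis unfolding newton_polygon_def by blast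
  qed
  then obtain t where t: "maximal_edge (newton_polygon P) t \<or> t = newton_polygon P"
    and tF: "\<And>i j. (i, j) \<in> support P \<Longrightarrow> (real i, real j) \<in> t \<longleftrightarrow> \<phi> (i, j) \<in> F" by blast
  define x where "x = (if bx then inverse u else u)"
  define y where "y = (if by then inverse v else v)"
  have xy: "x \<noteq> 0" "y \<noteq> 0" using uv by (auto simp: x_def y_def)
  \<comment> \<open>The common monomial factor produced by passing from u to 1 / u, or from v to 1 /
    v, at infinity.\<close>
  define K where "K = (if bx then inverse u ^ ?dx else 1) * (if by then inverse v ^ ?dy else 1)"
  have pw: "inverse w ^ d * w ^ (d - i) = inverse w ^ i" if "w \<noteq> 0" "i \<le> d" for w :: complex and d i
  proof -
    have "inverse w ^ d = inverse w ^ (d - i) * inverse w ^ i" using that(2) by (simp flip: power_add)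
    then show ?thesis using that(1) by (simp add: field_simps)
  qed
  have mono: "x ^ i * y ^ j = K * (u ^ fst (\<phi> (i, j)) * v ^ snd (\<phi> (i, j)))" if "(i, j) \<in> support P" for i j
    using support_le[OF that] pw[OF uv(1), of i ?dx] pw[OF uv(2), of j ?dy]
    by (auto simp: x_def y_def K_def \<phi>_def lexp_def) (metis mult.assoc mult.left_commute mult.commute)+
  define B where "B = {(i, j). (i, j) \<in> support P \<and> (real i, real j) \<in> t}"
  have B: "finite B" using finite_support by (rule finite_subset[rotated]) (auto simp: B_def)
  have tr: "(\<Sum>s\<in>B. w s * (coeff_xy P (fst s) (snd s) * x ^ fst s * y ^ snd s)) =
      K * (\<Sum>s\<in>F. w (\<phi> s) * (lcoef bx by P (fst s) (snd s) * u ^ fst s * v ^ snd s))" for w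
    unfolding sum_distrib_left
  proof (rule sum.reindex_bij_witness[of _ \<phi> \<phi>])
    fix s assume s: "s \<in> B"
    then have ss: "s \<in> support P" by (auto simp: B_def)
    show "\<phi> (\<phi> s) = s" using \<phi>\<phi>[OF ss] .
    show "\<phi> s \<in> F" using s tF ss by (auto simp: B_def)
    have "lcoef bx by P (fst (\<phi> s)) (snd (\<phi> s)) = coeff_xy P (fst s) (snd s)"
      using support_le[of "fst s" "snd s" P] ss by (auto simp: lcoef_def \<phi>_def split: prod.splits)
    moreover have "x ^ fst s * y ^ snd s = K * (u ^ fst (\<phi> s) * v ^ snd (\<phi> s))"
      using mono[of "fst s" "snd s"] ss by simp
    ultimately show "K * (w (\<phi> (\<phi> s)) * (lcoef bx by P (fst (\<phi> s)) (snd (\<phi> s)) * u ^ fst (\<phi> s) * v ^ snd (\<phi> s))) =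
        w s * (coeff_xy P (fst s) (snd s) * x ^ fst s * y ^ snd s)"
      using \<phi>\<phi>[OF ss] by (simp add: mult.assoc mult.left_commute)
  next
    fix s assume s: "s \<in> F"
    then have sL: "s \<in> lsupp bx by P" using Fsub by blast
    show "\<phi> (\<phi> s) = s" using \<phi>L(2)[OF sL] .
    show "\<phi> s \<in> B" using s \<phi>L[OF sL] tF[of "fst (\<phi> s)" "snd (\<phi> s)"] unfolding B_def by (simp add: split_beta)
  qed
  have R: "restricted P t = (\<lambda>x y. \<Sum>s\<in>B. coeff_xy P (fst s) (snd s) * x ^ fst s * y ^ snd s)"
    unfolding restricted_def B_def by (intro ext sum.cong) auto
  have S: "(\<Sum>s\<in>F. lcoef bx by P (fst s) (snd s) * u ^ fst s * v ^ snd s) = 0"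
      "(\<Sum>s\<in>F. of_nat (fst s) * (lcoef bx by P (fst s) (snd s) * u ^ fst s * v ^ snd s)) = 0"
      "(\<Sum>s\<in>F. of_nat (snd s) * (lcoef bx by P (fst s) (snd s) * u ^ fst s * v ^ snd s)) = 0"
    using s0 s1 s2 by (simp_all add: split_beta)
  have r0: "restricted P t x y = 0" using tr[of "\<lambda>_. 1"] S(1) by (simp add: R)
  \<comment> \<open>For a reversed exponent the weight is d - a, so the weighted sum is a
    combination of the given vanishing ones.\<close>
  have "(\<Sum>s\<in>F. of_nat (fst (\<phi> s)) * (lcoef bx by P (fst s) (snd s) * u ^ fst s * v ^ snd s)) =
     (if bx then of_nat ?dx * (\<Sum>s\<in>F. lcoef bx by P (fst s) (snd s) * u ^ fst s * v ^ snd s) -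
         (\<Sum>s\<in>F. of_nat (fst s) * (lcoef bx by P (fst s) (snd s) * u ^ fst s * v ^ snd s))
      else (\<Sum>s\<in>F. of_nat (fst s) * (lcoef bx by P (fst s) (snd s) * u ^ fst s * v ^ snd s)))"
    using Fsub unfolding sum_distrib_left sum_subtractf[symmetric]
    by (auto intro!: sum.cong simp: \<phi>_def lexp_def lsupp_def of_nat_diff algebra_simps split: prod.splits)
  also have "\<dots> = 0" by (simp only: S) simp
  finally have x0: "(\<Sum>s\<in>B. of_nat (fst s) * (coeff_xy P (fst s) (snd s) * x ^ fst s * y ^ snd s)) = 0"
    using tr[of "\<lambda>s. of_nat (fst s)"] by simp
  have "(\<Sum>s\<in>F. of_nat (snd (\<phi> s)) * (lcoef bx by P (fst s) (snd s) * u ^ fst s * v ^ snd s)) =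
     (if by then of_nat ?dy * (\<Sum>s\<in>F. lcoef bx by P (fst s) (snd s) * u ^ fst s * v ^ snd s) -
         (\<Sum>s\<in>F. of_nat (snd s) * (lcoef bx by P (fst s) (snd s) * u ^ fst s * v ^ snd s))
      else (\<Sum>s\<in>F. of_nat (snd s) * (lcoef bx by P (fst s) (snd s) * u ^ fst s * v ^ snd s)))"
    using Fsub unfolding sum_distrib_left sum_subtractf[symmetric]
    by (auto intro!: sum.cong simp: \<phi>_def lexp_def lsupp_def of_nat_diff algebra_simps split: prod.splits)
  also have "\<dots> = 0" by (simp only: S) simp
  finally have y0: "(\<Sum>s\<in>B. of_nat (snd s) * (coeff_xy P (fst s) (snd s) * x ^ fst s * y ^ snd s)) = 0"
    using tr[of "\<lambda>s. of_nat (snd s)"] by simp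
  have pm: "x * (of_nat k * x ^ (k - 1)) = of_nat k * x ^ k" for k and x :: complex
    by (cases k) auto
  have "deriv (\<lambda>x. restricted P t x y) x = (\<Sum>s\<in>B. (coeff_xy P (fst s) (snd s) * y ^ snd s) * of_nat (fst s) * x ^ (fst s - 1))"
    unfolding R using deriv_sum_monomials[OF B, of "\<lambda>s. coeff_xy P (fst s) (snd s) * y ^ snd s" fst x]
    by (simp add: mult.assoc mult.commute mult.left_commute)
  then have "x * deriv (\<lambda>x. restricted P t x y) x = (\<Sum>s\<in>B. coeff_xy P (fst s) (snd s) * y ^ snd s * (x * (of_nat (fst s) * x ^ (fst s - 1))))"
    by (simp add: sum_distrib_left mult.assoc mult.left_commute)
  also have "\<dots> = 0" unfolding pm using x0 by (simp add: mult.assoc mult.commute mult.left_commute)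
  finally have dx0: "deriv (\<lambda>x. restricted P t x y) x = 0" using xy by simp
  have "deriv (restricted P t x) y = (\<Sum>s\<in>B. (coeff_xy P (fst s) (snd s) * x ^ fst s) * of_nat (snd s) * y ^ (snd s - 1))"
    unfolding R using deriv_sum_monomials[OF B, of "\<lambda>s. coeff_xy P (fst s) (snd s) * x ^ fst s" snd y]
    by (simp add: mult.assoc mult.commute mult.left_commute)
  then have "y * deriv (restricted P t x) y = (\<Sum>s\<in>B. coeff_xy P (fst s) (snd s) * x ^ fst s * (y * (of_nat (snd s) * y ^ (snd s - 1))))"
    by (simp add: sum_distrib_left mult.assoc mult.left_commute)
  also have "\<dots> = 0" unfolding pm using y0 by (simp add: mult.assoc mult.commute mult.left_commute)
  finally have dy0: "deriv (restricted P t x) y = 0" using xy by simp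
  show False using P t xy r0 dx0 dy0 unfolding nondegenerate_def by blast
qed

text \<open>At a finite coordinate this is inscribedness, at infinity it is the definition of the
  degree.\<close>

lemma lsupp_axes:
  assumes ins: "inscribed dx dy (newton_polygon P)" and pos: "0 < deg_x P" "0 < deg_y P"
  shows "\<exists>b. (0, b) \<in> lsupp bx by P" "\<exists>a. (a, 0) \<in> lsupp bx by P"
proof -
  note D = inscribed_convex_hullD[OF ins[unfolded newton_polygon_def]]
  have "\<exists>j. (lexp bx (deg_x P) 0, j) \<in> support P"
  proof (cases bx)
    case True
    have "deg_x P \<in> (\<lambda>j. degree (coeff P j)) ` {..degree P}"
      unfolding deg_x_def by (intro Max_in) auto
    then obtain j where j: "degree (coeff P j) = deg_x P" by auto
    then have "coeff P j \<noteq> 0" using pos(1) by auto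
    then have "(deg_x P, j) \<in> support P" using leading_coeff_neq_0[of "coeff P j"] j by (simp add: support_def coeff_xy_def)
    then show ?thesis using True by (auto simp: lexp_def)
  next
    case False
    then show ?thesis using D(1) by (force simp: lexp_def)
  qed
  then obtain j where j: "(lexp bx (deg_x P) 0, j) \<in> support P" by blast
  show "\<exists>b. (0, b) \<in> lsupp bx by P"
    using lexp_in_lsupp_iff[of "lexp bx (deg_x P) 0" P j bx "by"] support_le[OF j] j by auto
  have "\<exists>i. (i, lexp by (deg_y P) 0) \<in> support P"
  proof (cases "by")
    case True
    have "P \<noteq> 0" using pos(2) by (auto simp: deg_y_def)
    then have "coeff P (degree P) \<noteq> 0" by simp
    then obtain i where "coeff (coeff P (degree P)) i \<noteq> 0" by (meson leading_coeff_0_iff)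
    then show ?thesis using True by (auto simp: lexp_def support_def coeff_xy_def deg_y_def)
  next
    case False
    then show ?thesis using D(3) by (force simp: lexp_def)
  qed
  then obtain i where i: "(i, lexp by (deg_y P) 0) \<in> support P" by blast
  show "\<exists>a. (a, 0) \<in> lsupp bx by P"
    using lexp_in_lsupp_iff[of i P "lexp by (deg_y P) 0" bx "by"] support_le[OF i] i by auto
qed

section \<open>Singular points of a nondegenerate curve\<close>

lemma affine_charts_eq: "affine_charts = range chart"
  by (auto simp: affine_charts_def chart_def fun_eq_iff UNIV_bool)

lemma lpoly_alt: "lpoly bx by P u v =
    (\<Sum>s\<in>lsupp bx by P. lcoef bx by P (fst s) (snd s) * u ^ fst s * v ^ snd s)"
  unfolding lpoly_def by (intro sum.cong) auto

lemma deriv_lpoly: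
  "deriv (\<lambda>u. lpoly bx by P u v) u =
     (\<Sum>s\<in>lsupp bx by P. lcoef bx by P (fst s) (snd s) * v ^ snd s * of_nat (fst s) * u ^ (fst s - 1))"
  "deriv (lpoly bx by P u) v =
     (\<Sum>s\<in>lsupp bx by P. lcoef bx by P (fst s) (snd s) * u ^ fst s * of_nat (snd s) * v ^ (snd s - 1))"
proof -
  have "(\<lambda>u. lpoly bx by P u v) = (\<lambda>u. \<Sum>s\<in>lsupp bx by P. (lcoef bx by P (fst s) (snd s) * v ^ snd s) * u ^ fst s)"
    unfolding lpoly_alt by (intro ext sum.cong) auto
  then show "deriv (\<lambda>u. lpoly bx by P u v) u =
     (\<Sum>s\<in>lsupp bx by P. lcoef bx by P (fst s) (snd s) * v ^ snd s * of_nat (fst s) * u ^ (fst s - 1))"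
    using deriv_sum_monomials[OF finite_lsupp] by simp
  show "deriv (lpoly bx by P u) v =
     (\<Sum>s\<in>lsupp bx by P. lcoef bx by P (fst s) (snd s) * u ^ fst s * of_nat (snd s) * v ^ (snd s - 1))"
    unfolding lpoly_alt[abs_def] using deriv_sum_monomials[OF finite_lsupp] by simp
qed

lemma singular_pointsE:
  assumes "p \<in> singular_points P"
  obtains bx "by" u v where "p = (pt bx u, pt by v)" "lpoly bx by P u v = 0"
    "deriv (\<lambda>u. lpoly bx by P u v) u = 0" "deriv (lpoly bx by P u) v = 0"
proof -
  obtain a b u v where *: "p = (abs_proj1 (a u), abs_proj1 (b v))" "a \<in> affine_charts" "b \<in> affine_charts"
      "bihom P (a u) (b v) = 0" "deriv (\<lambda>u'. bihom P (a u') (b v)) u = 0" "deriv (\<lambda>v'. bihom P (a u) (b v')) v = 0"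
    using assms unfolding singular_points_def by blast
  obtain bx "by" where "a = chart bx" "b = chart by" using *(2,3) unfolding affine_charts_eq by blast
  with * show ?thesis by (intro that[of bx u "by" v]) (simp_all add: bihom_chart pt_def)
qed

lemma singular_pointsI:
  assumes "lpoly bx by P u v = 0" "deriv (\<lambda>u. lpoly bx by P u v) u = 0" "deriv (lpoly bx by P u) v = 0"
  shows "(pt bx u, pt by v) \<in> singular_points P"
  unfolding singular_points_def affine_charts_eq
  by (rule CollectI, rule exI[of _ "chart bx"], rule exI[of _ "chart by"], rule exI[of _ u], rule exI[of _ v])
     (use assms in \<open>simp add: bihom_chart pt_def\<close>)

lemma of_nat_mult_power_pred: "x * (of_nat k * x ^ (k - 1)) = of_nat k * (x::complex) ^ k"
  by (cases k) auto

text \<open>On the torus this is nondegeneracy of the full polynomial. On a coordinate axis only the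
  monomials of the face on that axis survive; the vanishing coordinate can be replaced by 1, which
  the face polynomial does not see, and one logarithmic derivative is zero on the face for trivial
  reasons.\<close>

lemma singular_point_is_corner:
  assumes P: "nondegenerate P" and ins: "inscribed dx dy (newton_polygon P)" and pos: "0 < deg_x P" "0 < deg_y P"
    and p: "p \<in> singular_points P"
  shows "\<exists>bx by. p = (pt bx 0, pt by 0)"
proof -
  obtain bx "by" u v where uv: "p = (pt bx u, pt by v)" and z: "lpoly bx by P u v = 0"
    "deriv (\<lambda>u. lpoly bx by P u v) u = 0" "deriv (lpoly bx by P u) v = 0"
    by (rule singular_pointsE[OF p])
  let ?A = "lsupp bx by P"
  let ?c = "\<lambda>s. lcoef bx by P (fst s) (snd s)"
  obtain b0 a0 where ab: "(0, b0) \<in> ?A" "(a0, 0) \<in> ?A" using lsupp_axes[OF ins pos] by blast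
  have ne: "?A \<noteq> {}" using ab by auto
  have zu: "(\<Sum>s\<in>?A. of_nat (fst s) * (?c s * u ^ fst s * v ^ snd s)) = 0"
  proof -
    have "u * deriv (\<lambda>u. lpoly bx by P u v) u = (\<Sum>s\<in>?A. ?c s * v ^ snd s * (u * (of_nat (fst s) * u ^ (fst s - 1))))"
      unfolding deriv_lpoly sum_distrib_left by (intro sum.cong) (auto simp: mult_ac)
    then show ?thesis unfolding of_nat_mult_power_pred using z by (simp add: mult_ac)
  qed
  have zv: "(\<Sum>s\<in>?A. of_nat (snd s) * (?c s * u ^ fst s * v ^ snd s)) = 0"
  proof -
    have "v * deriv (lpoly bx by P u) v = (\<Sum>s\<in>?A. ?c s * u ^ fst s * (v * (of_nat (snd s) * v ^ (snd s - 1))))"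
      unfolding deriv_lpoly sum_distrib_left by (intro sum.cong) (auto simp: mult_ac)
    then show ?thesis unfolding of_nat_mult_power_pred using z by (simp add: mult_ac)
  qed
  have z0: "(\<Sum>s\<in>?A. ?c s * u ^ fst s * v ^ snd s) = 0" using z(1) by (simp add: lpoly_alt)
  have "u = 0 \<and> v = 0"
  proof (rule ccontr)
    assume "\<not> ?thesis"
    then consider "u \<noteq> 0" "v \<noteq> 0" | "u = 0" "v \<noteq> 0" | "u \<noteq> 0" "v = 0" by blast
    then show False
    proof cases
      case 1
      have F: "?A = face 0 0 ?A" by (auto simp: face_def)
      show False
        by (rule face_smooth[OF P ne 1 F]) (use z0 zu zv in \<open>simp_all add: split_beta\<close>)
    next
      case 2
      define F where "F = {s\<in>?A. fst s = 0}"
      have F: "F = face 1 0 ?A" using ab(1) by (auto simp: F_def face_def)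
      have FA: "(\<Sum>s\<in>?A. w s * (?c s * u ^ fst s * v ^ snd s)) = (\<Sum>s\<in>F. w s * (?c s * 1 ^ fst s * v ^ snd s))" for w
      proof -
        have "(\<Sum>s\<in>F. w s * (?c s * 1 ^ fst s * v ^ snd s)) = (\<Sum>s\<in>F. w s * (?c s * u ^ fst s * v ^ snd s))"
          by (intro sum.cong) (auto simp: F_def 2)
        also have "\<dots> = (\<Sum>s\<in>?A. w s * (?c s * u ^ fst s * v ^ snd s))"
          by (intro sum.mono_neutral_left) (auto simp: F_def 2)
        finally show ?thesis by simp
      qed
      show False
        by (rule face_smooth[OF P ne one_neq_zero 2(2) F])
           (use z0 zv FA[of "\<lambda>_. 1"] FA[of "\<lambda>s. of_nat (snd s)"] in \<open>simp_all add: split_beta F_def\<close>)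
    next
      case 3
      define F where "F = {s\<in>?A. snd s = 0}"
      have F: "F = face 0 1 ?A" using ab(2) by (auto simp: F_def face_def)
      have FA: "(\<Sum>s\<in>?A. w s * (?c s * u ^ fst s * v ^ snd s)) = (\<Sum>s\<in>F. w s * (?c s * u ^ fst s * 1 ^ snd s))" for w
      proof -
        have "(\<Sum>s\<in>F. w s * (?c s * u ^ fst s * 1 ^ snd s)) = (\<Sum>s\<in>F. w s * (?c s * u ^ fst s * v ^ snd s))"
          by (intro sum.cong) (auto simp: F_def 3)
        also have "\<dots> = (\<Sum>s\<in>?A. w s * (?c s * u ^ fst s * v ^ snd s))"
          by (intro sum.mono_neutral_left) (auto simp: F_def 3)
        finally show ?thesis by simp
      qed
      show False
        by (rule face_smooth[OF P ne 3(1) one_neq_zero F])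
           (use z0 zu FA[of "\<lambda>_. 1"] FA[of "\<lambda>s. of_nat (fst s)"] in \<open>simp_all add: split_beta F_def\<close>)
    qed
  qed
  then show ?thesis using uv by blast
qed

text \<open>Value and first derivatives at the corner are the coefficients of 1, u and v. A corner
  lies in only one pair of charts, so no other chart can make it singular.\<close>

lemma corner_singular_iff:
  "(pt bx 0, pt by 0) \<in> singular_points P \<longleftrightarrow> (\<forall>s\<in>lsupp bx by P. 2 \<le> fst s + snd s)"
proof -
  let ?A = "lsupp bx by P"
  let ?c = "\<lambda>s. lcoef bx by P (fst s) (snd s)"
  have cne: "?c s \<noteq> 0" if "s \<in> ?A" for s using that by (auto simp: lsupp_def)
  have 0: "lpoly bx by P 0 0 = 0 \<longleftrightarrow> (0, 0) \<notin> ?A"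
  proof -
    have "lpoly bx by P 0 0 = (\<Sum>s\<in>?A. if s = (0, 0) then ?c s else 0)"
      unfolding lpoly_alt by (intro sum.cong refl) (auto simp: power_0_left prod_eq_iff)
    also have "\<dots> = (if (0, 0) \<in> ?A then ?c (0, 0) else 0)" by (simp add: sum.delta)
    finally show ?thesis using cne[of "(0, 0)"] by auto
  qed
  have 1: "deriv (\<lambda>u. lpoly bx by P u 0) 0 = 0 \<longleftrightarrow> (1, 0) \<notin> ?A"
  proof -
    have "deriv (\<lambda>u. lpoly bx by P u 0) 0 = (\<Sum>s\<in>?A. if s = (1, 0) then ?c s else 0)"
      unfolding deriv_lpoly by (intro sum.cong refl) (auto simp: power_0_left prod_eq_iff)
    also have "\<dots> = (if (1, 0) \<in> ?A then ?c (1, 0) else 0)" by (simp add: sum.delta)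
    finally show ?thesis using cne[of "(1, 0)"] by auto
  qed
  have 2: "deriv (lpoly bx by P 0) 0 = 0 \<longleftrightarrow> (0, 1) \<notin> ?A"
  proof -
    have "deriv (lpoly bx by P 0) 0 = (\<Sum>s\<in>?A. if s = (0, 1) then ?c s else 0)"
      unfolding deriv_lpoly by (intro sum.cong refl) (auto simp: power_0_left prod_eq_iff)
    also have "\<dots> = (if (0, 1) \<in> ?A then ?c (0, 1) else 0)" by (simp add: sum.delta)
    finally show ?thesis using cne[of "(0, 1)"] by auto
  qed
  have "(pt bx 0, pt by 0) \<in> singular_points P \<longleftrightarrow>
      lpoly bx by P 0 0 = 0 \<and> deriv (\<lambda>u. lpoly bx by P u 0) 0 = 0 \<and> deriv (lpoly bx by P 0) 0 = 0"
  proof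
    assume "(pt bx 0, pt by 0) \<in> singular_points P"
    then obtain bx' by' u v where *: "(pt bx 0, pt by 0) = (pt bx' u, pt by' v)" "lpoly bx' by' P u v = 0"
        "deriv (\<lambda>u. lpoly bx' by' P u v) u = 0" "deriv (lpoly bx' by' P u) v = 0"
      by (rule singular_pointsE)
    then have "bx' = bx" "u = 0" "by' = by" "v = 0" using pt_eq_pt_0_iff by (metis Pair_inject)+
    with * show "lpoly bx by P 0 0 = 0 \<and> deriv (\<lambda>u. lpoly bx by P u 0) 0 = 0 \<and> deriv (lpoly bx by P 0) 0 = 0"
      by simp
  qed (simp add: singular_pointsI)
  also have "\<dots> \<longleftrightarrow> (\<forall>s\<in>?A. 2 \<le> fst s + snd s)"
    unfolding 0 1 2
  proof (intro iffI ballI)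
    fix s assume "(0, 0) \<notin> ?A \<and> (1, 0) \<notin> ?A \<and> (0, 1) \<notin> ?A" "s \<in> ?A"
    then have "s \<noteq> (0, 0)" "s \<noteq> (1, 0)" "s \<noteq> (0, 1)" by auto
    then show "2 \<le> fst s + snd s" by (cases s) auto
  qed force
  finally show ?thesis .
qed

section \<open>Edge polynomials and their roots\<close>

lemma pderiv_sum: "pderiv (\<Sum>i\<in>I. f i) = (\<Sum>i\<in>I. pderiv (f i))"
  by (induction I rule: infinite_finite_induct) (simp_all add: pderiv_add)

text \<open>The face polynomial with first variable 1, which loses nothing by quasi-homogeneity. Its
  nonzero roots are the candidates for the leading coefficient d of v = d z^n + ... on a branch with
  u = z^m.\<close>

definition edge_poly :: "bool \<Rightarrow> bool \<Rightarrow> poly_xy \<Rightarrow> nat \<Rightarrow> nat \<Rightarrow> complex \<Rightarrow> complex" where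
  "edge_poly bx by P m n d = (\<Sum>s\<in>face m n (lsupp bx by P). lcoef bx by P (fst s) (snd s) * d ^ snd s)"

lemma face_weight:
  assumes "s \<in> face m n A" "t \<in> face m n A"
  shows "m * fst s + n * snd s = m * fst t + n * snd t"
  using assms by (intro le_antisym) (simp_all add: face_def)

text \<open>The sum is d times the derivative. Since \<open>m * fst s + n * snd s\<close> is
  constant on the face, its vanishing together with the root condition makes the logarithmic
  derivative in the first variable vanish too, against nondegeneracy at (1, d).\<close>

lemma edge_poly_simple_root:
  assumes P: "nondegenerate P" and ne: "lsupp bx by P \<noteq> {}" and m: "0 < m" and d: "d \<noteq> 0" "edge_poly bx by P m n d = 0"
  shows "(\<Sum>s\<in>face m n (lsupp bx by P). of_nat (snd s) * (lcoef bx by P (fst s) (snd s) * d ^ snd s)) \<noteq> 0"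
proof
  let ?F = "face m n (lsupp bx by P)"
  let ?c = "\<lambda>s. lcoef bx by P (fst s) (snd s) * d ^ snd s"
  assume z: "(\<Sum>s\<in>?F. of_nat (snd s) * ?c s) = 0"
  have E: "(\<Sum>s\<in>?F. ?c s) = 0" using d(2) by (simp add: edge_poly_def)
  have "(\<Sum>s\<in>?F. of_nat (fst s) * ?c s) = 0"
  proof (cases "?F = {}")
    case False
    then obtain t where t: "t \<in> ?F" by blast
    define h where "h = m * fst t + n * snd t"
    have "of_nat m * (\<Sum>s\<in>?F. of_nat (fst s) * ?c s) + of_nat n * (\<Sum>s\<in>?F. of_nat (snd s) * ?c s)
        = (\<Sum>s\<in>?F. of_nat (m * fst s + n * snd s) * ?c s)"
      by (simp add: sum_distrib_left sum.distrib algebra_simps)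
    also have "\<dots> = (\<Sum>s\<in>?F. of_nat h * ?c s)"
      using face_weight[OF _ t] by (intro sum.cong) (auto simp: h_def)
    also have "\<dots> = 0" using E by (simp flip: sum_distrib_left)
    finally show ?thesis using z m by simp
  qed simp
  then show False
    using face_smooth[OF P ne one_neq_zero d(1) refl, of m n] E z by (simp add: split_beta)
qed

text \<open>The exponents of \<open>d\<close> on an edge of primitive inner normal \<open>(m, n)\<close> are congruent modulo \<open>m\<close>.\<close>

lemma edge_poly_factor:
  assumes m: "0 < m" and cop: "coprime m n" and st: "s \<in> face m n (lsupp bx by P)" "t \<in> face m n (lsupp bx by P)"
    and lt: "snd s < snd t"
  obtains b0 E where "\<forall>d. edge_poly bx by P m n d = d ^ b0 * poly E (d ^ m)"
    "\<forall>d. (\<Sum>s\<in>face m n (lsupp bx by P). of_nat (snd s) * (lcoef bx by P (fst s) (snd s) * d ^ snd s))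
        = d ^ b0 * (of_nat b0 * poly E (d ^ m) + of_nat m * d ^ m * poly (pderiv E) (d ^ m))"
    "poly E 0 \<noteq> 0" "snd t \<le> snd s + m * degree E" "m dvd snd t - snd s"
proof -
  let ?F = "face m n (lsupp bx by P)"
  have fin: "finite ?F" by (rule finite_subset[OF _ finite_lsupp]) (auto simp: face_def)
  let ?c = "\<lambda>s. lcoef bx by P (fst s) (snd s)"
  have cne: "?c s \<noteq> 0" if "s \<in> ?F" for s using that by (auto simp: lsupp_def face_def)
  obtain s0 where s0: "s0 \<in> ?F" "\<And>r. r \<in> ?F \<Longrightarrow> snd s0 \<le> snd r"
    using ex_is_arg_min_if_finite[OF fin, of snd] st unfolding is_arg_min_linorder by blast
  define b0 where "b0 = snd s0"
  have dv: "m dvd snd r - snd r'" if r: "r \<in> ?F" "r' \<in> ?F" "snd r' \<le> snd r" for r r'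
  proof -
    have e: "m * fst r + n * snd r = m * fst r' + n * snd r'" using face_weight r by blast
    have "int n * int (snd r - snd r') = int m * (int (fst r') - int (fst r))"
      using arg_cong[OF e, of int] r(3) by (simp add: of_nat_diff algebra_simps)
    then have "int m dvd int n * int (snd r - snd r')" by simp
    then have "m dvd n * (snd r - snd r')" by (metis of_nat_dvd_iff of_nat_mult)
    then show ?thesis using cop by (simp add: coprime_dvd_mult_right_iff)
  qed
  define e :: "nat \<times> nat \<Rightarrow> nat" where "e r = (snd r - b0) div m" for r
  have se: "snd r = b0 + m * e r" if "r \<in> ?F" for r
    using dv[OF that s0(1)] s0(2)[OF that] by (simp add: e_def b0_def)
  have inj: "inj_on e ?F"
  proof
    fix r r' assume r: "r \<in> ?F" "r' \<in> ?F" "e r = e r'"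
    then have "snd r = snd r'" using se by simp
    moreover from this have "fst r = fst r'" using face_weight[OF r(1,2)] m by simp
    ultimately show "r = r'" by (simp add: prod_eq_iff)
  qed
  define E where "E = (\<Sum>r\<in>?F. monom (?c r) (e r))"
  have cE: "coeff E (e r) = ?c r" if r: "r \<in> ?F" for r
  proof -
    have "coeff E (e r) = (\<Sum>r'\<in>?F. if r' = r then ?c r' else 0)"
      unfolding E_def coeff_sum using inj r by (intro sum.cong) (auto dest: inj_onD)
    then show ?thesis using r fin by simp
  qed
  have pE: "poly E w = (\<Sum>r\<in>?F. ?c r * w ^ e r)" for w by (simp add: E_def poly_sum poly_monom)
  have pE': "w * poly (pderiv E) w = (\<Sum>r\<in>?F. of_nat (e r) * (?c r * w ^ e r))" for w
  proof -
    have "w * poly (pderiv E) w = (\<Sum>r\<in>?F. ?c r * (w * (of_nat (e r) * w ^ (e r - 1))))"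
      by (simp add: E_def pderiv_sum pderiv_monom poly_sum poly_monom sum_distrib_left mult_ac)
    then show ?thesis unfolding of_nat_mult_power_pred by (simp add: mult_ac)
  qed
  show ?thesis
  proof (rule that[of b0 E]; (intro allI)?)
    fix d :: complex
    have pw: "d ^ snd r = d ^ b0 * (d ^ m) ^ e r" if "r \<in> ?F" for r
      by (subst se[OF that]) (simp only: power_add power_mult)
    show 1: "edge_poly bx by P m n d = d ^ b0 * poly E (d ^ m)"
      unfolding edge_poly_def pE sum_distrib_left using pw by (intro sum.cong) auto
    have "(\<Sum>s\<in>?F. of_nat (snd s) * (?c s * d ^ snd s)) =
        (\<Sum>s\<in>?F. d ^ b0 * (of_nat b0 * (?c s * (d ^ m) ^ e s) + of_nat m * (of_nat (e s) * (?c s * (d ^ m) ^ e s))))"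
    proof (intro sum.cong refl)
      fix r assume r: "r \<in> ?F"
      have "of_nat (snd r) = (of_nat b0 + of_nat m * of_nat (e r) :: complex)"
        by (subst se[OF r]) simp
      then show "of_nat (snd r) * (?c r * d ^ snd r) =
        d ^ b0 * (of_nat b0 * (?c r * (d ^ m) ^ e r) + of_nat m * (of_nat (e r) * (?c r * (d ^ m) ^ e r)))"
        unfolding pw[OF r] by (simp add: algebra_simps)
    qed
    also have "\<dots> = d ^ b0 * (of_nat b0 * poly E (d ^ m) + of_nat m * ((d ^ m) * poly (pderiv E) (d ^ m)))"
      unfolding pE pE' by (simp only: sum_distrib_left[symmetric] sum.distrib)
    finally show "(\<Sum>s\<in>?F. of_nat (snd s) * (?c s * d ^ snd s)) =
        d ^ b0 * (of_nat b0 * poly E (d ^ m) + of_nat m * d ^ m * poly (pderiv E) (d ^ m))"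
      by (simp add: mult.assoc)
  next
    have "e s0 = 0" by (simp add: e_def b0_def)
    then show "poly E 0 \<noteq> 0" using cE[OF s0(1)] cne[OF s0(1)] by (simp add: poly_0_coeff_0)
    have "e t \<le> degree E" using cE[OF st(2)] cne[OF st(2)] by (intro le_degree) simp
    then have "m * e t \<le> m * degree E" by (rule mult_le_mono2)
    then show "snd t \<le> snd s + m * degree E" using se[OF st(2)] s0(2)[OF st(1)] unfolding b0_def by linarith
    show "m dvd snd t - snd s" using dv st lt by simp
  qed
qed

lemma exists_nth_root:
  fixes w :: complex
  assumes "0 < m"
  shows "\<exists>d. d ^ m = w"
proof (cases "w = 0")
  case False
  then have "exp (Ln w / of_nat m) ^ m = w" using assms by (simp add: exp_divide_power_eq)
  then show ?thesis by blast
qed (use assms in auto)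

text \<open>\<open>E\<close> is nonconstant because two exponents differ, and 0 is not a root of it;
  any \<open>m\<close>-th root of a root of \<open>E\<close> works.\<close>

lemma edge_poly_root_exists:
  assumes m: "0 < m" and cop: "coprime m n" and st: "s \<in> face m n (lsupp bx by P)" "t \<in> face m n (lsupp bx by P)"
    and lt: "snd s < snd t"
  shows "\<exists>d. d \<noteq> 0 \<and> edge_poly bx by P m n d = 0"
proof -
  obtain b0 E where E: "\<forall>d. edge_poly bx by P m n d = d ^ b0 * poly E (d ^ m)"
    "poly E 0 \<noteq> 0" "snd t \<le> snd s + m * degree E"
    using edge_poly_factor[OF assms] by metis
  have "degree E \<noteq> 0" using E(3) lt by (intro notI) simp
  then obtain w where w: "poly E w = 0"
    using fundamental_theorem_of_algebra[of E] by (auto simp: constant_degree)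
  obtain d where "d ^ m = w" using exists_nth_root[OF m] by blast
  then show ?thesis using w E by (intro exI[of _ d]) (use m in \<open>auto simp: zero_power\<close>)
qed

text \<open>A gap larger than \<open>m\<close> gives \<open>E\<close> degree at least 2. After
  splitting off one linear factor, a root of the cofactor equal to the first root would be a double
  root of \<open>E\<close>, which \<open>edge_poly_simple_root\<close> excludes.\<close>

lemma edge_poly_two_roots:
  assumes P: "nondegenerate P" and m: "0 < m" and cop: "coprime m n"
    and st: "s \<in> face m n (lsupp bx by P)" "t \<in> face m n (lsupp bx by P)"
    and long: "snd s + m < snd t"
  shows "\<exists>d d'. d \<noteq> 0 \<and> d' \<noteq> 0 \<and> edge_poly bx by P m n d = 0 \<and> edge_poly bx by P m n d' = 0 \<and> d ^ m \<noteq> d' ^ m"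
proof -
  have lt: "snd s < snd t" using long by simp
  obtain b0 E where E: "\<forall>d. edge_poly bx by P m n d = d ^ b0 * poly E (d ^ m)"
    "\<forall>d. (\<Sum>s\<in>face m n (lsupp bx by P). of_nat (snd s) * (lcoef bx by P (fst s) (snd s) * d ^ snd s))
        = d ^ b0 * (of_nat b0 * poly E (d ^ m) + of_nat m * d ^ m * poly (pderiv E) (d ^ m))"
    "poly E 0 \<noteq> 0" "snd t \<le> snd s + m * degree E" "m dvd snd t - snd s"
    by (rule edge_poly_factor[OF m cop st lt])
  have "m < m * degree E" using E(4) long by linarith
  then have deg: "degree E \<ge> 2" by (cases "degree E") auto
  then obtain w where w: "poly E w = 0"
    using fundamental_theorem_of_algebra[of E] by (auto simp: constant_degree)
  obtain E1 where E1: "E = [:- w, 1:] * E1" using w by (auto simp: poly_eq_0_iff_dvd)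
  have "E1 \<noteq> 0" using deg E1 by auto
  then have "degree E = 1 + degree E1" unfolding E1 by (subst degree_mult_eq) auto
  then have "degree E1 \<noteq> 0" using deg by simp
  then obtain w' where w': "poly E1 w' = 0"
    using fundamental_theorem_of_algebra[of E1] by (auto simp: constant_degree)
  obtain d d' where d: "d ^ m = w" "d' ^ m = w'" using exists_nth_root[OF m] by metis
  have Ew': "poly E w' = 0" unfolding E1 using w' by simp
  have d0: "d \<noteq> 0" "d' \<noteq> 0" using d w Ew' E(3) m by (auto simp: zero_power)
  have r: "edge_poly bx by P m n d = 0" using E(1) d w by simp
  have "w \<noteq> w'"
  proof
    assume "w = w'"
    then have "poly (pderiv E) w = 0" unfolding E1 pderiv_mult using w' by (simp add: pderiv_pCons)
    then have "(\<Sum>s\<in>face m n (lsupp bx by P). of_nat (snd s) * (lcoef bx by P (fst s) (snd s) * d ^ snd s)) = 0"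
      using E(2) d(1) w by simp
    moreover have "lsupp bx by P \<noteq> {}" using st by (auto simp: face_def)
    ultimately show False using edge_poly_simple_root[OF P _ m d0(1) r] by simp
  qed
  then show ?thesis using d d0 r E(1) Ew' by (intro exI[of _ d] exI[of _ d']) auto
qed

section \<open>Branches at a corner\<close>

lemma order_factor_strong:
  assumes f: "f holomorphic_on S" "open S" "z0 \<in> S" "f z0 = 0" and nz: "\<not> (\<forall>\<^sub>F z in at z0. f z = 0)"
  obtains h r where "0 < zorder f z0" "0 < r" "ball z0 r \<subseteq> S" "h holomorphic_on ball z0 r"
    "\<forall>z\<in>ball z0 r. f z = h z * (z - z0) ^ nat (zorder f z0) \<and> h z \<noteq> 0"
proof -
  obtain e where e: "e > 0" "ball z0 e \<subseteq> S" using f(2,3) openE by blast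
  have hol: "f holomorphic_on ball z0 e" using f(1) e(2) by (rule holomorphic_on_subset)
  have "\<exists>w\<in>ball z0 e. f w \<noteq> 0"
  proof (rule ccontr)
    assume "\<not> ?thesis"
    then have "\<forall>\<^sub>F z in at z0. f z = 0"
      using eventually_at_ball[OF e(1), of z0 UNIV] by (elim eventually_mono) auto
    with nz show False by simp
  qed
  moreover have "z0 \<in> ball z0 e" using e(1) by simp
  ultimately have "(if f z0 = 0 then zorder f z0 > 0 else zorder f z0 = 0) \<and> (\<exists>r. r>0 \<and> cball z0 r \<subseteq> ball z0 e
      \<and> zor_poly f z0 holomorphic_on cball z0 r
      \<and> (\<forall>w\<in>cball z0 r. f w = zor_poly f z0 w * (w - z0) ^ nat (zorder f z0) \<and> zor_poly f z0 w \<noteq> 0))"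
    using zorder_exist_zero[OF hol open_ball connected_ball] by blast
  then obtain r where r: "zorder f z0 > 0" "r > 0" "cball z0 r \<subseteq> ball z0 e" "zor_poly f z0 holomorphic_on cball z0 r"
    "\<forall>w\<in>cball z0 r. f w = zor_poly f z0 w * (w - z0) ^ nat (zorder f z0) \<and> zor_poly f z0 w \<noteq> 0"
    using f(4) by auto
  show ?thesis
    by (rule that[of r "zor_poly f z0"])
       (use r e ball_subset_cball[of z0 r] holomorphic_on_subset[OF r(4) ball_subset_cball] in \<open>auto simp: subset_iff\<close>)
qed

text \<open>A nonvanishing holomorphic function on a ball has a holomorphic logarithm.\<close>

lemma holomorphic_nth_root_ball:
  assumes h: "h holomorphic_on ball z0 r" "\<And>z. z \<in> ball z0 r \<Longrightarrow> h z \<noteq> 0" and n: "0 < n"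
  obtains k where "k holomorphic_on ball z0 r" "\<forall>z\<in>ball z0 r. h z = k z ^ n"
proof -
  obtain g where g: "g holomorphic_on ball z0 r" "\<And>z. z \<in> ball z0 r \<Longrightarrow> h z = exp (g z)"
    using contractible_imp_holomorphic_log[OF h(1) convex_imp_contractible[OF convex_ball] h(2)] by metis
  show ?thesis
  proof (rule that[of "\<lambda>z. exp (g z / of_nat n)"])
    show "(\<lambda>z. exp (g z / of_nat n)) holomorphic_on ball z0 r"
      using g(1) n by (intro holomorphic_intros) auto
    show "\<forall>z\<in>ball z0 r. h z = exp (g z / of_nat n) ^ n"
      using g(2) n by (simp add: exp_divide_power_eq)
  qed
qed

section \<open>Changes of charts on a Riemann surface\<close>

locale riemann =
  fixes X :: "'a topology" and A :: "'a coord set"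
  assumes rs: "riemann_surface X A"
begin

lemma coord:
  assumes "c \<in> A"
  shows coord_open: "openin X (fst c)" "open (img c)"
    and coord_homeo: "homeomorphic_map (subtopology X (fst c)) (top_of_set (img c)) (snd c)"
    and coord_sub: "fst c \<subseteq> topspace X"
    and coord_inj: "inj_on (snd c) (fst c)"
proof -
  have ic: "is_coord X c" using rs assms by (simp add: riemann_surface_def)
  then show 1: "openin X (fst c)" "open (img c)"
    and 2: "homeomorphic_map (subtopology X (fst c)) (top_of_set (img c)) (snd c)"
    by (auto simp: is_coord_def)
  show 3: "fst c \<subseteq> topspace X" using 1 by (simp add: openin_subset)
  show "inj_on (snd c) (fst c)"
    using homeomorphic_imp_injective_map[OF 2] 3 by (simp add: Int_absorb1)
qed

lemma param_in [simp]: "z \<in> img c \<Longrightarrow> param c z \<in> fst c"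
  and snd_param [simp]: "z \<in> img c \<Longrightarrow> snd c (param c z) = z"
  by (auto simp: param_def inv_into_into f_inv_into_f)

lemma param_snd [simp]: "c \<in> A \<Longrightarrow> p \<in> fst c \<Longrightarrow> param c (snd c p) = p"
  unfolding param_def using coord_inj by (simp add: inv_into_f_f)

lemma coord_image_open:
  assumes "c \<in> A" "openin X U"
  shows "open (snd c ` (fst c \<inter> U))"
proof -
  have "openin (subtopology X (fst c)) (fst c \<inter> U)"
    using coord_open(1)[OF assms(1)] assms(2) by (simp add: openin_open_subtopology openin_Int)
  then have "openin (top_of_set (img c)) (snd c ` (fst c \<inter> U))"
    using homeomorphic_imp_open_map[OF coord_homeo[OF assms(1)]] by (auto simp: open_map_def)
  then show ?thesis using coord_open(2)[OF assms(1)] by (metis openin_open_trans)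
qed

lemma eventually_param:
  assumes c: "c \<in> A" "p \<in> fst c" "openin X U" "p \<in> U"
  shows "\<forall>\<^sub>F z in nhds (snd c p). z \<in> img c \<and> param c z \<in> U"
proof -
  have "open (snd c ` (fst c \<inter> U))" using coord_image_open c by blast
  then have "\<forall>\<^sub>F z in nhds (snd c p). z \<in> snd c ` (fst c \<inter> U)"
    using c by (intro eventually_nhds_in_open) auto
  then show ?thesis by eventually_elim (use c in auto)
qed

lemma openin_param_image:
  assumes c: "c \<in> A" and B: "open B" "B \<subseteq> img c"
  shows "openin X (param c ` B)"
proof -
  have "param c ` B = {p \<in> topspace (subtopology X (fst c)). snd c p \<in> B}"
  proof (intro set_eqI iffI)
    fix p assume "p \<in> param c ` B"
    then obtain z where "z \<in> B" "p = param c z" by blast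
    then show "p \<in> {p \<in> topspace (subtopology X (fst c)). snd c p \<in> B}"
      using B(2) subsetD[OF coord_sub[OF c] param_in[of z c]] param_in[of z c] snd_param[of z c] by auto
  next
    fix p assume "p \<in> {p \<in> topspace (subtopology X (fst c)). snd c p \<in> B}"
    then show "p \<in> param c ` B" using c by (intro image_eqI[of _ _ "snd c p"]) auto
  qed
  moreover have "openin (top_of_set (img c)) B" using B by (simp add: open_subset)
  ultimately have "openin (subtopology X (fst c)) (param c ` B)"
    using openin_continuous_map_preimage[OF homeomorphic_imp_continuous_map[OF coord_homeo[OF c]]] by metis
  then show ?thesis using coord_open(1)[OF c] by (rule openin_trans_full)
qed

text \<open>An injective holomorphic change of parameter on part of a chart is compatible with every
  chart, and the atlas is maximal. This is how standard coordinates are found in the atlas.\<close>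

lemma reparametrised_coord:
  assumes c: "c \<in> A" and B: "open B" "B \<subseteq> img c"
    and \<phi>: "\<phi> holomorphic_on B" "inj_on \<phi> B"
  defines "c' \<equiv> (param c ` B, \<phi> \<circ> snd c)"
  shows "c' \<in> A" "\<And>z. z \<in> B \<Longrightarrow> param c' (\<phi> z) = param c z"
proof -
  have img': "img c' = \<phi> ` B" using B(2) by (force simp: c'_def)
  have sub: "param c ` B \<subseteq> fst c" using B(2) by auto
  have inj': "inj_on (snd c') (fst c')"
    using \<phi>(2) B(2) by (auto simp: c'_def inj_on_def) (metis subsetD snd_param)
  have op: "open (\<phi> ` U)" if "open U" "U \<subseteq> B" for U
    using \<phi> that by (intro open_mapping_thm3) (auto intro: holomorphic_on_subset inj_on_subset)
  show par: "param c' (\<phi> z) = param c z" if "z \<in> B" for z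
  proof -
    have "\<phi> z = snd c' (param c z)" using that B(2) by (auto simp: c'_def)
    moreover have "param c z \<in> fst c'" using that by (simp add: c'_def)
    ultimately show ?thesis unfolding param_def[of c'] using inj' by (simp add: inv_into_f_f)
  qed
  have "is_coord X c'"
    unfolding is_coord_def img'
  proof (intro conjI)
    show "openin X (fst c')" using openin_param_image[OF c B] by (simp add: c'_def)
    show "open (\<phi> ` B)" using op[OF B(1)] by simp
    have "homeomorphic_map (subtopology (subtopology X (fst c)) (param c ` B))
        (subtopology (top_of_set (img c)) B) (snd c)"
    proof (rule homeomorphic_map_subtopologies[OF coord_homeo[OF c]])
      have "topspace (subtopology X (fst c)) \<inter> param c ` B = param c ` B"
        using sub coord_sub[OF c] by auto
      moreover have "snd c ` param c ` B = B" using B(2) by (force simp: image_image)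
      ultimately show "snd c ` (topspace (subtopology X (fst c)) \<inter> param c ` B) = topspace (top_of_set (img c)) \<inter> B"
        using B(2) by auto
    qed
    then have 1: "homeomorphic_map (subtopology X (param c ` B)) (top_of_set B) (snd c)"
      using sub B(2) by (simp add: subtopology_subtopology Int_absorb1)
    have 2: "homeomorphic_map (top_of_set B) (top_of_set (\<phi> ` B)) \<phi>"
    proof (rule bijective_open_imp_homeomorphic_map)
      show "continuous_map (top_of_set B) (top_of_set (\<phi> ` B)) \<phi>"
        using holomorphic_on_imp_continuous_on[OF \<phi>(1)] by auto
      show "open_map (top_of_set B) (top_of_set (\<phi> ` B)) \<phi>"
        unfolding open_map_def
      proof (intro allI impI)
        fix U assume U: "openin (top_of_set B) U"
        then have "open U" "U \<subseteq> B" using B(1) by (auto simp: openin_open_eq)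
        then show "openin (top_of_set (\<phi> ` B)) (\<phi> ` U)" using op by (intro open_subset) auto
      qed
    qed (use \<phi> in auto)
    show "homeomorphic_map (subtopology X (fst c')) (top_of_set (\<phi> ` B)) (snd c')"
      using homeomorphic_map_compose[OF 1 2] by (simp add: c'_def)
  qed
  moreover have "compatible c' d" if d: "d \<in> A" for d
  proof -
    have comp: "transition c d holomorphic_on snd c ` (fst c \<inter> fst d)" "transition d c holomorphic_on snd d ` (fst c \<inter> fst d)"
      using rs c d by (auto simp: riemann_surface_def compatible_def)
    obtain \<psi> where \<psi>: "\<psi> holomorphic_on \<phi> ` B" "\<And>z. z \<in> B \<Longrightarrow> \<psi> (\<phi> z) = z"
      using holomorphic_has_inverse[OF \<phi>(1) B(1) \<phi>(2)] by metis
    have fc': "fst c' = param c ` B" by (simp add: c'_def)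
    define N where "N = {z \<in> B. param c z \<in> fst d}"
    have sc: "snd c' ` (fst c' \<inter> fst d) = \<phi> ` N"
      using B(2) by (force simp: c'_def N_def)
    have "(transition c d \<circ> \<psi>) holomorphic_on \<phi> ` N"
    proof (rule holomorphic_on_compose)
      show "\<psi> holomorphic_on \<phi> ` N" using \<psi>(1) by (rule holomorphic_on_subset) (auto simp: N_def)
      have "\<psi> ` \<phi> ` N = N" using \<psi>(2) by (force simp: N_def)
      moreover have "N \<subseteq> snd c ` (fst c \<inter> fst d)"
      proof
        fix z assume "z \<in> N"
        then have "z \<in> img c" "param c z \<in> fst d" using B(2) by (auto simp: N_def)
        then show "z \<in> snd c ` (fst c \<inter> fst d)" by (intro image_eqI[of _ _ "param c z"]) auto
      qed
      ultimately show "transition c d holomorphic_on \<psi> ` \<phi> ` N"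
        using comp(1) by (auto intro: holomorphic_on_subset)
    qed
    then have 1: "transition c' d holomorphic_on snd c' ` (fst c' \<inter> fst d)"
      unfolding sc
      by (rule holomorphic_transform) (auto simp: transition_def \<psi>(2) par N_def)
    have "(\<phi> \<circ> transition d c) holomorphic_on snd d ` (fst c' \<inter> fst d)"
    proof (rule holomorphic_on_compose)
      show "transition d c holomorphic_on snd d ` (fst c' \<inter> fst d)"
        using comp(2) by (rule holomorphic_on_subset) (use sub in \<open>auto simp: fc'\<close>)
      have "transition d c ` snd d ` (fst c' \<inter> fst d) \<subseteq> B"
        using d B(2) by (auto simp: transition_def fc')
      then show "\<phi> holomorphic_on transition d c ` snd d ` (fst c' \<inter> fst d)"
        using \<phi>(1) by (rule holomorphic_on_subset[rotated])
    qed
    then have 2: "transition d c' holomorphic_on snd d ` (fst c' \<inter> fst d)"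
      by (rule holomorphic_transform) (auto simp: transition_def c'_def)
    show ?thesis using 1 2 by (simp add: compatible_def)
  qed
  ultimately show "c' \<in> A" using rs unfolding riemann_surface_def by blast
qed

end

lemma finite_imp_eventually_not_in:
  fixes z :: "'b::t1_space"
  assumes "finite N"
  shows "\<forall>\<^sub>F x in at z. x \<notin> N"
proof -
  have "open (- (N - {z}))" using assms by (intro open_Compl finite_imp_closed) auto
  then have "\<forall>\<^sub>F x in at z. x \<in> - (N - {z}) - {z}" by (intro eventually_at_in_open) auto
  then show ?thesis by eventually_elim auto
qed

section \<open>Points over a fixed corner and their parametrisation\<close>

locale curve_corner =
  fixes P :: poly_xy and \<eta> :: "'a \<Rightarrow> proj1 \<times> proj1" and S :: "'a spectral_curve"
    and bx "by" :: bool and dx dy :: nat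
  assumes nondeg: "nondegenerate P" and ins: "inscribed dx dy (newton_polygon P)"
    and csc: "compact_spectral_curve P \<eta> S"
begin

sublocale riemann "surface S" "coords S"
  by unfold_locales (use csc in \<open>auto simp: compact_spectral_curve_def normalisation_def\<close>)

abbreviation "A \<equiv> lsupp bx by P"
abbreviation "Q u v \<equiv> lpoly bx by P u v"
abbreviation "corner \<equiv> (pt bx 0, pt by 0)"
abbreviation "cof s \<equiv> lcoef bx by P (fst s) (snd s)"

lemma param_topspace: "c \<in> coords S \<Longrightarrow> z \<in> img c \<Longrightarrow> param c z \<in> topspace (surface S)"
  by (rule subsetD[OF coord_sub param_in])

lemma deg_pos: "0 < deg_x P" "0 < deg_y P"
  using csc by (auto simp: compact_spectral_curve_def)

lemma axes: "\<exists>b. (0, b) \<in> A" "\<exists>a. (a, 0) \<in> A"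
  using lsupp_axes[OF ins deg_pos] by auto

lemma A_nonempty: "A \<noteq> {}"
  using axes by auto

lemma norm:
  shows "compact_space (surface S)" "holomorphic_to_proj1 (coords S) (fst \<circ> \<eta>)"
    "holomorphic_to_proj1 (coords S) (snd \<circ> \<eta>)" "\<eta> ` topspace (surface S) = proj_curve P"
    "finite {q \<in> topspace (surface S). \<eta> q \<in> singular_points P}"
    "inj_on \<eta> {q \<in> topspace (surface S). \<eta> q \<notin> singular_points P}"
    "Hausdorff_space (surface S)" "\<Union> (fst ` coords S) = topspace (surface S)"
  using csc by (auto simp: compact_spectral_curve_def normalisation_def riemann_surface_def)

lemma xmap: "q \<in> topspace (surface S) \<Longrightarrow> xmap S q = fst (\<eta> q)"
  using csc by (auto simp: compact_spectral_curve_def)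

lemma on_curve: "q \<in> topspace (surface S) \<Longrightarrow> \<eta> q = (pt bx u, pt by v) \<Longrightarrow> Q u v = 0"
  using norm(4) pt_in_proj_curve_iff[of bx u "by" v P] by (metis image_eqI)

text \<open>There is a monomial on each axis, so the polynomial does not vanish identically
  there.\<close>

lemma Q_finite_roots: "finite {v. Q 0 v = 0}" "finite {u. Q u 0 = 0}"
proof -
  have cne: "cof s \<noteq> 0" if "s \<in> A" for s using that by (auto simp: lsupp_def)
  obtain a b where ab: "(0, b) \<in> A" "(a, 0) \<in> A" using axes by blast
  define p where "p = (\<Sum>s\<in>{s\<in>A. fst s = 0}. monom (cof s) (snd s))"
  have "Q 0 v = poly p v" for v
  proof -
    have "Q 0 v = (\<Sum>s\<in>{s\<in>A. fst s = 0}. cof s * 0 ^ fst s * v ^ snd s)"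
      unfolding lpoly_alt by (intro sum.mono_neutral_right) auto
    then show ?thesis by (simp add: p_def poly_sum poly_monom)
  qed
  moreover have "p \<noteq> 0"
  proof -
    have "coeff p b = (\<Sum>s\<in>{s\<in>A. fst s = 0}. if s = (0, b) then cof s else 0)"
      unfolding p_def coeff_sum by (intro sum.cong) (auto simp: prod_eq_iff)
    also have "\<dots> = cof (0, b)" using ab by simp
    finally show ?thesis using cne[OF ab(1)] by auto
  qed
  ultimately show "finite {v. Q 0 v = 0}" using poly_roots_finite[of p] by simp
  define p' where "p' = (\<Sum>s\<in>{s\<in>A. snd s = 0}. monom (cof s) (fst s))"
  have "Q u 0 = poly p' u" for u
  proof -
    have "Q u 0 = (\<Sum>s\<in>{s\<in>A. snd s = 0}. cof s * u ^ fst s * 0 ^ snd s)"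
      unfolding lpoly_alt by (intro sum.mono_neutral_right) auto
    then show ?thesis by (simp add: p'_def poly_sum poly_monom)
  qed
  moreover have "p' \<noteq> 0"
  proof -
    have "coeff p' a = (\<Sum>s\<in>{s\<in>A. snd s = 0}. if s = (a, 0) then cof s else 0)"
      unfolding p'_def coeff_sum by (intro sum.cong) (auto simp: prod_eq_iff)
    also have "\<dots> = cof (a, 0)" using ab by simp
    finally show ?thesis using cne[OF ab(2)] by auto
  qed
  ultimately show "finite {u. Q u 0 = 0}" using poly_roots_finite[of p'] by simp
qed

text \<open>A corner value \<open>pt b 0\<close> lies in only one chart of the projective line,
  which decides the alternative in \<open>holomorphic_to_proj1\<close>.\<close>

lemma coordinate_function:
  assumes f: "holomorphic_to_proj1 (coords S) f" and c: "c \<in> coords S" "q \<in> fst c" and fq: "f q = pt b 0"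
  obtains W g where "open W" "snd c q \<in> W" "W \<subseteq> img c" "g holomorphic_on W" "g (snd c q) = 0"
    "\<forall>z\<in>W. f (param c z) = pt b (g z)"
proof -
  obtain W g where W: "open W" "snd c q \<in> W" "W \<subseteq> img c" "g holomorphic_on W"
    and g: "(\<forall>z\<in>W. f (param c z) = homog (g z) 1) \<or> (\<forall>z\<in>W. f (param c z) = homog 1 (g z))"
    using f[unfolded holomorphic_to_proj1_def, rule_format, OF c] by (elim exE conjE) (rule that)
  have "\<exists>b'. \<forall>z\<in>W. f (param c z) = pt b' (g z)"
    using g by (elim disjE) (rule exI[of _ False] exI[of _ True], simp add: pt_homog)+
  then obtain b' where b': "\<And>z. z \<in> W \<Longrightarrow> f (param c z) = pt b' (g z)" by blast
  have "pt b' (g (snd c q)) = pt b 0" using b'[OF W(2)] fq c by simp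
  then show ?thesis using that[of W g] W b' by (auto simp: pt_eq_pt_0_iff)
qed

lemma coordinate_functions:
  assumes c: "c \<in> coords S" "q \<in> fst c" and q: "\<eta> q = corner"
  obtains W g h where "open W" "snd c q \<in> W" "W \<subseteq> img c" "g holomorphic_on W" "h holomorphic_on W"
    "g (snd c q) = 0" "h (snd c q) = 0" "\<forall>z\<in>W. \<eta> (param c z) = (pt bx (g z), pt by (h z))"
proof -
  obtain W g where W: "open W" "snd c q \<in> W" "W \<subseteq> img c" "g holomorphic_on W" "g (snd c q) = 0"
      "\<forall>z\<in>W. (fst \<circ> \<eta>) (param c z) = pt bx (g z)"
    by (rule coordinate_function[OF norm(2) c, of bx]) (use q in auto)
  obtain U h where U: "open U" "snd c q \<in> U" "U \<subseteq> img c" "h holomorphic_on U" "h (snd c q) = 0"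
      "\<forall>z\<in>U. (snd \<circ> \<eta>) (param c z) = pt by (h z)"
    by (rule coordinate_function[OF norm(3) c, of "by"]) (use q in auto)
  show ?thesis
    by (rule that[of "W \<inter> U" g h])
       (use W U in \<open>auto intro: holomorphic_on_subset simp: prod_eq_iff\<close>)
qed

text \<open>The normalisation is injective off a finite set, so infinitely many points cannot have
  finitely many images.\<close>

lemma infinite_fibre_contradiction:
  assumes c: "c \<in> coords S" and N: "N \<subseteq> img c" "infinite N" and K: "finite K" "(\<lambda>z. \<eta> (param c z)) ` N \<subseteq> K"
  shows False
proof -
  define B where "B = {q \<in> topspace (surface S). \<eta> q \<in> singular_points P}"
  have inj: "inj_on (param c) (img c)" by (metis inj_onI snd_param)
  have "finite {z \<in> N. param c z \<in> B}"
    using finite_vimage_IntI[OF norm(5), of "param c" N] inj_on_subset[OF inj N(1)]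
    by (simp add: B_def vimage_def Int_def conj_commute)
  then have inf: "infinite {z \<in> N. param c z \<notin> B}"
    using N(2) finite_subset[of N "{z \<in> N. param c z \<in> B} \<union> {z \<in> N. param c z \<notin> B}"] by blast
  have "inj_on (\<lambda>z. \<eta> (param c z)) {z \<in> N. param c z \<notin> B}"
  proof (rule inj_onI)
    fix z w assume zw: "z \<in> {z \<in> N. param c z \<notin> B}" "w \<in> {z \<in> N. param c z \<notin> B}" "\<eta> (param c z) = \<eta> (param c w)"
    then have "z \<in> img c" "w \<in> img c" using N(1) by auto
    moreover from this have "param c z \<in> topspace (surface S)" "param c w \<in> topspace (surface S)"
      using param_topspace[OF c] by simp_all
    ultimately have "param c z = param c w"
      using zw norm(6) by (auto simp: B_def inj_on_def)
    then show "z = w" using inj \<open>z \<in> img c\<close> \<open>w \<in> img c\<close> by (auto dest: inj_onD)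
  qed
  moreover have "finite ((\<lambda>z. \<eta> (param c z)) ` {z \<in> N. param c z \<notin> B})"
    using K(2) by (intro finite_subset[OF _ K(1)]) auto
  ultimately show False using inf by (auto dest: finite_imageD)
qed

text \<open>If one coordinate vanished near \<open>z0\<close>, the other would be confined to the
  finitely many zeros of the polynomial on an axis.\<close>

lemma coordinate_functions_nonzero:
  assumes c: "c \<in> coords S" and W: "open W" "z0 \<in> W" "W \<subseteq> img c"
    and \<eta>: "\<And>z. z \<in> W \<Longrightarrow> \<eta> (param c z) = (pt bx (g z), pt by (h z))"
  shows "\<not> (\<forall>\<^sub>F z in at z0. g z = 0)" "\<not> (\<forall>\<^sub>F z in at z0. h z = 0)"
proof -
  have Q: "Q (g z) (h z) = 0" if "z \<in> W" for z
    using on_curve[OF param_topspace[OF c subsetD[OF W(3) that]] \<eta>[OF that]] .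
  have inf: "infinite N" if f0: "\<forall>\<^sub>F z in at z0. f z = 0" and NW: "N = {z \<in> W. z \<noteq> z0 \<and> f z = 0}" for f :: "complex \<Rightarrow> complex" and N
  proof -
    obtain e where e: "e > 0" "ball z0 e \<subseteq> W" using W openE by blast
    obtain e' where e': "e' > 0" "\<And>z. z \<noteq> z0 \<Longrightarrow> dist z z0 < e' \<Longrightarrow> f z = 0"
      using f0 unfolding eventually_at by blast
    have "ball z0 (min e e') - {z0} \<subseteq> N" using e e' NW by (auto simp: dist_commute)
    moreover have "infinite (ball z0 (min e e') - {z0})" using e e' uncountable_infinite[OF uncountable_ball[of "min e e'" z0]] by simp
    ultimately show ?thesis using finite_subset by blast
  qed
  show "\<not> (\<forall>\<^sub>F z in at z0. g z = 0)"
  proof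
    assume *: "\<forall>\<^sub>F z in at z0. g z = 0"
    have Q0: "Q 0 (h z) = 0" if "z \<in> W" "g z = 0" for z using Q[OF that(1)] that(2) by simp
    show False
    proof (rule infinite_fibre_contradiction[OF c _ inf[OF * refl]])
      show "finite ({pt bx 0} \<times> pt by ` {v. Q 0 v = 0})" using Q_finite_roots by simp
    qed (use W(3) \<eta> Q0 in auto)
  qed
  show "\<not> (\<forall>\<^sub>F z in at z0. h z = 0)"
  proof
    assume *: "\<forall>\<^sub>F z in at z0. h z = 0"
    have Q0: "Q (g z) 0 = 0" if "z \<in> W" "h z = 0" for z using Q[OF that(1)] that(2) by simp
    show False
    proof (rule infinite_fibre_contradiction[OF c _ inf[OF * refl]])
      show "finite (pt bx ` {u. Q u 0 = 0} \<times> {pt by 0})" using Q_finite_roots by simp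
    qed (use W(3) \<eta> Q0 in auto)
  qed
qed

text \<open>Write the local first coordinate as \<open>k z * (z - z0) ^ n\<close> with
  \<open>k\<close> nonvanishing, and absorb an n-th root of \<open>k\<close> into the parameter. The
  derivative of the new parameter at the centre is the value of that root, hence nonzero, so it is
  locally injective.\<close>

lemma standard_coord_exists:
  assumes q: "q \<in> topspace (surface S)" "\<eta> q = corner"
  shows "\<exists>c. standard_coord S q c" "0 < ram_order S q"
proof -
  define c where "c = some_coord S q"
  have "\<exists>c. c \<in> coords S \<and> q \<in> fst c" using q(1) norm(8) by blast
  then have "c \<in> coords S \<and> q \<in> fst c" unfolding c_def some_coord_def by (rule someI_ex)
  then have c: "c \<in> coords S" "q \<in> fst c" by auto
  define z0 where "z0 = snd c q"
  obtain W g h where W: "open W" "z0 \<in> W" "W \<subseteq> img c" "g holomorphic_on W" "g z0 = 0"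
      and \<eta>': "\<forall>z\<in>W. \<eta> (param c z) = (pt bx (g z), pt by (h z))"
    unfolding z0_def by (rule coordinate_functions[OF c q(2)])
  have \<eta>: "\<And>z. z \<in> W \<Longrightarrow> \<eta> (param c z) = (pt bx (g z), pt by (h z))" using \<eta>' by blast
  have xq: "xmap S q = pt bx 0" using xmap q by simp
  have xm: "xmap S (param c z) = pt bx (g z)" if "z \<in> W" for z
  proof -
    have "param c z \<in> topspace (surface S)" using param_topspace[OF c(1) subsetD[OF W(3) that]] .
    then show ?thesis using xmap \<eta>[OF that] by simp
  qed
  obtain k r where r: "0 < zorder g z0" "0 < r" "ball z0 r \<subseteq> W" "k holomorphic_on ball z0 r"
      and k: "\<forall>z\<in>ball z0 r. g z = k z * (z - z0) ^ nat (zorder g z0) \<and> k z \<noteq> 0"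
    by (rule order_factor_strong[OF W(4,1,2,5) coordinate_functions_nonzero(1)[OF c(1) W(1-3) \<eta>]])
  define n where "n = nat (zorder g z0)"
  have n: "0 < n" using r(1) by (simp add: n_def)
  have ram: "ram_order S q = n"
  proof -
    have "zorder (\<lambda>z. if xmap S q = proj_inf then coaff (xmap S (param c z))
                      else aff (xmap S (param c z)) - aff (xmap S q)) z0 = zorder g z0"
    proof (rule zorder_cong[OF _ refl])
      have "\<forall>\<^sub>F z in at z0. z \<in> W" using W(1,2) by (intro eventually_at_in_open') auto
      then show "\<forall>\<^sub>F z in at z0. (if xmap S q = proj_inf then coaff (xmap S (param c z))
                      else aff (xmap S (param c z)) - aff (xmap S q)) = g z"
      proof eventually_elim
        case (elim z)
        then show ?case unfolding xm[OF elim] xq proj_inf_eq pt_eq_pt_0_iff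
          by (auto simp: pt_homog aff_homog coaff_homog)
      qed
    qed
    then show ?thesis by (simp add: ram_order_def Let_def n_def flip: c_def z0_def)
  qed
  then show "0 < ram_order S q" using n by simp
  obtain k' where k': "k' holomorphic_on ball z0 r" "\<forall>z\<in>ball z0 r. k z = k' z ^ n"
    by (rule holomorphic_nth_root_ball[OF r(4) _ n]) (use k in auto)
  define \<phi> where "\<phi> z = (z - z0) * k' z" for z
  have \<phi>: "\<phi> holomorphic_on ball z0 r" unfolding \<phi>_def using k'(1) by (intro holomorphic_intros)
  have z0r: "z0 \<in> ball z0 r" using r(2) by simp
  have "(k' has_field_derivative deriv k' z0) (at z0)"
    using k'(1) z0r by (intro holomorphic_derivI[of _ "ball z0 r"]) auto
  then have "(\<phi> has_field_derivative k' z0) (at z0)"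
    unfolding \<phi>_def by (auto intro!: derivative_eq_intros)
  then have "deriv \<phi> z0 = k' z0" by (rule DERIV_imp_deriv)
  moreover have "k' z0 \<noteq> 0" using k k'(2) z0r n by (metis power_0_left less_numeral_extra(3))
  ultimately obtain \<delta> where \<delta>: "\<delta> > 0" "ball z0 \<delta> \<subseteq> ball z0 r" "inj_on \<phi> (ball z0 \<delta>)"
    using has_complex_derivative_locally_injective[OF \<phi> z0r open_ball] by metis
  define B where "B = ball z0 \<delta>"
  have B: "open B" "B \<subseteq> img c" "\<phi> holomorphic_on B" "inj_on \<phi> B" "z0 \<in> B" "B \<subseteq> W" "B \<subseteq> ball z0 r"
    using \<delta> r(3) W(3) \<phi> by (auto simp: B_def intro: holomorphic_on_subset)
  define c' where "c' = (param c ` B, \<phi> \<circ> snd c)"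
  have c': "c' \<in> coords S" using reparametrised_coord[OF c(1) B(1-4)] by (simp add: c'_def)
  have "standard_coord S q c'"
    unfolding standard_coord_def ram
  proof (intro conjI ballI)
    show "q \<in> fst c'" using B(5) c by (auto simp: c'_def z0_def intro!: image_eqI[of _ _ "snd c q"])
    show "snd c' q = 0" by (simp add: c'_def \<phi>_def z0_def)
    fix p assume "p \<in> fst c'"
    then obtain z where z: "z \<in> B" "p = param c z" by (auto simp: c'_def)
    have "z \<in> img c" using z B by blast
    then have "snd c' p = \<phi> z" by (simp add: c'_def z)
    moreover have "g z = \<phi> z ^ n"
      using k k'(2) subsetD[OF B(7) z(1)] by (simp add: \<phi>_def power_mult_distrib mult.commute flip: n_def)
    moreover have "xmap S p = pt bx (g z)" using xm z B by auto
    ultimately show "xmap S p = (if xmap S q = proj_inf then homog 1 (snd c' p ^ n)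
           else homog (aff (xmap S q) + snd c' p ^ n) 1)"
      unfolding xq proj_inf_eq pt_eq_pt_0_iff by (auto simp: pt_homog aff_homog)
  qed (rule c')
  then show "\<exists>c. standard_coord S q c" by blast
qed

text \<open>A Puiseux branch with leading coefficient \<open>V 0\<close>. Replacing z by \<epsilon>
  z with \<epsilon> ^ r = 1 keeps the first coordinate and multiplies \<open>V 0\<close> by
  \<epsilon> ^ n, so only \<open>V 0 ^ r\<close> can be intrinsic.\<close>

definition branch :: "'a \<Rightarrow> 'a coord \<Rightarrow> nat \<Rightarrow> nat \<Rightarrow> (complex \<Rightarrow> complex) \<Rightarrow> real \<Rightarrow> bool" where
  "branch q c r n V e \<longleftrightarrow> c \<in> coords S \<and> q \<in> fst c \<and> snd c q = 0 \<and> 0 < r \<and> 0 < n \<and> 0 < e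
     \<and> ball 0 e \<subseteq> img c \<and> V holomorphic_on ball 0 e \<and> (\<forall>z\<in>ball 0 e. V z \<noteq> 0)
     \<and> (\<forall>z\<in>ball 0 e. \<eta> (param c z) = (pt bx (z ^ r), pt by (z ^ n * V z)))"

lemma branch_exists:
  assumes q: "q \<in> topspace (surface S)" "\<eta> q = corner" and c: "standard_coord S q c"
  shows "\<exists>n V e. branch q c (ram_order S q) n V e"
proof -
  have cA: "c \<in> coords S" "q \<in> fst c" "snd c q = 0" using c by (auto simp: standard_coord_def)
  obtain W g h where W: "open W" "0 \<in> W" "W \<subseteq> img c" "h holomorphic_on W" "h 0 = 0"
      and \<eta>': "\<forall>z\<in>W. \<eta> (param c z) = (pt bx (g z), pt by (h z))"
    by (rule coordinate_functions[OF cA(1,2) q(2), unfolded cA(3)])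
  have \<eta>: "\<And>z. z \<in> W \<Longrightarrow> \<eta> (param c z) = (pt bx (g z), pt by (h z))" using \<eta>' by blast
  have xq: "xmap S q = pt bx 0" using xmap q by simp
  have u: "pt bx (g z) = pt bx (z ^ ram_order S q)" if "z \<in> W" for z :: complex
  proof -
    have z: "z \<in> img c" using subsetD[OF W(3) that] .
    then have "param c z \<in> topspace (surface S)" using param_topspace[OF cA(1)] by simp
    then have "xmap S (param c z) = pt bx (g z)" using xmap \<eta>[OF that] by simp
    moreover have "xmap S (param c z) = pt bx (z ^ ram_order S q)"
      using c z param_in[OF z] snd_param[OF z] unfolding standard_coord_def xq proj_inf_eq pt_eq_pt_0_iff
      by (auto simp: pt_homog aff_homog)
    ultimately show ?thesis by simp
  qed
  obtain V r where r: "0 < zorder h 0" "0 < r" "ball 0 r \<subseteq> W" "V holomorphic_on ball 0 r"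
      and V: "\<forall>z\<in>ball 0 r. h z = V z * (z - 0) ^ nat (zorder h 0) \<and> V z \<noteq> 0"
    by (rule order_factor_strong[OF W(4,1,2,5) coordinate_functions_nonzero(2)[OF cA(1) W(1-3) \<eta>]])
  have "branch q c (ram_order S q) (nat (zorder h 0)) V r"
    unfolding branch_def
  proof (intro conjI ballI)
    fix z :: complex assume z: "z \<in> ball 0 r"
    then have "z \<in> W" using r(3) by blast
    then show "\<eta> (param c z) = (pt bx (z ^ ram_order S q), pt by (z ^ nat (zorder h 0) * V z))"
      using \<eta> u V z by (simp add: mult.commute)
    show "V z \<noteq> 0" using V z by blast
  qed (use cA r W standard_coord_exists(2)[OF q] in auto)
  then show ?thesis by blast
qed

end

section \<open>Branches and the roots of edge polynomials\<close>

context curve_corner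
begin

definition wmin :: "nat \<Rightarrow> nat \<Rightarrow> nat" where
  "wmin m n = Min ((\<lambda>s. m * fst s + n * snd s) ` A)"

lemma wmin_le: "s \<in> A \<Longrightarrow> wmin m n \<le> m * fst s + n * snd s"
  unfolding wmin_def by (intro Min_le) auto

lemma face_iff: "s \<in> face m n A \<longleftrightarrow> s \<in> A \<and> m * fst s + n * snd s = wmin m n"
proof -
  have "wmin m n \<in> (\<lambda>s. m * fst s + n * snd s) ` A" unfolding wmin_def using A_nonempty by (intro Min_in) auto
  then obtain t where t: "t \<in> A" "wmin m n = m * fst t + n * snd t" by blast
  show ?thesis
  proof
    assume s: "s \<in> face m n A"
    then have "s \<in> A" "m * fst s + n * snd s \<le> wmin m n" using t by (simp_all add: face_def)
    then show "s \<in> A \<and> m * fst s + n * snd s = wmin m n" using wmin_le[of s m n] by simp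
  next
    assume "s \<in> A \<and> m * fst s + n * snd s = wmin m n"
    then show "s \<in> face m n A" using wmin_le by (simp add: face_def)
  qed
qed

lemma wmin_power_0:
  assumes "s \<in> A - face m n A"
  shows "(0 :: complex) ^ (m * fst s + n * snd s - wmin m n) = 0"
proof -
  have "wmin m n < m * fst s + n * snd s" using assms wmin_le[of s m n] by (auto simp: face_iff)
  then show ?thesis by simp
qed

text \<open>What remains of the polynomial after the weighted substitution of z^m for u and z^n v
  for v when the largest common power of z is divided out. It is a deformation of the edge
  polynomial, which is its value at z = 0.\<close>

definition G :: "nat \<Rightarrow> nat \<Rightarrow> complex \<Rightarrow> complex \<Rightarrow> complex" where
  "G m n z v = (\<Sum>s\<in>A. cof s * z ^ (m * fst s + n * snd s - wmin m n) * v ^ snd s)"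

lemma Q_eq_G: "Q (z ^ m) (z ^ n * v) = z ^ wmin m n * G m n z v"
  unfolding lpoly_alt G_def sum_distrib_left
proof (intro sum.cong refl)
  fix s assume s: "s \<in> A"
  have "z ^ wmin m n * z ^ (m * fst s + n * snd s - wmin m n) = z ^ (m * fst s + n * snd s)"
    using wmin_le[OF s, of m n] by (simp flip: power_add)
  moreover have "(z ^ m) ^ fst s * (z ^ n * v) ^ snd s = z ^ (m * fst s + n * snd s) * v ^ snd s"
    by (simp add: power_mult_distrib power_add power_mult)
  ultimately show "cof s * (z ^ m) ^ fst s * (z ^ n * v) ^ snd s =
      z ^ wmin m n * (cof s * z ^ (m * fst s + n * snd s - wmin m n) * v ^ snd s)"
    by (simp add: mult.assoc mult.left_commute)
qed

lemma G_0: "G m n 0 v = edge_poly bx by P m n v"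
proof -
  have "G m n 0 v = (\<Sum>s\<in>face m n A. cof s * 0 ^ (m * fst s + n * snd s - wmin m n) * v ^ snd s)"
    unfolding G_def
    by (rule sum.mono_neutral_right) (auto simp: wmin_power_0 face_iff)
  also have "\<dots> = edge_poly bx by P m n v"
    unfolding edge_poly_def by (rule sum.cong) (auto simp: face_iff)
  finally show ?thesis .
qed

lemma branchD:
  assumes "branch q c r n V e"
  shows "c \<in> coords S" "q \<in> fst c" "snd c q = 0" "0 < r" "0 < n" "0 < e" "ball 0 e \<subseteq> img c"
    "V holomorphic_on ball 0 e" "\<And>z. z \<in> ball 0 e \<Longrightarrow> V z \<noteq> 0"
    "\<And>z. z \<in> ball 0 e \<Longrightarrow> \<eta> (param c z) = (pt bx (z ^ r), pt by (z ^ n * V z))"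
    "V 0 \<noteq> 0" "isCont V 0"
proof -
  show V: "c \<in> coords S" "q \<in> fst c" "snd c q = 0" "0 < r" "0 < n" "0 < e" "ball 0 e \<subseteq> img c"
    "V holomorphic_on ball 0 e" "\<And>z. z \<in> ball 0 e \<Longrightarrow> V z \<noteq> 0"
    "\<And>z. z \<in> ball 0 e \<Longrightarrow> \<eta> (param c z) = (pt bx (z ^ r), pt by (z ^ n * V z))"
    using assms unfolding branch_def by blast+
  show "V 0 \<noteq> 0" using V(6,9) by simp
  show "isCont V 0"
    using holomorphic_on_imp_continuous_on[OF V(8)] V(6) by (simp add: continuous_on_eq_continuous_at)
qed

lemma branch_G:
  assumes b: "branch q c r n V e" and z: "z \<in> ball 0 e" "z \<noteq> 0"
  shows "G r n z (V z) = 0"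
proof -
  note D = branchD[OF b]
  have "Q (z ^ r) (z ^ n * V z) = 0"
    using on_curve[OF param_topspace[OF D(1) subsetD[OF D(7) z(1)]] D(10)[OF z(1)]] .
  then show ?thesis using z(2) by (simp add: Q_eq_G)
qed

lemma continuous_G: "isCont (\<lambda>p. G m n (fst p) (snd p)) p"
  unfolding G_def by (intro continuous_intros)

text \<open>Off z = 0 a branch solves \<open>G r n z (V z) = 0\<close>; the claim is the limit of
  this as z tends to 0.\<close>

lemma branch_root:
  assumes b: "branch q c r n V e"
  shows "edge_poly bx by P r n (V 0) = 0"
proof -
  note D = branchD[OF b]
  have "isCont (\<lambda>z. G r n z (V z)) 0" unfolding G_def using D(12) by (intro continuous_intros)
  then have "((\<lambda>z. G r n z (V z)) \<longlongrightarrow> G r n 0 (V 0)) (at 0)" by (simp add: isCont_def)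
  moreover have "\<forall>\<^sub>F z in at 0. z \<in> ball 0 e - {0 :: complex}"
    using D(6) by (intro eventually_at_in_open) auto
  then have "\<forall>\<^sub>F z in at 0. G r n z (V z) = 0" by eventually_elim (use branch_G[OF b] in auto)
  then have "((\<lambda>z. G r n z (V z)) \<longlongrightarrow> 0) (at 0)" by (rule tendsto_eventually)
  ultimately show ?thesis unfolding G_0[symmetric] by (rule tendsto_unique[OF at_neq_bot])
qed

text \<open>The root \<open>d\<close> of \<open>G m n 0\<close> is simple, so the difference quotient of \<open>G m n z\<close> does not vanish near \<open>d\<close>.\<close>

lemma G_root_unique:
  assumes m: "0 < m" and d: "d \<noteq> 0" "edge_poly bx by P m n d = 0"
  obtains \<epsilon> where "\<epsilon> > 0" "\<forall>z v v'. norm z < \<epsilon> \<longrightarrow> norm (v - d) < \<epsilon> \<longrightarrow> norm (v' - d) < \<epsilon> \<longrightarrow>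
    G m n z v = 0 \<longrightarrow> G m n z v' = 0 \<longrightarrow> v = v'"
proof -
  define k where "k s = m * fst s + n * snd s - wmin m n" for s
  define T where "T p = (\<Sum>s\<in>A. cof s * fst p ^ k s *
      (\<Sum>i<snd s. snd (snd p) ^ (snd s - Suc i) * fst (snd p) ^ i))" for p :: "complex \<times> complex \<times> complex"
  have diff: "G m n z v - G m n z v' = (v - v') * T (z, v, v')" for z v v'
  proof -
    have "G m n z v - G m n z v' = (\<Sum>s\<in>A. cof s * z ^ k s * (v ^ snd s - v' ^ snd s))"
      unfolding G_def k_def by (simp only: sum_subtractf[symmetric] right_diff_distrib)
    then show ?thesis unfolding T_def power_diff_sumr2 sum_distrib_left by (simp add: mult.assoc mult.left_commute)
  qed
  have "isCont T (0, d, d)" unfolding T_def by (intro continuous_intros)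
  moreover have "T (0, d, d) \<noteq> 0"
  proof -
    have "T (0, d, d) = (\<Sum>s\<in>face m n A. cof s * 0 ^ k s * (\<Sum>i<snd s. d ^ (snd s - Suc i) * d ^ i))"
      unfolding T_def fst_conv snd_conv
      by (rule sum.mono_neutral_right) (auto simp: k_def wmin_power_0 face_iff)
    also have "\<dots> = (\<Sum>s\<in>face m n A. cof s * (of_nat (snd s) * d ^ (snd s - 1)))"
    proof (rule sum.cong[OF refl])
      fix s assume s: "s \<in> face m n A"
      have "(\<Sum>i<snd s. d ^ (snd s - Suc i) * d ^ i) = (\<Sum>i<snd s. d ^ (snd s - 1))"
        by (intro sum.cong) (auto simp flip: power_add)
      then show "cof s * 0 ^ k s * (\<Sum>i<snd s. d ^ (snd s - Suc i) * d ^ i) = cof s * (of_nat (snd s) * d ^ (snd s - 1))"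
        using s by (simp add: k_def face_iff)
    qed
    finally have "d * T (0, d, d) = (\<Sum>s\<in>face m n A. cof s * (d * (of_nat (snd s) * d ^ (snd s - 1))))"
      by (simp add: sum_distrib_left mult.left_commute)
    then have "d * T (0, d, d) = (\<Sum>s\<in>face m n A. of_nat (snd s) * (cof s * d ^ snd s))"
      unfolding of_nat_mult_power_pred by (simp add: mult.left_commute)
    then show ?thesis using edge_poly_simple_root[OF nondeg A_nonempty m d] by auto
  qed
  ultimately obtain \<delta> where \<delta>: "\<delta> > 0" "\<And>p. dist (0, d, d) p < \<delta> \<Longrightarrow> T p \<noteq> 0"
    using continuous_at_avoid[of "(0, d, d)" T 0] by metis
  show ?thesis
  proof (rule that[of "\<delta> / 3"])
    show "\<forall>z v v'. norm z < \<delta> / 3 \<longrightarrow> norm (v - d) < \<delta> / 3 \<longrightarrow> norm (v' - d) < \<delta> / 3 \<longrightarrow>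
      G m n z v = 0 \<longrightarrow> G m n z v' = 0 \<longrightarrow> v = v'"
    proof (intro allI impI)
      fix z v v' assume l: "norm z < \<delta> / 3" "norm (v - d) < \<delta> / 3" "norm (v' - d) < \<delta> / 3"
        and G: "G m n z v = 0" "G m n z v' = 0"
      have "dist (0, d, d) (z, v, v') = norm (z, v - d, v' - d)" by (subst dist_commute) (simp add: dist_norm)
      also have "\<dots> \<le> norm z + (norm (v - d) + norm (v' - d))"
        using norm_Pair_le[of z "(v - d, v' - d)"] norm_Pair_le[of "v - d" "v' - d"] by linarith
      also have "\<dots> < \<delta>" using l by simp
      finally have "T (z, v, v') \<noteq> 0" by (rule \<delta>(2))
      then show "v = v'" using diff[of z v v'] G by simp
    qed
  qed (use \<delta> in simp)
qed

lemma eventually_param_not_in_finite: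
  assumes c: "c \<in> coords S" and B: "finite B" and N: "0 \<in> img c" and \<epsilon>: "\<epsilon> \<noteq> 0"
  shows "\<forall>\<^sub>F z in at 0. \<epsilon> * z \<in> img c \<longrightarrow> param c (\<epsilon> * z) \<notin> B"
proof -
  have inj: "inj_on (param c) (img c)" by (metis inj_onI snd_param)
  have "finite (param c -` B \<inter> img c)" using finite_vimage_IntI[OF B inj] .
  then have "finite ((\<lambda>z. z / \<epsilon>) ` (param c -` B \<inter> img c))" by simp
  then have "\<forall>\<^sub>F z in at 0. z \<notin> (\<lambda>z. z / \<epsilon>) ` (param c -` B \<inter> img c)" by (rule finite_imp_eventually_not_in)
  then show ?thesis
  proof eventually_elim
    case (elim z)
    show ?case
    proof
      assume "\<epsilon> * z \<in> img c"
      moreover have "z = \<epsilon> * z / \<epsilon>" using \<epsilon> by simp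
      ultimately show "param c (\<epsilon> * z) \<notin> B" using elim by blast
    qed
  qed
qed

text \<open>Rotating the parameter by \<epsilon> keeps z^r and turns the leading coefficient of the
  first branch into that of the second. Both then solve the same equation near a simple root, so
  their images agree; off the finitely many points over singularities the normalisation is
  injective, so the points agree as well.\<close>

lemma branches_meet:
  assumes b1: "branch q1 c1 r n V1 e1" and b2: "branch q2 c2 r n V2 e2"
    and \<epsilon>: "\<epsilon> ^ r = 1" "\<epsilon> ^ n * V1 0 = V2 0"
  shows "\<forall>\<^sub>F z in at 0. \<epsilon> * z \<in> ball 0 e1 \<and> z \<in> ball 0 e2 \<and> param c1 (\<epsilon> * z) = param c2 z"
proof -
  note D1 = branchD[OF b1] and D2 = branchD[OF b2]
  have "norm \<epsilon> ^ r = 1" using \<epsilon>(1) by (metis norm_one norm_power)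
  then have n\<epsilon>: "norm \<epsilon> = 1" using D1(4) power_eq_imp_eq_base[of "norm \<epsilon>" r 1] by simp
  then have \<epsilon>0: "\<epsilon> \<noteq> 0" by auto
  define W where "W z = \<epsilon> ^ n * V1 (\<epsilon> * z)" for z
  have W0: "W 0 = V2 0" using \<epsilon>(2) by (simp add: W_def)
  have lim\<epsilon>: "((\<lambda>z. \<epsilon> * z) \<longlongrightarrow> 0) (at 0)" by (auto intro!: tendsto_eq_intros)
  have "isCont W 0"
    unfolding W_def using D1(12) by (intro continuous_intros isCont_o2[of 0 "\<lambda>z. \<epsilon> * z" V1]) auto
  then have Wlim: "(W \<longlongrightarrow> V2 0) (at 0)" using W0 by (simp add: isCont_def)
  have Vlim: "(V2 \<longlongrightarrow> V2 0) (at 0)" using D2(12) by (simp add: isCont_def)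
  obtain \<delta> where \<delta>: "\<delta> > 0" "\<forall>z v v'. norm z < \<delta> \<longrightarrow> norm (v - V2 0) < \<delta> \<longrightarrow> norm (v' - V2 0) < \<delta> \<longrightarrow>
    G r n z v = 0 \<longrightarrow> G r n z v' = 0 \<longrightarrow> v = v'"
    by (rule G_root_unique[OF D1(4) D2(11) branch_root[OF b2]])
  define B where "B = {q \<in> topspace (surface S). \<eta> q \<in> singular_points P}"
  have B: "finite B" using norm(5) by (simp add: B_def)
  have 0: "\<forall>\<^sub>F z in at 0. z \<in> ball 0 (min e1 (min e2 \<delta>)) - {0 :: complex}"
    using D1(6) D2(6) \<delta>(1) by (intro eventually_at_in_open) auto
  have 1: "\<forall>\<^sub>F z in at 0. norm (W z - V2 0) < \<delta>" "\<forall>\<^sub>F z in at 0. norm (V2 z - V2 0) < \<delta>"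
    using tendstoD[OF Wlim \<delta>(1)] tendstoD[OF Vlim \<delta>(1)] by (simp_all add: dist_norm)
  have 2: "\<forall>\<^sub>F z in at 0. \<epsilon> * z \<in> img c1 \<longrightarrow> param c1 (\<epsilon> * z) \<notin> B"
    using D1(6,7) by (intro eventually_param_not_in_finite[OF D1(1) B _ \<epsilon>0]) auto
  have 3: "\<forall>\<^sub>F z in at 0. 1 * z \<in> img c2 \<longrightarrow> param c2 (1 * z) \<notin> B"
    using D2(6,7) by (intro eventually_param_not_in_finite[OF D2(1) B]) auto
  from 0 1 2 3 show ?thesis
  proof eventually_elim
    case (elim z)
    have z1: "\<epsilon> * z \<in> ball 0 e1" "z \<noteq> 0" and z2: "z \<in> ball 0 e2" and z\<delta>: "norm z < \<delta>"
      using elim(1) by (auto simp: norm_mult n\<epsilon>)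
    have i1: "\<epsilon> * z \<in> img c1" and i2: "z \<in> img c2" using z1 z2 D1(7) D2(7) by blast+
    have p1: "\<eta> (param c1 (\<epsilon> * z)) = (pt bx (z ^ r), pt by (z ^ n * W z))"
      using D1(10)[OF z1(1)] \<epsilon>(1) by (simp add: power_mult_distrib W_def mult_ac)
    have p2: "\<eta> (param c2 z) = (pt bx (z ^ r), pt by (z ^ n * V2 z))" using D2(10)[OF z2] .
    have t1: "param c1 (\<epsilon> * z) \<in> topspace (surface S)" and t2: "param c2 z \<in> topspace (surface S)"
      using param_topspace D1(1) D2(1) i1 i2 by blast+
    have "G r n z (W z) = 0" using on_curve[OF t1 p1] z1(2) by (simp add: Q_eq_G)
    moreover have "G r n z (V2 z) = 0" using branch_G[OF b2 z2 z1(2)] .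
    ultimately have "W z = V2 z" using \<delta>(2) z\<delta> elim(2,3) by blast
    then have "\<eta> (param c1 (\<epsilon> * z)) = \<eta> (param c2 z)" using p1 p2 by simp
    moreover have "param c1 (\<epsilon> * z) \<notin> B" "param c2 z \<notin> B" using elim(4,5) i1 i2 by auto
    ultimately have "param c1 (\<epsilon> * z) = param c2 z"
      using inj_onD[OF norm(6)] t1 t2 by (simp add: B_def)
    then show ?case using z1 z2 by blast
  qed
qed

text \<open>A common divisor greater than 1 yields a nontrivial root of unity fixing both z^r and
  z^n; the branch would meet its own rotation, against injectivity of the parameter.\<close>

lemma branch_coprime:
  assumes b: "branch q c r n V e"
  shows "coprime r n"
proof (rule ccontr)
  assume nc: "\<not> coprime r n"
  note D = branchD[OF b]
  define g where "g = gcd r n"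
  have g: "g \<noteq> 0" "g \<noteq> 1" "g dvd r" "g dvd n" using nc D(4) by (auto simp: g_def coprime_iff_gcd_eq_1)
  define \<epsilon> where "\<epsilon> = exp (2 * of_real pi * \<i> * of_nat 1 / of_nat g :: complex)"
  have \<epsilon>g: "\<epsilon> ^ g = 1" unfolding \<epsilon>_def using complex_root_unity[OF g(1), of 1] by simp
  have \<epsilon>1: "\<epsilon> \<noteq> 1" unfolding \<epsilon>_def using complex_root_unity_eq_1[of g 1] g(1,2) by simp
  have pw: "\<epsilon> ^ k = 1" if "g dvd k" for k using that \<epsilon>g by (auto simp: power_mult elim!: dvdE)
  have "\<forall>\<^sub>F z in at 0. \<epsilon> * z \<in> ball 0 e \<and> z \<in> ball 0 e \<and> param c (\<epsilon> * z) = param c z"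
    by (rule branches_meet[OF b b]) (use pw g in simp_all)
  moreover have "\<forall>\<^sub>F z in at 0. z \<noteq> (0 :: complex)" by (rule eventually_neq_at_within)
  ultimately have "\<forall>\<^sub>F z in at (0 :: complex). False"
  proof eventually_elim
    case (elim z)
    then have "\<epsilon> * z \<in> img c" "z \<in> img c" using D(7) by blast+
    then have "\<epsilon> * z = z" using elim by (metis snd_param)
    then show ?case using elim \<epsilon>1 by simp
  qed
  then show False by (simp add: eventually_False)
qed

text \<open>The quotient of the leading coefficients is an \<open>r\<close>-th root of unity. By
  coprimality it is the \<open>n\<close>-th power of another one, which is the rotation needed in
  \<open>branches_meet\<close>. Distinct points have disjoint neighbourhoods, so their branches
  cannot meet arbitrarily close to them.\<close>

lemma branch_unique:
  assumes b1: "branch q1 c1 r n V1 e1" and b2: "branch q2 c2 r n V2 e2" and V: "V1 0 ^ r = V2 0 ^ r"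
  shows "q1 = q2"
proof (rule ccontr)
  assume ne: "q1 \<noteq> q2"
  note D1 = branchD[OF b1] and D2 = branchD[OF b2]
  have t: "q1 \<in> topspace (surface S)" "q2 \<in> topspace (surface S)"
    using coord_sub[OF D1(1)] coord_sub[OF D2(1)] D1(2) D2(2) by blast+
  obtain U1 U2 where U: "openin (surface S) U1" "openin (surface S) U2" "q1 \<in> U1" "q2 \<in> U2" "disjnt U1 U2"
    using norm(7) t ne unfolding Hausdorff_space_def by blast
  define \<rho> where "\<rho> = V2 0 / V1 0"
  have \<rho>: "\<rho> ^ r = 1" "\<rho> * V1 0 = V2 0" using V D1(11) D2(11) by (simp_all add: \<rho>_def power_divide)
  obtain x where "[n * x = 1] (mod r)"
    using cong_solve_coprime_nat[of n r] branch_coprime[OF b1] by (auto simp: coprime_commute)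
  then obtain j2 j1 where "1 + j2 * r = n * x + j1 * r" by (auto simp: cong_iff_lin_nat)
  then have j: "n * x + r * j1 = 1 + r * j2" by (simp add: mult.commute)
  define \<epsilon> where "\<epsilon> = \<rho> ^ x"
  have \<epsilon>r: "\<epsilon> ^ r = 1" using \<rho>(1) by (metis \<epsilon>_def power_mult mult.commute power_one)
  have "\<rho> ^ (n * x + r * j1) = \<rho> ^ (1 + r * j2)" using j by simp
  then have \<epsilon>n: "\<epsilon> ^ n = \<rho>"
    by (simp add: power_add power_mult \<rho>(1) \<epsilon>_def) (metis power_mult mult.commute)
  have m: "\<forall>\<^sub>F z in at 0. \<epsilon> * z \<in> ball 0 e1 \<and> z \<in> ball 0 e2 \<and> param c1 (\<epsilon> * z) = param c2 z"
    by (rule branches_meet[OF b1 b2 \<epsilon>r]) (simp add: \<epsilon>n \<rho>(2))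
  have "\<forall>\<^sub>F z in nhds 0. z \<in> img c1 \<and> param c1 z \<in> U1"
    using eventually_param[OF D1(1,2) U(1,3)] D1(3) by simp
  moreover have "filterlim (\<lambda>z. \<epsilon> * z) (nhds 0) (at 0)" by (auto intro!: tendsto_eq_intros)
  ultimately have u1: "\<forall>\<^sub>F z in at 0. \<epsilon> * z \<in> img c1 \<and> param c1 (\<epsilon> * z) \<in> U1"
    by (rule eventually_compose_filterlim)
  have "\<forall>\<^sub>F z in nhds 0. z \<in> img c2 \<and> param c2 z \<in> U2"
    using eventually_param[OF D2(1,2) U(2,4)] D2(3) by simp
  then have u2: "\<forall>\<^sub>F z in at 0. z \<in> img c2 \<and> param c2 z \<in> U2"
    by (auto simp: eventually_at_filter elim: eventually_mono)
  from m u1 u2 have "\<forall>\<^sub>F z in at (0 :: complex). False"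
    by eventually_elim (use U(5) in \<open>auto simp: disjnt_iff\<close>)
  then show False by (simp add: eventually_False)
qed

text \<open>Continuity of a map to the projective line, for limits at a corner value. If the chart
  at \<open>q\<close> is the opposite one, values close to \<open>pt b 0\<close> have the large
  coordinate 1 / w there, while the chart function is bounded near \<open>q\<close>.\<close>

lemma approach_corner:
  assumes f: "holomorphic_to_proj1 (coords S) f" and q: "q \<in> topspace (surface S)"
    and lim: "\<And>U \<epsilon>. openin (surface S) U \<Longrightarrow> q \<in> U \<Longrightarrow> \<epsilon> > 0 \<Longrightarrow> \<exists>q'\<in>U. \<exists>w. norm w < \<epsilon> \<and> f q' = pt b w"
  shows "f q = pt b 0"
proof -
  obtain c where c: "c \<in> coords S" "q \<in> fst c" using q norm(8) by blast
  obtain W g where W: "open W" "snd c q \<in> W" "W \<subseteq> img c" "g holomorphic_on W"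
    and g: "(\<forall>z\<in>W. f (param c z) = homog (g z) 1) \<or> (\<forall>z\<in>W. f (param c z) = homog 1 (g z))"
    using f[unfolded holomorphic_to_proj1_def, rule_format, OF c] by (elim exE conjE) (rule that)
  have "\<exists>b'. \<forall>z\<in>W. f (param c z) = pt b' (g z)"
    using g by (elim disjE) (rule exI[of _ False] exI[of _ True], simp add: pt_homog)+
  then obtain b' where b': "\<And>z. z \<in> W \<Longrightarrow> f (param c z) = pt b' (g z)" by blast
  define z0 where "z0 = snd c q"
  have fq: "f q = pt b' (g z0)" using b'[OF W(2)] c by (simp add: z0_def)
  have cont: "isCont g z0"
    using holomorphic_on_imp_continuous_on[OF W(4)] W(1,2) by (simp add: continuous_on_eq_continuous_at z0_def)
  have near: "\<exists>z\<in>W. \<exists>w. dist (g z) (g z0) < \<delta> \<and> norm w < \<epsilon> \<and> pt b' (g z) = pt b w" if "\<delta> > 0" "\<epsilon> > 0" for \<delta> \<epsilon>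
  proof -
    obtain d where d: "d > 0" "\<And>z. dist z z0 < d \<Longrightarrow> dist (g z) (g z0) < \<delta>"
      using cont \<open>\<delta> > 0\<close> by (auto simp: continuous_at_eps_delta)
    define N where "N = W \<inter> ball z0 d"
    have N: "open N" "N \<subseteq> img c" "z0 \<in> N" using W d(1) by (auto simp: N_def z0_def)
    have "openin (surface S) (param c ` N)" using openin_param_image[OF c(1) N(1,2)] .
    moreover have "q \<in> param c ` N" using N(3) c by (auto simp: z0_def intro!: image_eqI[of _ _ "snd c q"])
    ultimately obtain q' w where qw: "q' \<in> param c ` N" "norm w < \<epsilon>" "f q' = pt b w"
      using lim[OF _ _ \<open>\<epsilon> > 0\<close>] by blast
    then obtain z where z: "z \<in> N" "q' = param c z" by blast
    have "z \<in> W" "dist (g z) (g z0) < \<delta>" using z(1) d(2)[of z] by (auto simp: N_def dist_commute)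
    moreover have "pt b' (g z) = pt b w" using b'[OF \<open>z \<in> W\<close>] qw z by simp
    ultimately show ?thesis using qw(2) by blast
  qed
  show ?thesis
  proof (cases "b' = b")
    case True
    have "g z0 = 0"
    proof (rule ccontr)
      assume "g z0 \<noteq> 0"
      then have p: "norm (g z0) / 2 > 0" by simp
      obtain z w where "dist (g z) (g z0) < norm (g z0) / 2" "norm w < norm (g z0) / 2" "pt b' (g z) = pt b w"
        using near[OF p p] by blast
      then have "dist (g z) (g z0) < norm (g z0) / 2" "norm (g z) < norm (g z0) / 2" using True by simp_all
      moreover have "norm (g z0) \<le> norm (g z) + dist (g z) (g z0)"
        using norm_triangle_ineq2[of "g z0" "g z"] by (simp add: dist_norm norm_minus_commute)
      ultimately show False by simp
    qed
    then show ?thesis using fq True by simp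
  next
    case False
    have p: "1 / (norm (g z0) + 1) > 0" by (simp add: add_nonneg_pos)
    obtain z w where zw: "dist (g z) (g z0) < 1" "norm w < 1 / (norm (g z0) + 1)" "pt b' (g z) = pt b w"
      using near[OF zero_less_one p] by blast
    have "g z * w = 1" using zw(3) pt_neq_iff[OF False] by simp
    then have "norm (g z) * norm w = 1" by (metis norm_mult norm_one)
    moreover have "norm (g z) < norm (g z0) + 1"
      using norm_triangle_ineq2[of "g z" "g z0"] zw(1) by (simp add: dist_norm)
    then have "norm (g z) * norm w \<le> (norm (g z0) + 1) * norm w" by (intro mult_right_mono) auto
    moreover have "(norm (g z0) + 1) * norm w < 1"
      using zw(2) pos_less_divide_eq[of "norm (g z0) + 1" "norm w" 1] by (simp add: add_nonneg_pos mult.commute)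
    ultimately show ?thesis by simp
  qed
qed

text \<open>Hurwitz: if the functions \<open>G m n (z k)\<close> had no zeros near \<open>d\<close>
  along a sequence tending to 0, their nonconstant limit could not vanish at \<open>d\<close>. It is
  nonconstant because \<open>d\<close> is an isolated root, by \<open>G_root_unique\<close> at z =
  0.\<close>

lemma G_roots_near:
  assumes m: "0 < m" and d: "d \<noteq> 0" "edge_poly bx by P m n d = 0" and \<delta>: "\<delta> > 0"
  shows "\<exists>z v. z \<noteq> 0 \<and> norm z < \<delta> \<and> norm (v - d) < \<delta> \<and> G m n z v = 0"
proof (rule ccontr)
  assume no: "\<not> ?thesis"
  define z where "z k = complex_of_real (\<delta> / 2 * inverse (real (Suc k)))" for k :: nat
  have z: "z k \<noteq> 0" "norm (z k) < \<delta>" for k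
  proof -
    have n: "norm (z k) = \<delta> / 2 * inverse (real (Suc k))" unfolding z_def norm_of_real using \<delta> by simp
    have "inverse (real (Suc k)) \<le> 1" by (simp add: inverse_le_1_iff)
    then have "\<delta> / 2 * inverse (real (Suc k)) \<le> \<delta> / 2 * 1" using \<delta> by (intro mult_left_mono) auto
    then show "norm (z k) < \<delta>" unfolding n using \<delta> by linarith
    have "norm (z k) > 0" unfolding n using \<delta> by (intro mult_pos_pos) auto
    then show "z k \<noteq> 0" by simp
  qed
  have "(\<lambda>k. \<delta> / 2 * inverse (real (Suc k))) \<longlonglongrightarrow> 0"
    by (rule tendsto_mult_right_zero[OF LIMSEQ_inverse_real_of_nat])
  from tendsto_of_real[OF this, where 'a = complex] have zlim: "z \<longlonglongrightarrow> 0"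
    unfolding z_def[symmetric] of_real_0 .
  obtain \<epsilon> where \<epsilon>: "\<epsilon> > 0" "\<forall>z v v'. norm z < \<epsilon> \<longrightarrow> norm (v - d) < \<epsilon> \<longrightarrow> norm (v' - d) < \<epsilon> \<longrightarrow>
    G m n z v = 0 \<longrightarrow> G m n z v' = 0 \<longrightarrow> v = v'"
    by (rule G_root_unique[OF m d])
  have "G m n 0 d \<noteq> 0"
  proof (rule Hurwitz_no_zeros[where S = "ball d \<delta>" and \<F> = "\<lambda>k. G m n (z k)" and g = "G m n 0" and ?z0.0 = d])
    show "G m n (z k) holomorphic_on ball d \<delta>" for k
      unfolding G_def[abs_def] by (intro holomorphic_intros)
    show "G m n 0 holomorphic_on ball d \<delta>" unfolding G_def[abs_def] by (intro holomorphic_intros)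
    show "\<not> G m n 0 constant_on ball d \<delta>"
    proof
      assume "G m n 0 constant_on ball d \<delta>"
      then obtain C where C: "\<And>v. v \<in> ball d \<delta> \<Longrightarrow> G m n 0 v = C" by (auto simp: constant_on_def)
      define v where "v = d + of_real (min \<delta> \<epsilon> / 2)"
      have v: "norm (v - d) < \<delta>" "norm (v - d) < \<epsilon>" "v \<noteq> d" using \<delta> \<epsilon>(1) by (auto simp: v_def)
      have "C = 0" using C[of d] \<delta> d(2) by (simp add: G_0)
      then have "G m n 0 v = 0" using C[of v] v(1) by (simp add: dist_norm norm_minus_commute)
      moreover have "G m n 0 d = 0" using d(2) by (simp add: G_0)
      ultimately have "v = d" using \<epsilon>(2)[rule_format, of 0 v d] \<epsilon>(1) v by simp
      with v(3) show False by simp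
    qed
    show "G m n (z k) v \<noteq> 0" if "v \<in> ball d \<delta>" for k v
      using no z[of k] that by (auto simp: dist_norm norm_minus_commute)
    show "d \<in> ball d \<delta>" using \<delta> by simp
    fix K assume K: "compact K" "K \<subseteq> ball d \<delta>"
    have "uniformly_continuous_on (cball 0 \<delta> \<times> K) (\<lambda>p. G m n (fst p) (snd p))"
      using continuous_G K(1) by (intro compact_uniformly_continuous compact_Times) (auto intro: continuous_at_imp_continuous_on)
    then have uc: "\<exists>\<gamma>>0. \<forall>p\<in>cball 0 \<delta> \<times> K. \<forall>p'\<in>cball 0 \<delta> \<times> K. dist p' p < \<gamma> \<longrightarrow>
        dist (G m n (fst p') (snd p')) (G m n (fst p) (snd p)) < e" if "e > 0" for e
      using that by (simp add: uniformly_continuous_on_def)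
    show "uniform_limit K (\<lambda>k. G m n (z k)) (G m n 0) sequentially"
    proof (rule uniform_limitI)
      fix e :: real assume "e > 0"
      then obtain \<gamma> where \<gamma>: "\<gamma> > 0" "\<And>p p'. p \<in> cball 0 \<delta> \<times> K \<Longrightarrow> p' \<in> cball 0 \<delta> \<times> K \<Longrightarrow> dist p' p < \<gamma> \<Longrightarrow>
        dist (G m n (fst p') (snd p')) (G m n (fst p) (snd p)) < e"
        using uc by blast
      have "\<forall>\<^sub>F k in sequentially. norm (z k) < \<gamma>" using tendstoD[OF zlim \<gamma>(1)] by simp
      then show "\<forall>\<^sub>F k in sequentially. \<forall>v\<in>K. dist (G m n (z k) v) (G m n 0 v) < e"
      proof eventually_elim
        case (elim k)
        show ?case
        proof
          fix v assume v: "v \<in> K"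
          have "dist (z k, v) (0, v) < \<gamma>" using elim by (simp add: dist_Pair_Pair)
          then show "dist (G m n (z k) v) (G m n 0 v) < e"
            using \<gamma>(2)[of "(0, v)" "(z k, v)"] v z(2)[of k] \<delta> by simp
        qed
      qed
    qed
  qed auto
  then show False using d(2) by (simp add: G_0)
qed

text \<open>Points of the curve close to the expected branch exist by \<open>G_roots_near\<close>.
  Compactness of the surface gives a point \<open>q\<close> at which they accumulate, and by
  continuity it lies over the corner. The type of the branch at \<open>q\<close> is read off by
  comparing it with these approximants.\<close>

lemma branch_surjective:
  assumes m: "0 < m" and n: "0 < n" and cop: "coprime m n" and d: "d \<noteq> 0" "edge_poly bx by P m n d = 0"
  obtains q where "q \<in> topspace (surface S)" "\<eta> q = corner"
    "\<forall>c r n' V e. branch q c r n' V e \<longrightarrow> r = m \<and> n' = n \<and> V 0 ^ m = d ^ m"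
proof -
  define R where "R \<epsilon> q' \<longleftrightarrow> (\<exists>z v. z \<noteq> 0 \<and> norm z < \<epsilon> \<and> norm (v - d) < \<epsilon> \<and> \<eta> q' = (pt bx (z ^ m), pt by (z ^ n * v)))"
    for \<epsilon> q'
  have Rex: "\<exists>q'\<in>topspace (surface S). R \<epsilon> q'" if \<epsilon>: "\<epsilon> > 0" for \<epsilon>
  proof -
    obtain z v where zv: "z \<noteq> 0" "norm z < \<epsilon>" "norm (v - d) < \<epsilon>" "G m n z v = 0"
      using G_roots_near[OF m d \<epsilon>] by blast
    then have "(pt bx (z ^ m), pt by (z ^ n * v)) \<in> proj_curve P"
      by (simp add: pt_in_proj_curve_iff Q_eq_G)
    then obtain q' where "q' \<in> topspace (surface S)" "\<eta> q' = (pt bx (z ^ m), pt by (z ^ n * v))"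
      using norm(4) by (metis imageE)
    then show ?thesis using zv unfolding R_def by blast
  qed
  have Rmono: "R \<epsilon> q' \<Longrightarrow> \<epsilon> \<le> \<epsilon>' \<Longrightarrow> R \<epsilon>' q'" for \<epsilon> \<epsilon>' q'
    unfolding R_def by (meson less_le_trans)
  \<comment> \<open>Otherwise every point has a neighbourhood free of approximants of some
    precision, and a finite subcover leaves none of the least of these precisions.\<close>
  have "\<exists>q\<in>topspace (surface S). \<forall>U \<epsilon>. openin (surface S) U \<longrightarrow> q \<in> U \<longrightarrow> \<epsilon> > 0 \<longrightarrow> (\<exists>q'\<in>U. R \<epsilon> q')"
  proof (rule ccontr)
    assume no: "\<not> ?thesis"
    define N where "N q U \<epsilon> \<longleftrightarrow> openin (surface S) U \<and> q \<in> U \<and> \<epsilon> > 0 \<and> (\<forall>q'\<in>U. \<not> R \<epsilon> q')" for q U \<epsilon>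
    have "\<exists>U \<epsilon>. N q U \<epsilon>" if q: "q \<in> topspace (surface S)" for q
    proof (rule ccontr)
      assume nN: "\<not> ?thesis"
      have "\<exists>q'\<in>U. R \<epsilon> q'" if "openin (surface S) U" "q \<in> U" "\<epsilon> > 0" for U \<epsilon>
      proof (rule ccontr)
        assume "\<not> ?thesis"
        then have "N q U \<epsilon>" unfolding N_def using that by simp
        then show False using nN by simp
      qed
      then show False using no q by meson
    qed
    then obtain U \<epsilon> where N: "\<And>q. q \<in> topspace (surface S) \<Longrightarrow> N q (U q) (\<epsilon> q)" by metis
    have U: "openin (surface S) (U q) \<and> q \<in> U q \<and> \<epsilon> q > 0 \<and> (\<forall>q'\<in>U q. \<not> R (\<epsilon> q) q')"
      if "q \<in> topspace (surface S)" for q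
      using N[OF that] unfolding N_def .
    have "compactin (surface S) (topspace (surface S))" using norm(1) by (simp add: compact_space_def)
    then obtain \<F> where F: "finite \<F>" "\<F> \<subseteq> U ` topspace (surface S)" "topspace (surface S) \<subseteq> \<Union> \<F>"
      using compactinD[of "surface S" "topspace (surface S)" "U ` topspace (surface S)"] U by blast
    obtain T where T: "finite T" "T \<subseteq> topspace (surface S)" "\<F> = U ` T"
      using finite_subset_image[OF F(1,2)] by blast
    define e where "e = Min (insert 1 (\<epsilon> ` T))"
    have e: "e > 0" unfolding e_def using T U by (subst Min_gr_iff) auto
    obtain q' where q': "q' \<in> topspace (surface S)" "R e q'" using Rex[OF e] by blast
    then obtain q where q: "q \<in> T" "q' \<in> U q" using F(3) T(3) by blast
    have "e \<le> \<epsilon> q" unfolding e_def using T(1) q(1) by (intro Min_le) auto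
    then have "R (\<epsilon> q) q'" using Rmono q'(2) by blast
    then show False using U[of q] q T(2) by blast
  qed
  then obtain q where q: "q \<in> topspace (surface S)"
    and near: "\<And>U \<epsilon>. openin (surface S) U \<Longrightarrow> q \<in> U \<Longrightarrow> \<epsilon> > 0 \<Longrightarrow> \<exists>q'\<in>U. R \<epsilon> q'" by blast
  have pw: "norm (z ^ k) < \<epsilon>" if "norm z < \<epsilon>" "norm z < 1" "0 < k" for z :: complex and k \<epsilon>
  proof -
    have "norm z ^ k \<le> norm z ^ 1" using that by (intro power_decreasing) auto
    then show ?thesis using that(1) by (simp add: norm_power)
  qed
  have f1: "(fst \<circ> \<eta>) q = pt bx 0"
  proof (rule approach_corner[OF norm(2) q])
    fix U and \<epsilon> :: real assume U: "openin (surface S) U" "q \<in> U" "\<epsilon> > 0"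
    have "min \<epsilon> 1 > 0" using U(3) by simp
    from near[OF U(1,2) this] obtain q' z v where *: "q' \<in> U" "norm z < min \<epsilon> 1" "\<eta> q' = (pt bx (z ^ m), pt by (z ^ n * v))"
      unfolding R_def by blast
    have "norm (z ^ m) < \<epsilon>" using *(2) m by (intro pw) auto
    then show "\<exists>q'\<in>U. \<exists>w. norm w < \<epsilon> \<and> (fst \<circ> \<eta>) q' = pt bx w" using * by (intro bexI[of _ q'] exI[of _ "z ^ m"]) auto
  qed
  have f2: "(snd \<circ> \<eta>) q = pt by 0"
  proof (rule approach_corner[OF norm(3) q])
    fix U and \<epsilon> :: real assume U: "openin (surface S) U" "q \<in> U" "\<epsilon> > 0"
    define \<epsilon>' where "\<epsilon>' = min (\<epsilon> / (norm d + 1)) 1"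
    have d1: "norm d + 1 > 0" by (simp add: add_nonneg_pos)
    have "\<epsilon>' > 0" using U(3) d1 by (simp add: \<epsilon>'_def)
    from near[OF U(1,2) this] obtain q' z v where *: "q' \<in> U" "norm z < \<epsilon>'" "norm (v - d) < \<epsilon>'" "\<eta> q' = (pt bx (z ^ m), pt by (z ^ n * v))"
      unfolding R_def by blast
    have "norm (z ^ n) < \<epsilon> / (norm d + 1)" using *(2) n by (intro pw) (auto simp: \<epsilon>'_def)
    moreover have "norm v \<le> norm d + 1" using *(3) norm_triangle_ineq2[of v d] by (simp add: \<epsilon>'_def)
    ultimately have "norm (z ^ n) * norm v < \<epsilon> / (norm d + 1) * (norm d + 1)"
      using d1 by (intro le_less_trans[OF mult_left_mono mult_strict_right_mono]) auto
    then have "norm (z ^ n * v) < \<epsilon>" using d1 by (simp add: norm_mult)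
    then show "\<exists>q'\<in>U. \<exists>w. norm w < \<epsilon> \<and> (snd \<circ> \<eta>) q' = pt by w" using * by (intro bexI[of _ q'] exI[of _ "z ^ n * v"]) auto
  qed
  have \<eta>q: "\<eta> q = corner" using f1 f2 by (simp add: prod_eq_iff)
  have "r = m \<and> n' = n \<and> V 0 ^ m = d ^ m" if b: "branch q c r n' V e" for c r n' V e
  proof -
    note D = branchD[OF b]
    define \<Phi> where "\<Phi> k z' z v \<longleftrightarrow> norm z' < 1 / Suc k \<and> z' \<in> ball 0 e \<and> z' \<noteq> 0 \<and> norm (v - d) < 1 / Suc k
        \<and> z' ^ r = z ^ m \<and> z' ^ n' * V z' = z ^ n * v" for k :: nat and z' z v :: complex
    have "\<exists>z' z v. \<Phi> k z' z v" for k
    proof -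
      define N :: "complex set" where "N = ball 0 (min e (1 / Suc k))"
      have "openin (surface S) (param c ` N)" using D(7) by (intro openin_param_image[OF D(1)]) (auto simp: N_def)
      moreover have "0 \<in> N" using D(6) by (simp add: N_def)
      then have "q \<in> param c ` N" using D(1-3) param_snd[of c q] by (metis image_eqI)
      moreover have "1 / real (Suc k) > 0" by simp
      ultimately obtain q' where q': "q' \<in> param c ` N" "R (1 / Suc k) q'" using near by blast
      obtain z' where z': "z' \<in> N" "q' = param c z'" using q'(1) by blast
      obtain z v where zv: "z \<noteq> 0" "norm (v - d) < 1 / Suc k" "\<eta> q' = (pt bx (z ^ m), pt by (z ^ n * v))"
        using q'(2) unfolding R_def by blast
      have z'e: "z' \<in> ball 0 e" using z'(1) by (auto simp: N_def)
      have e: "z' ^ r = z ^ m" "z' ^ n' * V z' = z ^ n * v" using D(10)[OF z'e] zv(3) z'(2) by simp_all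
      have "z' \<noteq> 0" using e(1) zv(1) D(4) by (auto simp: zero_power)
      moreover have "norm z' < 1 / Suc k" using z'(1) by (auto simp: N_def)
      ultimately show ?thesis using e z'e zv(2) unfolding \<Phi>_def by blast
    qed
    then obtain z' z v where \<Phi>: "\<And>k. \<Phi> k (z' k) (z k) (v k)" by metis
    have zv: "\<And>k. norm (z' k) < 1 / Suc k" "\<And>k. z' k \<in> ball 0 e" "\<And>k. z' k \<noteq> 0"
        "\<And>k. norm (v k - d) < 1 / Suc k" "\<And>k. z' k ^ r = z k ^ m" "\<And>k. z' k ^ n' * V (z' k) = z k ^ n * v k"
      using \<Phi> unfolding \<Phi>_def by blast+
    have z'0: "z' \<longlonglongrightarrow> 0"
      by (rule Lim_null_comparison[OF _ LIMSEQ_inverse_real_of_nat])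
         (use zv(1) in \<open>auto intro!: always_eventually less_imp_le simp: inverse_eq_divide\<close>)
    have "(\<lambda>k. v k - d) \<longlonglongrightarrow> 0"
      by (rule Lim_null_comparison[OF _ LIMSEQ_inverse_real_of_nat])
         (use zv(4) in \<open>auto intro!: always_eventually less_imp_le simp: inverse_eq_divide\<close>)
    then have vd: "v \<longlonglongrightarrow> d" by (simp add: LIM_zero_iff)
    have Vlim: "(\<lambda>k. V (z' k)) \<longlonglongrightarrow> V 0" using isCont_tendsto_compose[OF D(12) z'0] .
    have vm: "(\<lambda>k. v k ^ m) \<longlonglongrightarrow> d ^ m" and Vm: "(\<lambda>k. V (z' k) ^ m) \<longlonglongrightarrow> V 0 ^ m"
      using vd Vlim by (auto intro: tendsto_power)
    \<comment> \<open>Taking \<open>m\<close>-th powers eliminates z, which is not a function of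
      z'.\<close>
    have rel: "z' k ^ (n' * m) * V (z' k) ^ m = z' k ^ (r * n) * v k ^ m" for k
    proof -
      have "(z' k ^ n' * V (z' k)) ^ m = (z k ^ n * v k) ^ m" by (simp only: zv(6))
      then have "z' k ^ (n' * m) * V (z' k) ^ m = (z k ^ m) ^ n * v k ^ m"
        by (simp add: power_mult_distrib power_mult) (metis power_mult mult.commute)
      then show ?thesis by (simp flip: zv(5) add: power_mult)
    qed
    \<comment> \<open>Unless the powers of z' cancel, one of the two nonzero limits would be
      0.\<close>
    have eq: "n' * m = r * n"
    proof (rule ccontr)
      assume "n' * m \<noteq> r * n"
      then consider "r * n < n' * m" | "n' * m < r * n" by linarith
      then show False
      proof cases
        case 1
        then have p: "z' k ^ (n' * m) = z' k ^ (r * n) * z' k ^ (n' * m - r * n)" for k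
          by (simp flip: power_add)
        have "v k ^ m = z' k ^ (n' * m - r * n) * V (z' k) ^ m" for k
          using rel[of k] zv(3)[of k] unfolding p by simp
        moreover have "(\<lambda>k. z' k ^ (n' * m - r * n) * V (z' k) ^ m) \<longlonglongrightarrow> 0 ^ (n' * m - r * n) * V 0 ^ m"
          by (rule tendsto_mult[OF tendsto_power[OF z'0] Vm])
        ultimately have "d ^ m = 0 ^ (n' * m - r * n) * V 0 ^ m" using LIMSEQ_unique[OF vm] by simp
        then show False using 1 d(1) by (simp add: zero_power)
      next
        case 2
        then have p: "z' k ^ (r * n) = z' k ^ (n' * m) * z' k ^ (r * n - n' * m)" for k
          by (simp flip: power_add)
        have "V (z' k) ^ m = z' k ^ (r * n - n' * m) * v k ^ m" for k
          using rel[of k] zv(3)[of k] unfolding p by simp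
        moreover have "(\<lambda>k. z' k ^ (r * n - n' * m) * v k ^ m) \<longlonglongrightarrow> 0 ^ (r * n - n' * m) * d ^ m"
          by (rule tendsto_mult[OF tendsto_power[OF z'0] vm])
        ultimately have "V 0 ^ m = 0 ^ (r * n - n' * m) * d ^ m" using LIMSEQ_unique[OF Vm] by simp
        then show False using 2 D(11) by (simp add: zero_power)
      qed
    qed
    have "m dvd r * n" "r dvd n' * m" by (metis eq dvd_triv_right, metis eq dvd_triv_left)
    then have "m dvd r" "r dvd m"
      using cop branch_coprime[OF b] by (simp_all add: coprime_dvd_mult_left_iff coprime_dvd_mult_right_iff)
    then have rm: "r = m" by (rule dvd_antisym[rotated])
    then have "n' = n" using eq m by simp
    moreover have "V (z' k) ^ m = v k ^ m" for k using rel[of k] zv(3)[of k] by (simp add: eq)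
    then have "V 0 ^ m = d ^ m" using LIMSEQ_unique[OF Vm] vm by simp
    ultimately show ?thesis using rm by simp
  qed
  then show ?thesis using that[OF q \<eta>q] by blast
qed

end

section \<open>Local parameters of a branch\<close>

lemma aff_pt: "w \<noteq> 0 \<Longrightarrow> aff (pt b w) = (if b then inverse w else w)"
  by (simp add: pt_homog aff_homog divide_inverse)

lemma aff_pt_power:
  assumes "z \<noteq> 0"
  shows "aff (pt b (z ^ r)) = z powi (if b then - int r else int r)"
  using assms by (simp add: aff_pt power_int_minus)

context curve_corner
begin

text \<open>On a branch x = z^R and y is z^M times a unit, with R = \<plusminus>r and M =
  \<plusminus>n, negative at infinity. Since z dx / dz = R x, the form y dx has leading exponent R +
  M. Its leading coefficient \<open>lead_at\<close> is R times that of y, which is inverted at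
  infinity because the branch describes 1 / y there.\<close>

definition order_at :: "nat \<Rightarrow> nat \<Rightarrow> int" where
  "order_at r n = (if bx then - int r else int r) + (if by then - int n else int n)"

definition lead_at :: "nat \<Rightarrow> complex \<Rightarrow> complex" where
  "lead_at r d = of_int (if bx then - int r else int r) * (if by then inverse d else d)"

lemma om01_branch:
  assumes b: "branch q c r n V e" and z: "z \<in> ball 0 e" "z \<noteq> 0"
  shows "z * om01 S c z = lead_at r (V z) * z powi order_at r n"
proof -
  note D = branchD[OF b]
  define R where "R = (if bx then - int r else int r)"
  define M where "M = (if by then - int n else int n)"
  have zi: "z \<in> img c" using z D(7) by blast
  have \<eta>: "\<eta> (param c z) = (pt bx (z ^ r), pt by (z ^ n * V z))" using D(10)[OF z(1)] .
  have nz: "z ^ r \<noteq> 0" "z ^ n * V z \<noteq> 0" using z D(9) by auto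
  have "fst (\<eta> (param c z)) \<noteq> proj_inf" "snd (\<eta> (param c z)) \<noteq> proj_inf"
    using nz by (auto simp: \<eta> proj_inf_eq pt_eq_pt_0_iff)
  then have om: "om01 S c z = aff (snd (\<eta> (param c z))) * deriv (\<lambda>z'. aff (fst (\<eta> (param c z')))) z"
    using csc D(1) zi unfolding compact_spectral_curve_def by blast
  have y: "aff (snd (\<eta> (param c z))) = z powi M * (if by then inverse (V z) else V z)"
    using aff_pt[OF nz(2), of "by"] z(2) by (auto simp: \<eta> M_def power_int_minus)
  have "\<forall>\<^sub>F w in nhds z. w \<in> ball 0 e - {0}" using z by (intro eventually_nhds_in_open) auto
  then have "\<forall>\<^sub>F w in nhds z. aff (fst (\<eta> (param c w))) = w powi R"
  proof eventually_elim
    case (elim w)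
    then show ?case using D(10)[of w] aff_pt_power[of w bx r] by (simp add: R_def)
  qed
  then have "deriv (\<lambda>z'. aff (fst (\<eta> (param c z')))) z = deriv (\<lambda>w. w powi R) z"
    by (rule deriv_cong_ev) simp
  also have "\<dots> = of_int R * z powi (R - 1)"
    by (rule DERIV_imp_deriv) (use z(2) in \<open>auto intro!: derivative_eq_intros\<close>)
  finally have "z * om01 S c z = z * (z powi M * (if by then inverse (V z) else V z) * (of_int R * z powi (R - 1)))"
    by (simp add: om y)
  also have "\<dots> = (of_int R * (if by then inverse (V z) else V z)) * (z powi M * (z * z powi (R - 1)))"
    by (simp add: mult_ac)
  also have "z * z powi (R - 1) = z powi R"
    using z(2) by (simp add: power_int_diff)
  also have "z powi M * z powi R = z powi (R + M)"
    using z(2) by (simp add: power_int_add)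
  finally show ?thesis by (simp add: lead_at_def order_at_def R_def M_def)
qed

lemma tau_branch:
  assumes b: "branch q (SOME c. standard_coord S q c) r n V e"
  shows "tau S q (order_at r n) = lead_at r (V 0)" "l < order_at r n \<Longrightarrow> tau S q l = 0"
    "lead_at r (V 0) \<noteq> 0"
proof -
  define c where "c = (SOME c. standard_coord S q c)"
  note D = branchD[OF b[folded c_def]]
  define K where "K z = lead_at r (V z)" for z
  have "K holomorphic_on ball 0 e"
    unfolding K_def lead_at_def using D(8,9) by (cases "by") (auto intro!: holomorphic_intros)
  then have "K analytic_on {0}" using D(6) by (intro analytic_at_ball[THEN iffD2]) auto
  then have "K has_fps_expansion fps_expansion K 0" by (rule analytic_at_imp_has_fps_expansion_0)
  then have "(\<lambda>z. K z * z powi order_at r n) has_laurent_expansion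
      fls_shift (- order_at r n) (fps_to_fls (fps_expansion K 0))"
    by (intro has_laurent_expansion_shift has_laurent_expansion_fps)
  moreover have "\<forall>\<^sub>F z in at 0. z \<in> ball 0 e - {0 :: complex}" using D(6) by (intro eventually_at_in_open) auto
  then have ev: "\<forall>\<^sub>F z in at 0. K z * z powi order_at r n = z * om01 S c z"
    by eventually_elim (use om01_branch[OF b[folded c_def]] in \<open>auto simp: K_def\<close>)
  ultimately have "(\<lambda>z. z * om01 S c z) has_laurent_expansion
      fls_shift (- order_at r n) (fps_to_fls (fps_expansion K 0))"
    using has_laurent_expansion_cong[OF ev refl] by simp
  then have L: "laurent_expansion (\<lambda>z. z * om01 S c z) 0 = fls_shift (- order_at r n) (fps_to_fls (fps_expansion K 0))"
    by (rule laurent_expansion_0_eqI)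
  have t: "tau S q l = fls_nth (fps_to_fls (fps_expansion K 0)) (l - order_at r n)" for l
    unfolding tau_def Let_def c_def[symmetric] L by (simp add: fls_shift_nth)
  show "tau S q (order_at r n) = lead_at r (V 0)" by (simp add: t fps_expansion_def K_def)
  show "l < order_at r n \<Longrightarrow> tau S q l = 0" by (simp add: t)
  show "lead_at r (V 0) \<noteq> 0" using D(4,11) by (simp add: lead_at_def)
qed

text \<open>The exponent is \<plusminus>r \<plusminus> n, and multiples of r do not affect its gcd
  with r.\<close>

lemma order_at_coprime: "coprime (order_at r n) (int r) \<longleftrightarrow> coprime r n"
proof -
  have "order_at r n = (if bx then - 1 else 1) * int r + (if by then - int n else int n)"
    by (simp add: order_at_def)
  then have "gcd (int r) (order_at r n) = gcd (int r) (if by then - int n else int n)"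
    by (simp only: gcd_add_mult)
  then have "coprime (order_at r n) (int r) \<longleftrightarrow> coprime (int n) (int r)"
    by (simp add: coprime_iff_gcd_eq_1 gcd.commute)
  then show ?thesis by (simp add: coprime_commute)
qed

text \<open>The branch is taken in the very coordinate chosen by \<open>tau\<close>, which ties
  \<open>d\<close> to \<open>tau_lead\<close>.\<close>

definition point_data :: "'a \<Rightarrow> nat \<Rightarrow> complex \<Rightarrow> bool" where
  "point_data q n d \<longleftrightarrow> (\<exists>V e. branch q (SOME c. standard_coord S q c) (ram_order S q) n V e \<and> V 0 = d)"

lemma point_data_exists:
  assumes "q \<in> topspace (surface S)" "\<eta> q = corner"
  shows "\<exists>n d. point_data q n d"
proof -
  have "standard_coord S q (SOME c. standard_coord S q c)"
    using standard_coord_exists(1)[OF assms] by (rule someI_ex)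
  from branch_exists[OF assms this] show ?thesis unfolding point_data_def by blast
qed

text \<open>The leading exponent is coprime to the ramification order r, so for r \<ge> 2 it is not
  divisible by r and coincides with s.\<close>

lemma point_dataD:
  assumes "point_data q n d"
  shows "0 < ram_order S q" "0 < n" "coprime (ram_order S q) n" "d \<noteq> 0" "edge_poly bx by P (ram_order S q) n d = 0"
    "sbar S q = order_at (ram_order S q) n" "tau_lead S q = lead_at (ram_order S q) d"
    "2 \<le> ram_order S q \<Longrightarrow> s_param S q = Fin (order_at (ram_order S q) n)"
proof -
  define r where "r = ram_order S q"
  obtain V e where b: "branch q (SOME c. standard_coord S q c) r n V e" and d: "V 0 = d"
    using assms by (auto simp: point_data_def r_def)
  note D = branchD[OF b] and T = tau_branch[OF b]
  show "0 < ram_order S q" "0 < n" "d \<noteq> 0" using D(4,5,11) d by (simp_all add: r_def)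
  show cop: "coprime (ram_order S q) n" using branch_coprime[OF b] by (simp add: r_def)
  show "edge_poly bx by P (ram_order S q) n d = 0" using branch_root[OF b] d by (simp add: r_def)
  show sb: "sbar S q = order_at (ram_order S q) n"
    unfolding sbar_def r_def[symmetric]
    by (rule Least_equality) (use T not_less in auto)
  then show "tau_lead S q = lead_at (ram_order S q) d" using T(1) d by (simp add: tau_lead_def r_def)
  assume r2: "2 \<le> ram_order S q"
  have "\<not> int r dvd order_at r n"
  proof
    assume "int r dvd order_at r n"
    then have "int r dvd 1"
      using order_at_coprime[of r n] cop coprime_common_divisor[of "order_at r n" "int r" "int r"]
      by (simp add: r_def)
    then show False using r2 by (simp add: r_def)
  qed
  moreover have "tau S q (order_at r n) \<noteq> 0" using T by simp
  ultimately have ex: "tau S q (order_at r n) \<noteq> 0 \<and> \<not> int r dvd order_at r n" by simp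
  have "(LEAST l. tau S q l \<noteq> 0 \<and> \<not> int r dvd l) = order_at r n"
    by (rule Least_equality) (use ex T not_less in auto)
  then show "s_param S q = Fin (order_at (ram_order S q) n)"
    unfolding s_param_def r_def[symmetric] using ex by auto
qed

lemma point_data_unique:
  assumes "point_data q1 n d1" "point_data q2 n d2" "ram_order S q1 = ram_order S q2"
    "d1 ^ ram_order S q1 = d2 ^ ram_order S q1"
  shows "q1 = q2"
  using assms branch_unique unfolding point_data_def by metis

lemma point_data_surjective:
  assumes "0 < m" "0 < n" "coprime m n" "d \<noteq> 0" "edge_poly bx by P m n d = 0"
  shows "\<exists>q d'. q \<in> topspace (surface S) \<and> \<eta> q = corner \<and> ram_order S q = m \<and> point_data q n d' \<and> d' ^ m = d ^ m"
proof -
  obtain q where q: "q \<in> topspace (surface S)" "\<eta> q = corner"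
    and all: "\<forall>c r n' V e. branch q c r n' V e \<longrightarrow> r = m \<and> n' = n \<and> V 0 ^ m = d ^ m"
    by (rule branch_surjective[OF assms])
  obtain n' d' where pd: "point_data q n' d'" using point_data_exists[OF q] by blast
  then obtain V e where "branch q (SOME c. standard_coord S q c) (ram_order S q) n' V e" "V 0 = d'"
    by (auto simp: point_data_def)
  then have "ram_order S q = m" "n' = n" "d' ^ m = d ^ m" using all by blast+
  then show ?thesis using q pd by blast
qed

end

section \<open>Lattice cones\<close>

text \<open>\<open>X\<close> and \<open>Y\<close> are the heights of a point above the two
  supporting lines whose normals span the cone. These normals form a lattice basis, so
  \<open>X\<close> and \<open>Y\<close> are integral coordinates in which \<open>A\<close> lies in
  the quadrant and touches both axes.\<close>

locale lattice_cone =
  fixes A :: "(nat \<times> nat) set" and m1 n1 m2 n2 :: nat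
  assumes fin: "finite A" "A \<noteq> {}" and det: "\<bar>int m1 * int n2 - int m2 * int n1\<bar> = 1"
begin

definition w1 where "w1 s = m1 * fst s + n1 * snd s"
definition w2 where "w2 s = m2 * fst s + n2 * snd s"
definition X where "X s = w1 s - Min (w1 ` A)"
definition Y where "Y s = w2 s - Min (w2 ` A)"

definition cone_good :: bool where
  "cone_good \<longleftrightarrow> (\<exists>p\<in>A. \<forall>q\<in>A. \<forall>q'\<in>A. w1 p + w2 p \<le> w1 q + w2 q' + 1)"

lemma w1_eq: "s \<in> A \<Longrightarrow> w1 s = X s + Min (w1 ` A)" and w2_eq: "s \<in> A \<Longrightarrow> w2 s = Y s + Min (w2 ` A)"
  unfolding X_def Y_def using fin by simp_all

lemma X_zero: "\<exists>s\<in>A. X s = 0" and Y_zero: "\<exists>s\<in>A. Y s = 0"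
proof -
  have "Min (w1 ` A) \<in> w1 ` A" "Min (w2 ` A) \<in> w2 ` A" using fin by simp_all
  then show "\<exists>s\<in>A. X s = 0" "\<exists>s\<in>A. Y s = 0" unfolding X_def Y_def by auto
qed

lemma cone_good_iff: "cone_good \<longleftrightarrow> (\<exists>p\<in>A. X p + Y p \<le> 1)"
proof
  assume "cone_good"
  then obtain p where p: "p \<in> A" "\<And>q q'. q \<in> A \<Longrightarrow> q' \<in> A \<Longrightarrow> w1 p + w2 p \<le> w1 q + w2 q' + 1"
    unfolding cone_good_def by blast
  obtain q q' where "q \<in> A" "X q = 0" "q' \<in> A" "Y q' = 0" using X_zero Y_zero by blast
  with p(2)[of q q'] p(1) have "X p + Y p \<le> 1" by (simp add: w1_eq w2_eq)
  then show "\<exists>p\<in>A. X p + Y p \<le> 1" using p(1) by blast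
next
  assume "\<exists>p\<in>A. X p + Y p \<le> 1"
  then obtain p where p: "p \<in> A" "X p + Y p \<le> 1" by blast
  then have "w1 p + w2 p \<le> w1 q + w2 q' + 1" if "q \<in> A" "q' \<in> A" for q q'
    using that by (simp add: w1_eq w2_eq)
  then show cone_good unfolding cone_good_def using p(1) by blast
qed

lemma XY_inj: "s \<in> A \<Longrightarrow> t \<in> A \<Longrightarrow> X s = X t \<Longrightarrow> Y s = Y t \<Longrightarrow> s = t"
proof -
  assume st: "s \<in> A" "t \<in> A" "X s = X t" "Y s = Y t"
  then have "w1 s = w1 t" "w2 s = w2 t" by (simp_all add: w1_eq w2_eq)
  then have e: "int m1 * (int (fst s) - int (fst t)) + int n1 * (int (snd s) - int (snd t)) = 0"
       "int m2 * (int (fst s) - int (fst t)) + int n2 * (int (snd s) - int (snd t)) = 0"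
    unfolding w1_def w2_def by (simp_all add: algebra_simps flip: of_nat_mult of_nat_add)
  have "(int m1 * int n2 - int m2 * int n1) * (int (fst s) - int (fst t)) = 0"
       "(int m1 * int n2 - int m2 * int n1) * (int (snd s) - int (snd t)) = 0"
    using e by algebra+
  then show "s = t" using det by (auto simp: prod_eq_iff)
qed

text \<open>The face of normal \<alpha> (m1, n1) + \<beta> (m2, n2), as \<open>cface_eq\<close>
  shows; positive \<alpha> and \<beta> describe the normals inside the cone.\<close>

definition cface :: "nat \<Rightarrow> nat \<Rightarrow> (nat \<times> nat) set" where
  "cface \<alpha> \<beta> = {s \<in> A. \<forall>t\<in>A. \<alpha> * X s + \<beta> * Y s \<le> \<alpha> * X t + \<beta> * Y t}"

lemma cface_eq:
  "cface \<alpha> \<beta> = {s \<in> A. \<forall>t\<in>A. (\<alpha> * m1 + \<beta> * m2) * fst s + (\<alpha> * n1 + \<beta> * n2) * snd s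
      \<le> (\<alpha> * m1 + \<beta> * m2) * fst t + (\<alpha> * n1 + \<beta> * n2) * snd t}"
proof -
  have "(\<alpha> * m1 + \<beta> * m2) * fst s + (\<alpha> * n1 + \<beta> * n2) * snd s = \<alpha> * w1 s + \<beta> * w2 s" for s
    by (simp add: w1_def w2_def algebra_simps)
  moreover have "\<alpha> * w1 s + \<beta> * w2 s \<le> \<alpha> * w1 t + \<beta> * w2 t \<longleftrightarrow> \<alpha> * X s + \<beta> * Y s \<le> \<alpha> * X t + \<beta> * Y t"
    if "s \<in> A" "t \<in> A" for s t
    unfolding w1_eq[OF that(1)] w1_eq[OF that(2)] w2_eq[OF that(1)] w2_eq[OF that(2)] distrib_left by linarith
  ultimately show ?thesis unfolding cface_def by auto
qed

text \<open>In the coordinates \<open>X\<close>, \<open>Y\<close> the two points differ by k times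
  (\<beta>, -\<alpha>), and Cramer's rule with determinant \<plusminus>1 recovers the second
  exponent. An edge of lattice length k thus spans k steps of d^m in its edge polynomial, m being
  the first component of the normal.\<close>

lemma snd_diff:
  assumes "s \<in> A" "t \<in> A" "int (X t) - int (X s) = int k * int \<beta>" "int (Y s) - int (Y t) = int k * int \<alpha>"
  shows "\<bar>int (snd s) - int (snd t)\<bar> = int (k * (\<alpha> * m1 + \<beta> * m2))"
proof -
  define D where "D = int m1 * int n2 - int m2 * int n1"
  have e: "int m1 * (int (fst s) - int (fst t)) + int n1 * (int (snd s) - int (snd t)) = - (int k * int \<beta>)"
       "int m2 * (int (fst s) - int (fst t)) + int n2 * (int (snd s) - int (snd t)) = int k * int \<alpha>"
    using assms(3,4) w1_eq[OF assms(1)] w1_eq[OF assms(2)] w2_eq[OF assms(1)] w2_eq[OF assms(2)]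
    unfolding w1_def w2_def by (simp_all add: algebra_simps flip: of_nat_mult of_nat_add)
  have "D * (int (snd s) - int (snd t)) = int k * (int \<alpha> * int m1 + int \<beta> * int m2)"
    unfolding D_def using e by algebra
  then have "\<bar>D\<bar> * \<bar>int (snd s) - int (snd t)\<bar> = \<bar>int (k * (\<alpha> * m1 + \<beta> * m2))\<bar>"
    by (simp flip: abs_mult)
  then show ?thesis using det by (simp add: D_def)
qed

text \<open>A point with X + Y \<le> 1 pins down every edge inside the cone. If it is the origin,
  there is none. If it is (1, 0), the weight on the face is at most \<alpha>, so X \<le> 1 there,
  the edge joins (0, \<alpha> / \<beta>) to (1, 0), and coprimality gives \<beta> = 1. The case (0,
  1) is symmetric.\<close>

lemma good_coneD:
  assumes good: cone_good and pos: "0 < \<alpha>" "0 < \<beta>" "coprime \<alpha> \<beta>" and st: "s \<in> cface \<alpha> \<beta>" "t \<in> cface \<alpha> \<beta>" "s \<noteq> t"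
  obtains s0 t0 where "cface \<alpha> \<beta> = {s0, t0}" "s0 \<noteq> t0" "X s0 = 0" "Y s0 = \<alpha>" "X t0 = \<beta>" "Y t0 = 0"
    "\<alpha> = 1 \<or> \<beta> = 1"
proof -
  obtain p where p: "p \<in> A" "X p + Y p \<le> 1" using good cone_good_iff by blast
  have H: "\<alpha> * X r + \<beta> * Y r \<le> \<alpha> * X p + \<beta> * Y p" if "r \<in> cface \<alpha> \<beta>" for r
    using that p(1) by (simp add: cface_def)
  have eq: "\<alpha> * X r + \<beta> * Y r = \<alpha> * X r' + \<beta> * Y r'" if "r \<in> cface \<alpha> \<beta>" "r' \<in> cface \<alpha> \<beta>" for r r'
    using that by (intro le_antisym) (simp_all add: cface_def)
  have A: "r \<in> A" if "r \<in> cface \<alpha> \<beta>" for r using that by (simp add: cface_def)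
  \<comment> \<open>Stated for primed data so that it also applies with the roles of
    \<open>X\<close> and \<open>Y\<close> exchanged.\<close>
  have main: "\<exists>s0 t0. cface \<alpha> \<beta> = {s0, t0} \<and> s0 \<noteq> t0 \<and> X' s0 = 0 \<and> Y' s0 = \<alpha>' \<and> X' t0 = 1 \<and> Y' t0 = 0 \<and> \<beta>' = 1"
    if p': "X' p = 1" "Y' p = 0"
      and pos': "0 < \<alpha>'" "0 < \<beta>'" "coprime \<alpha>' \<beta>'"
      and H': "\<And>r. r \<in> cface \<alpha> \<beta> \<Longrightarrow> \<alpha>' * X' r + \<beta>' * Y' r \<le> \<alpha>'"
      and eq': "\<And>r r'. r \<in> cface \<alpha> \<beta> \<Longrightarrow> r' \<in> cface \<alpha> \<beta> \<Longrightarrow> \<alpha>' * X' r + \<beta>' * Y' r = \<alpha>' * X' r' + \<beta>' * Y' r'"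
      and inj': "\<And>r r'. r \<in> cface \<alpha> \<beta> \<Longrightarrow> r' \<in> cface \<alpha> \<beta> \<Longrightarrow> X' r = X' r' \<Longrightarrow> Y' r = Y' r' \<Longrightarrow> r = r'"
    for X' Y' :: "nat \<times> nat \<Rightarrow> nat" and \<alpha>' \<beta>' :: nat
  proof -
    have X1: "X' r \<le> 1" if "r \<in> cface \<alpha> \<beta>" for r
    proof -
      have "\<alpha>' * X' r \<le> \<alpha>' * 1" using H'[OF that] by linarith
      then show ?thesis using pos'(1) by (simp only: mult_le_cancel1)
    qed
    have X0inj: "r = r'" if "r \<in> cface \<alpha> \<beta>" "r' \<in> cface \<alpha> \<beta>" "X' r = X' r'" for r r'
      using eq'[OF that(1,2)] that pos' inj' by simp
    have "X' s \<noteq> X' t" using X0inj st by blast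
    then have "X' s = 0 \<and> X' t = 1 \<or> X' s = 1 \<and> X' t = 0" using X1[OF st(1)] X1[OF st(2)] by linarith
    then obtain s0 t0 where s0: "s0 \<in> cface \<alpha> \<beta>" "X' s0 = 0" and t0: "t0 \<in> cface \<alpha> \<beta>" "X' t0 = 1"
      using st(1,2) by metis
    have Yt: "Y' t0 = 0" using H'[OF t0(1)] t0(2) pos' by simp
    have Ys: "\<beta>' * Y' s0 = \<alpha>'" using eq'[OF s0(1) t0(1)] s0 t0 Yt by simp
    then have "\<beta>' dvd \<alpha>'" by (metis dvd_triv_left)
    then have \<beta>1: "\<beta>' = 1" using pos'(3) coprime_common_divisor_nat[of \<alpha>' \<beta>' \<beta>'] by simp
    have "r = s0 \<or> r = t0" if "r \<in> cface \<alpha> \<beta>" for r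
      using X1[OF that] X0inj[OF that s0(1)] X0inj[OF that t0(1)] s0 t0 by fastforce
    then have "cface \<alpha> \<beta> = {s0, t0}" using s0 t0 by blast
    then show ?thesis using s0 t0 Yt Ys \<beta>1 by (intro exI[of _ s0] exI[of _ t0]) auto
  qed
  have "X p \<noteq> 0 \<or> Y p \<noteq> 0"
  proof (rule ccontr)
    assume "\<not> ?thesis"
    then have "X s = 0" "Y s = 0" "X t = 0" "Y t = 0" using H[OF st(1)] H[OF st(2)] pos by auto
    then show False using XY_inj[OF A[OF st(1)] A[OF st(2)]] st(3) by simp
  qed
  then consider "X p = 1" "Y p = 0" | "X p = 0" "Y p = 1" using p(2) by linarith
  then show ?thesis
  proof cases
    case 1
    have "\<exists>s0 t0. cface \<alpha> \<beta> = {s0, t0} \<and> s0 \<noteq> t0 \<and> X s0 = 0 \<and> Y s0 = \<alpha> \<and> X t0 = 1 \<and> Y t0 = 0 \<and> \<beta> = 1"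
    proof (rule main[of X Y \<alpha> \<beta>, OF 1 pos])
      show "\<alpha> * X r + \<beta> * Y r \<le> \<alpha>" if "r \<in> cface \<alpha> \<beta>" for r using H[OF that] 1 by simp
    qed (fact eq, blast intro: XY_inj A)
    then obtain s0 t0 where "cface \<alpha> \<beta> = {s0, t0}" "s0 \<noteq> t0" "X s0 = 0" "Y s0 = \<alpha>" "X t0 = 1" "Y t0 = 0" "\<beta> = 1"
      by blast
    then show ?thesis by (intro that[of s0 t0]) auto
  next
    case 2
    have "\<exists>s0 t0. cface \<alpha> \<beta> = {s0, t0} \<and> s0 \<noteq> t0 \<and> Y s0 = 0 \<and> X s0 = \<beta> \<and> Y t0 = 1 \<and> X t0 = 0 \<and> \<alpha> = 1"
    proof (rule main[of Y X \<beta> \<alpha>, OF 2(2,1) pos(2,1)])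
      show "coprime \<beta> \<alpha>" using pos(3) by (simp add: coprime_commute)
      show "\<beta> * Y r + \<alpha> * X r \<le> \<beta>" if "r \<in> cface \<alpha> \<beta>" for r using H[OF that] 2 by simp
      show "\<beta> * Y r + \<alpha> * X r = \<beta> * Y r' + \<alpha> * X r'" if "r \<in> cface \<alpha> \<beta>" "r' \<in> cface \<alpha> \<beta>" for r r'
        using eq[OF that] by simp
    qed (blast intro: XY_inj A)
    then obtain s0 t0 where "cface \<alpha> \<beta> = {s0, t0}" "s0 \<noteq> t0" "Y s0 = 0" "X s0 = \<beta>" "Y t0 = 1" "X t0 = 0" "\<alpha> = 1"
      by blast
    then show ?thesis by (intro that[of t0 s0]) auto
  qed
qed

text \<open>The edge of normal (\<alpha>, \<beta>) ends at (0, \<alpha>) and (\<beta>, 0). Comparing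
  each edge with the end points of the other gives both inequalities.\<close>

lemma good_cone_unique:
  assumes good: cone_good and pos: "0 < \<alpha>" "0 < \<beta>" "coprime \<alpha> \<beta>" and st: "s \<in> cface \<alpha> \<beta>" "t \<in> cface \<alpha> \<beta>" "s \<noteq> t"
    and pos': "0 < \<alpha>'" "0 < \<beta>'" "coprime \<alpha>' \<beta>'" and st': "s' \<in> cface \<alpha>' \<beta>'" "t' \<in> cface \<alpha>' \<beta>'" "s' \<noteq> t'"
  shows "\<alpha> = \<alpha>'" "\<beta> = \<beta>'"
proof -
  obtain s0 t0 where 1: "cface \<alpha> \<beta> = {s0, t0}" "X s0 = 0" "Y s0 = \<alpha>" "X t0 = \<beta>" "Y t0 = 0"
    using good_coneD[OF good pos st] by metis
  obtain s1 t1 where 2: "cface \<alpha>' \<beta>' = {s1, t1}" "X s1 = 0" "Y s1 = \<alpha>'" "X t1 = \<beta>'" "Y t1 = 0"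
    using good_coneD[OF good pos' st'] by metis
  have A: "s0 \<in> A" "t0 \<in> A" "s1 \<in> A" "t1 \<in> A" using 1(1) 2(1) unfolding cface_def by blast+
  have f1: "\<alpha> * X s0 + \<beta> * Y s0 \<le> \<alpha> * X r + \<beta> * Y r" "\<alpha> * X t0 + \<beta> * Y t0 \<le> \<alpha> * X r + \<beta> * Y r" if "r \<in> A" for r
    using 1(1) that unfolding cface_def by blast+
  have f2: "\<alpha>' * X s1 + \<beta>' * Y s1 \<le> \<alpha>' * X r + \<beta>' * Y r" "\<alpha>' * X t1 + \<beta>' * Y t1 \<le> \<alpha>' * X r + \<beta>' * Y r" if "r \<in> A" for r
    using 2(1) that unfolding cface_def by blast+
  have "\<alpha> \<le> \<alpha>'" "\<beta> \<le> \<beta>'" using f1(1)[OF A(3)] f1(2)[OF A(4)] 1 2 pos by auto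
  moreover have "\<alpha>' \<le> \<alpha>" "\<beta>' \<le> \<beta>" using f2(1)[OF A(1)] f2(2)[OF A(2)] 1 2 pos' by auto
  ultimately show "\<alpha> = \<alpha>'" "\<beta> = \<beta>'" by auto
qed

text \<open>From the lowest point on the axis U = 0 the boundary leaves towards the point with the
  largest quotient (W s0 - W t) / U t; dividing by the gcd yields the primitive normal.
  \<open>U\<close> and \<open>W\<close> are parameters so that both axes are covered.\<close>

lemma steepest_edge:
  fixes U W :: "nat \<times> nat \<Rightarrow> nat"
  assumes s0: "s0 \<in> A" "U s0 = 0" and low: "\<And>s. s \<in> A \<Longrightarrow> U s = 0 \<Longrightarrow> W s0 \<le> W s"
    and ex: "\<exists>t\<in>A. W t < W s0"
  shows "\<exists>\<alpha> \<beta>. \<exists>t\<in>A. 0 < \<alpha> \<and> 0 < \<beta> \<and> coprime \<alpha> \<beta> \<and> t \<noteq> s0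
    \<and> \<alpha> * U t + \<beta> * W t = \<beta> * W s0 \<and> (\<forall>r\<in>A. \<beta> * W s0 \<le> \<alpha> * U r + \<beta> * W r)"
proof -
  define T where "T = {t\<in>A. W t < W s0}"
  have T: "finite T" "T \<noteq> {}" using fin ex by (auto simp: T_def)
  have Upos: "0 < U t" if "t \<in> T" for t using that low[of t] by (fastforce simp: T_def)
  obtain t where t: "t \<in> T" "\<And>r. r \<in> T \<Longrightarrow> (real (W s0) - W r) / U r \<le> (real (W s0) - W t) / U t"
    using ex_is_arg_min_if_finite[OF T, of "\<lambda>r. - ((real (W s0) - W r) / U r)"]
    unfolding is_arg_min_linorder neg_le_iff_le by blast
  have tA: "t \<in> A" "W t < W s0" using t(1) by (auto simp: T_def)
  define g where "g = gcd (W s0 - W t) (U t)"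
  have g0: "g \<noteq> 0" using Upos[OF t(1)] by (simp add: g_def)
  obtain \<alpha> \<beta> where ab: "W s0 - W t = \<alpha> * g" "U t = \<beta> * g" "coprime \<alpha> \<beta>"
    using gcd_coprime_exists[OF g0[unfolded g_def]] unfolding g_def by blast
  have pos: "0 < \<alpha>" "0 < \<beta>" using ab tA Upos[OF t(1)] by (auto intro!: Nat.gr0I)
  have e: "\<alpha> * U t + \<beta> * W t = \<beta> * W s0"
  proof -
    have "\<alpha> * U t = \<beta> * (W s0 - W t)" using ab by simp
    then show ?thesis using tA(2) by (simp add: diff_mult_distrib2)
  qed
  have "\<beta> * W s0 \<le> \<alpha> * U r + \<beta> * W r" if r: "r \<in> A" for r
  proof (cases "r \<in> T")
    case True
    then have rl: "W r < W s0" by (simp add: T_def)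
    have "(real (W s0) - W r) * U t \<le> (real (W s0) - W t) * U r"
      using t(2)[OF True] Upos[OF t(1)] Upos[OF True] by (simp add: field_simps)
    then have "real ((W s0 - W r) * U t) \<le> real ((W s0 - W t) * U r)"
      using rl tA(2) by (simp add: of_nat_diff)
    then have "(W s0 - W r) * (\<beta> * g) \<le> (\<alpha> * g) * U r" using ab by (simp only: of_nat_le_iff)
    then have "g * (\<beta> * (W s0 - W r)) \<le> g * (\<alpha> * U r)" by (simp add: mult_ac)
    then have "\<beta> * (W s0 - W r) \<le> \<alpha> * U r" using g0 mult_le_cancel1[of g] by blast
    then show ?thesis using rl by (simp add: diff_mult_distrib2)
  next
    case False
    then have "\<beta> * W s0 \<le> \<beta> * W r" using r by (intro mult_le_mono2) (simp add: T_def)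
    then show ?thesis by (rule trans_le_add2)
  qed
  then show ?thesis using pos ab(3) tA e by (intro exI[of _ \<alpha>] exI[of _ \<beta>] bexI[of _ t]) auto
qed

text \<open>Without a point of X + Y \<le> 1, the lowest points on both axes are at distance at
  least 2 from the origin. The edges starting there have different normals (\<open>two\<close>), or
  they are one edge from (0, \<alpha> k) to (\<beta> k, 0). For k = 1 both \<alpha> and \<beta> are
  at least 2 (\<open>big\<close>); for k \<ge> 2 the edge has lattice length at least 2
  (\<open>long\<close>).\<close>

lemma bad_coneD:
  assumes bad: "\<not> cone_good"
  obtains (big) \<alpha> \<beta> s t where "2 \<le> \<alpha>" "2 \<le> \<beta>" "coprime \<alpha> \<beta>" "s \<in> cface \<alpha> \<beta>" "t \<in> cface \<alpha> \<beta>" "s \<noteq> t"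
  | (long) \<alpha> \<beta> s t where "0 < \<alpha>" "0 < \<beta>" "coprime \<alpha> \<beta>" "s \<in> cface \<alpha> \<beta>" "t \<in> cface \<alpha> \<beta>"
      "snd s + (\<alpha> * m1 + \<beta> * m2) < snd t"
  | (two) \<alpha> \<beta> s t \<alpha>' \<beta>' s' t' where "0 < \<alpha>" "0 < \<beta>" "coprime \<alpha> \<beta>" "s \<in> cface \<alpha> \<beta>" "t \<in> cface \<alpha> \<beta>" "s \<noteq> t"
      "0 < \<alpha>'" "0 < \<beta>'" "coprime \<alpha>' \<beta>'" "s' \<in> cface \<alpha>' \<beta>'" "t' \<in> cface \<alpha>' \<beta>'" "s' \<noteq> t'"
      "(\<alpha>, \<beta>) \<noteq> (\<alpha>', \<beta>')"
proof -
  have XY: "2 \<le> X s + Y s" if "s \<in> A" for s using bad that unfolding cone_good_iff by force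
  define AX where "AX = {s\<in>A. X s = 0}"
  define AY where "AY = {s\<in>A. Y s = 0}"
  have AXY: "finite AX" "AX \<noteq> {}" "finite AY" "AY \<noteq> {}"
    unfolding AX_def AY_def using fin X_zero Y_zero by auto
  obtain s0 where "s0 \<in> AX" "\<forall>s\<in>AX. Y s0 \<le> Y s"
    using ex_is_arg_min_if_finite[OF AXY(1,2), of Y] unfolding is_arg_min_linorder by blast
  then have s0: "s0 \<in> A" "X s0 = 0" "\<And>s. s \<in> A \<Longrightarrow> X s = 0 \<Longrightarrow> Y s0 \<le> Y s"
    unfolding AX_def by blast+
  obtain t0 where "t0 \<in> AY" "\<forall>s\<in>AY. X t0 \<le> X s"
    using ex_is_arg_min_if_finite[OF AXY(3,4), of X] unfolding is_arg_min_linorder by blast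
  then have t0: "t0 \<in> A" "Y t0 = 0" "\<And>s. s \<in> A \<Longrightarrow> Y s = 0 \<Longrightarrow> X t0 \<le> X s"
    unfolding AY_def by blast+
  have Y0: "2 \<le> Y s0" using XY[OF s0(1)] s0(2) by simp
  have X0: "2 \<le> X t0" using XY[OF t0(1)] t0(2) by simp
  have ex: "\<exists>t\<in>A. Y t < Y s0" "\<exists>t\<in>A. X t < X t0"
    using bexI[of _ t0] bexI[of _ s0] s0(1,2) t0(1,2) X0 Y0 by auto
  obtain \<alpha> \<beta> t where 1: "t \<in> A" "0 < \<alpha>" "0 < \<beta>" "coprime \<alpha> \<beta>" "t \<noteq> s0"
      "\<alpha> * X t + \<beta> * Y t = \<beta> * Y s0" "\<forall>r\<in>A. \<beta> * Y s0 \<le> \<alpha> * X r + \<beta> * Y r"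
    using steepest_edge[of s0 X Y, OF s0(1,2) s0(3) ex(1)] by blast
  obtain \<beta>' \<alpha>' s where 2: "s \<in> A" "0 < \<beta>'" "0 < \<alpha>'" "coprime \<beta>' \<alpha>'" "s \<noteq> t0"
      "\<beta>' * Y s + \<alpha>' * X s = \<alpha>' * X t0" "\<forall>r\<in>A. \<alpha>' * X t0 \<le> \<beta>' * Y r + \<alpha>' * X r"
    using steepest_edge[of t0 Y X, OF t0(1,2) t0(3) ex(2)] by blast
  have c1: "s0 \<in> cface \<alpha> \<beta>" "t \<in> cface \<alpha> \<beta>" using 1 s0 by (simp_all add: cface_def)
  have c2: "s \<in> cface \<alpha>' \<beta>'" "t0 \<in> cface \<alpha>' \<beta>'" using 2 t0 by (simp_all add: cface_def add.commute)
  show ?thesis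
  proof (cases "(\<alpha>, \<beta>) = (\<alpha>', \<beta>')")
    case False
    then show ?thesis
      using two[of \<alpha> \<beta> s0 t \<alpha>' \<beta>' s t0] 1 2 c1 c2 by (simp add: coprime_commute)
  next
    case True
    then have t0c: "t0 \<in> cface \<alpha> \<beta>" using c2 by simp
    have "\<alpha> * X s0 + \<beta> * Y s0 = \<alpha> * X t0 + \<beta> * Y t0"
      using c1(1) t0c s0(1) t0(1) by (intro le_antisym) (simp_all add: cface_def)
    then have eq: "\<beta> * Y s0 = \<alpha> * X t0" using s0 t0 by simp
    have "\<alpha> dvd \<beta> * Y s0" using eq by simp
    then have "\<alpha> dvd Y s0" using 1(4) by (simp add: coprime_dvd_mult_right_iff)
    then obtain k where k: "Y s0 = \<alpha> * k" by blast
    have "\<alpha> * X t0 = \<alpha> * (\<beta> * k)" unfolding eq[symmetric] k by simp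
    then have k': "X t0 = \<beta> * k" using 1(2) by simp
    have k0: "k \<noteq> 0" using k Y0 by (intro notI) simp
    show ?thesis
    proof (cases "k = 1")
      case True
      have "s0 \<noteq> t0" using Y0 t0(2) by (intro notI) simp
      then show ?thesis using big[of \<alpha> \<beta> s0 t0] k k' X0 Y0 1(4) c1(1) t0c True by simp
    next
      case False
      then have k2: "2 \<le> k" using k0 by simp
      have d: "\<bar>int (snd s0) - int (snd t0)\<bar> = int (k * (\<alpha> * m1 + \<beta> * m2))"
        using snd_diff[OF s0(1) t0(1), of k \<beta> \<alpha>] k k' s0 t0 by simp
      define M where "M = \<alpha> * m1 + \<beta> * m2"
      have "M > 0"
      proof -
        have "m1 \<noteq> 0 \<or> m2 \<noteq> 0" using det by (cases "m1 = 0"; cases "m2 = 0") simp_all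
        then show ?thesis using 1(2,3) unfolding M_def by (metis add_gr_0 gr0I mult_pos_pos)
      qed
      then have "M < 2 * M" by simp
      also have "2 * M \<le> k * M" using k2 by (rule mult_le_mono1)
      finally have "M < k * M" .
      then have "snd s0 + M < snd t0 \<or> snd t0 + M < snd s0" using d unfolding M_def[symmetric] by linarith
      then show ?thesis
      proof
        assume "snd s0 + M < snd t0"
        then show ?thesis by (intro long[OF 1(2-4) c1(1) t0c]) (simp add: M_def)
      next
        assume "snd t0 + M < snd s0"
        then show ?thesis by (intro long[OF 1(2-4) t0c c1(1)]) (simp add: M_def)
      qed
    qed
  qed
qed

end

section \<open>Admissibility at a corner\<close>

lemma locally_admissibleI:
  assumes "2 \<le> ram_order S q" "s_param S q = Fin s" "sbar S q = s" "coprime s (int (ram_order S q))"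
    and "s \<le> - 1 \<or> s \<in> {1..int (ram_order S q) + 1} \<and>
      ([int (ram_order S q) = 1] (mod s) \<or> [int (ram_order S q) = - 1] (mod s))"
  shows "locally_admissible S q"
  unfolding locally_admissible_def Let_def
  by (rule disjI2, rule conjI, fact, rule exI[of _ s], rule conjI, fact, rule conjI, fact, rule conjI, fact, simp add: assms)

text \<open>\<nu>1 \<le> 0 gives (C-ii), and a value \<nu> = 1 / r serves itself as 1 / m or gives
  (C-ii). In the remaining case \<kappa> N < r < (\<kappa> + 1) N for each point; the larger \<nu>
  has the smaller \<kappa>, and m = \<kappa>1 separates the two values.\<close>

lemma condition_C_holds:
  assumes le: "nu S q1 \<le> nu S q2"
    and r: "r1 = ram_order S q1" "r2 = ram_order S q2" "0 < r1" "0 < r2"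
    and N: "N1 = sbar S q1" "N2 = sbar S q2"
    and cases: "N1 \<le> 0 \<or> N1 = 1 \<or> N2 = 1 \<or>
      (int r1 = \<kappa>1 * N1 + \<beta>1 \<and> 0 < \<beta>1 \<and> \<beta>1 < N1 \<and> int r2 = \<kappa>2 * N2 + \<beta>2 \<and> 0 < \<beta>2 \<and> \<beta>2 < N2 \<and> 0 \<le> \<kappa>1 \<and> 0 \<le> \<kappa>2 \<and> \<kappa>1 \<noteq> \<kappa>2)"
  shows "condition_C S q1 q2"
proof -
  define r12 where "r12 = max r1 r2"
  have r12: "r1 \<le> r12" "r2 \<le> r12" "r12 = r1 \<or> r12 = r2" "0 < r12" using r by (auto simp: r12_def max_def)
  have nu: "nu S q1 = of_int N1 / r1" "nu S q2 = of_int N2 / r2" using r N by (simp_all add: nu_def)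
  have "(\<exists>m\<in>{1..<r12}. nu S q1 \<le> 1 / real m \<and> 1 / real m \<le> nu S q2) \<or> nu S q1 \<le> 1 / real r12"
    using cases
  proof (elim disjE conjE)
    assume "N1 \<le> 0"
    then have "nu S q1 \<le> 0" using r by (simp add: nu divide_nonpos_pos)
    also have "0 \<le> 1 / real r12" by simp
    finally show ?thesis by blast
  next
    assume "N1 = 1"
    then have n1: "nu S q1 = 1 / real r1" by (simp add: nu)
    show ?thesis
    proof (cases "r12 = r1")
      case False
      then have "r1 \<in> {1..<r12}" using r12 r by auto
      then show ?thesis using n1 le by (intro disjI1 bexI[of _ r1]) auto
    qed (simp add: n1)
  next
    assume "N2 = 1"
    then have n2: "nu S q2 = 1 / real r2" by (simp add: nu)
    show ?thesis
    proof (cases "r12 = r2")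
      case False
      then have "r2 \<in> {1..<r12}" using r12 r by auto
      then show ?thesis using n2 le by (intro disjI1 bexI[of _ r2]) auto
    qed (use n2 le in simp)
  next
    assume a: "int r1 = \<kappa>1 * N1 + \<beta>1" "0 < \<beta>1" "\<beta>1 < N1" "int r2 = \<kappa>2 * N2 + \<beta>2" "0 < \<beta>2" "\<beta>2 < N2" "0 \<le> \<kappa>1" "0 \<le> \<kappa>2" "\<kappa>1 \<noteq> \<kappa>2"
    have "of_int N1 * real r2 \<le> of_int N2 * real r1" using le r(3,4) by (simp add: nu field_simps)
    then have "real_of_int (N1 * int r2) \<le> of_int (N2 * int r1)" by simp
    then have cross: "N1 * int r2 \<le> N2 * int r1" by (simp only: of_int_le_iff)
    have "\<kappa>2 < \<kappa>1"
    proof (rule ccontr)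
      assume "\<not> \<kappa>2 < \<kappa>1"
      then have l: "\<kappa>1 + 1 \<le> \<kappa>2" using a by simp
      have "int r1 < (\<kappa>1 + 1) * N1" using a by (simp add: algebra_simps)
      also have "\<dots> \<le> \<kappa>2 * N1" using l a by (intro mult_right_mono) auto
      finally have "N2 * int r1 < N2 * (\<kappa>2 * N1)" using a by (intro mult_strict_left_mono) auto
      moreover have "N1 * (\<kappa>2 * N2) \<le> N1 * int r2" using a by (intro mult_left_mono) auto
      ultimately show False using cross by (simp add: mult_ac)
    qed
    then have k1: "1 \<le> \<kappa>1" using a by simp
    \<comment> \<open>m = \<kappa>1 must stay below the larger ramification order.\<close>
    have "\<kappa>1 * 1 \<le> \<kappa>1 * N1" using a by (intro mult_left_mono) auto
    then have klt: "\<kappa>1 < int r1" using a by simp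
    have "int r2 \<le> (\<kappa>2 + 1) * N2" using a by (simp add: algebra_simps)
    also have "\<dots> \<le> \<kappa>1 * N2" using a \<open>\<kappa>2 < \<kappa>1\<close> by (intro mult_right_mono) auto
    finally have "real_of_int (int r2) \<le> of_int (\<kappa>1 * N2)" by (simp only: of_int_le_iff)
    then have u2: "real r2 \<le> of_int \<kappa>1 * of_int N2" by simp
    have "\<kappa>1 * N1 \<le> int r1" using a by simp
    then have "real_of_int (\<kappa>1 * N1) \<le> of_int (int r1)" by (simp only: of_int_le_iff)
    then have u1: "of_int \<kappa>1 * of_int N1 \<le> real r1" by simp
    define m where "m = nat \<kappa>1"
    have m: "real m = of_int \<kappa>1" "m \<in> {1..<r12}" using k1 klt r12 by (auto simp: m_def)
    have "nu S q1 \<le> 1 / real m" "1 / real m \<le> nu S q2"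
      using u1 u2 r k1 unfolding nu m(1) by (simp_all add: field_simps)
    then show ?thesis using m by blast
  qed
  then show ?thesis unfolding condition_C_def Let_def r12_def r(1,2) .
qed

text \<open>With equal \<kappa> no 1 / m lies between: \<nu>1 \<le> 1 / m forces m \<le> \<kappa>,
  and 1 / m \<le> \<nu>2 forces m > \<kappa>. Condition (C-ii) would give N1 \<le> 1.\<close>

lemma condition_C_fails:
  assumes r: "r1 = ram_order S q1" "r2 = ram_order S q2" "0 < r1" "0 < r2"
    and N: "N1 = sbar S q1" "N2 = sbar S q2" "2 \<le> N1" "2 \<le> N2"
    and same: "int r1 = \<kappa> * N1 + \<beta>1" "\<beta>1 < N1" "int r2 = \<kappa> * N2 + \<beta>2" "0 < \<beta>2"
  shows "\<not> condition_C S q1 q2"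
proof -
  define r12 where "r12 = max r1 r2"
  have r12: "r1 \<le> r12" "0 < r12" using r by (auto simp: r12_def)
  have nu: "nu S q1 = of_int N1 / r1" "nu S q2 = of_int N2 / r2" using r N by (simp_all add: nu_def)
  have 1: False if m: "m \<in> {1..<r12}" "nu S q1 \<le> 1 / real m" "1 / real m \<le> nu S q2" for m
  proof -
    have "of_int N1 * real m \<le> real r1" "real r2 \<le> of_int N2 * real m"
      using m r by (simp_all add: nu field_simps)
    then have "real_of_int (N1 * int m) \<le> of_int (int r1)" "real_of_int (int r2) \<le> of_int (N2 * int m)" by simp_all
    then have i: "N1 * int m \<le> int r1" "int r2 \<le> N2 * int m" by (simp_all only: of_int_le_iff)
    have "N1 * int m < N1 * (\<kappa> + 1)" using i(1) same by (simp add: algebra_simps)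
    then have "int m < \<kappa> + 1" using N(3) by (simp add: mult_less_cancel_left)
    then have "N2 * int m \<le> N2 * \<kappa>" using N(4) by (intro mult_left_mono) auto
    then show False using i(2) same(3,4) by (simp add: mult.commute)
  qed
  have 2: False if "nu S q1 \<le> 1 / real r12"
  proof -
    have "of_int N1 * real r12 \<le> real r1" using that r r12 by (simp add: nu field_simps)
    also have "\<dots> \<le> real r12" using r12 by simp
    finally have "of_int N1 * real r12 \<le> 1 * real r12" by simp
    then have "real_of_int N1 \<le> 1" using r12(2) by (subst (asm) mult_le_cancel_right_pos) auto
    then show False using N(3) by simp
  qed
  show ?thesis using 1 2 unfolding condition_C_def Let_def r(1,2)[symmetric] r12_def[symmetric] by blast
qed

context curve_corner
begin

definition corner_points :: "'a set" where
  "corner_points = {q \<in> topspace (surface S). \<eta> q = corner}"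

definition corner_admissible :: bool where
  "corner_admissible \<longleftrightarrow> (\<forall>q\<in>corner_points. locally_admissible S q)
     \<and> (\<forall>q1\<in>corner_points. \<forall>q2\<in>corner_points. q1 \<noteq> q2 \<and> nu S q1 \<le> nu S q2 \<longrightarrow>
          non_resonant S q1 q2 \<and> condition_C S q1 q2)"

lemma corner_point_data: "q \<in> corner_points \<Longrightarrow> \<exists>n d. point_data q n d"
  using point_data_exists by (simp add: corner_points_def)

lemma order_at_inject: "order_at r n = order_at r n' \<longleftrightarrow> n = n'"
  by (simp add: order_at_def)

text \<open>Equal \<nu> are equal reduced fractions, so both branches have the same normal, and the
  exponent r' is r. The ratio in the condition is the ratio of the leading coefficients or its
  inverse; by \<open>branch_unique\<close> its r-th power is 1 only if the points coincide.\<close>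

lemma corner_non_resonant:
  assumes 1: "point_data q1 n1 d1" and 2: "point_data q2 n2 d2" and ne: "q1 \<noteq> q2"
  shows "non_resonant S q1 q2"
proof (cases "nu S q1 = nu S q2")
  case True
  note D1 = point_dataD[OF 1] and D2 = point_dataD[OF 2]
  define r1 r2 where "r1 = ram_order S q1" and "r2 = ram_order S q2"
  define N1 N2 where "N1 = order_at r1 n1" and "N2 = order_at r2 n2"
  have pos: "0 < r1" "0 < r2" using D1(1) D2(1) by (simp_all add: r1_def r2_def)
  have cop: "coprime N1 (int r1)" "coprime N2 (int r2)"
    using D1(3) D2(3) by (simp_all add: N1_def N2_def r1_def r2_def order_at_coprime)
  have "of_int N1 / real r1 = of_int N2 / real r2"
    using True D1(6) D2(6) by (simp add: nu_def N1_def N2_def r1_def r2_def)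
  then have "of_int N1 * real r2 = of_int N2 * real r1" using pos by (simp add: field_simps)
  then have "real_of_int (N1 * int r2) = of_int (N2 * int r1)" by simp
  then have x: "N1 * int r2 = N2 * int r1" by (simp only: of_int_eq_iff)
  have "int r1 dvd N1 * int r2" "int r2 dvd N2 * int r1" using x by (metis dvd_triv_right)+
  then have "int r1 dvd int r2" "int r2 dvd int r1"
    using cop by (metis coprime_commute coprime_dvd_mult_right_iff)+
  then have rr: "r1 = r2" by (simp add: dvd_antisym)
  then have NN: "N1 = N2" using x pos by simp
  then have nn: "n1 = n2" using rr by (simp add: N1_def N2_def order_at_inject)
  have dd: "d1 ^ r1 \<noteq> d2 ^ r1"
    using point_data_unique[OF 1 2[folded nn]] rr ne by (auto simp: r1_def r2_def)
  have ex: "nat (int (ram_order S q1) div gcd (int (ram_order S q1)) (sbar S q1)) = r1"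
    using cop(1) D1(6) by (simp add: N1_def r1_def coprime_iff_gcd_eq_1 gcd.commute)
  have d0: "d1 \<noteq> 0" "d2 \<noteq> 0" using D1(4) D2(4) by auto
  have ratio: "(tau_lead S q1 / of_nat (ram_order S q1)) / (tau_lead S q2 / of_nat (ram_order S q2))
      = (if by then d2 / d1 else d1 / d2)"
    using D1(7) D2(7) rr pos d0 by (simp add: lead_at_def r1_def r2_def field_simps)
  have "(if by then d2 / d1 else d1 / d2) ^ r1 \<noteq> 1"
    using dd d0 by (auto simp: power_divide)
  then show ?thesis unfolding non_resonant_def ratio ex using True by blast
qed (simp add: non_resonant_def)

text \<open>Here N = - r - n is negative, which is locally admissible and makes \<nu> negative, so
  (C-ii) holds.\<close>

lemma corner_admissible_infinity:
  assumes "bx" "by"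
  shows corner_admissible
proof -
  have neg: "order_at r n < 0" if "0 < n" for r n
    using that assms unfolding order_at_def by simp
  have "locally_admissible S q" if q: "q \<in> corner_points" for q
  proof -
    obtain n d where pd: "point_data q n d" using corner_point_data[OF q] by blast
    note D = point_dataD[OF pd]
    show ?thesis
    proof (cases "ram_order S q = 1")
      case False
      then have r2: "2 \<le> ram_order S q" using D(1) by simp
      show ?thesis
        by (rule locally_admissibleI[OF r2 D(8)[OF r2] D(6)])
           (use neg[OF D(2), of "ram_order S q"] order_at_coprime D(3) in auto)
    qed (simp add: locally_admissible_def)
  qed
  moreover have "non_resonant S q1 q2 \<and> condition_C S q1 q2"
    if q: "q1 \<in> corner_points" "q2 \<in> corner_points" and ne: "q1 \<noteq> q2" and le: "nu S q1 \<le> nu S q2" for q1 q2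
  proof -
    obtain n1 d1 where pd1: "point_data q1 n1 d1" using corner_point_data[OF q(1)] by blast
    obtain n2 d2 where pd2: "point_data q2 n2 d2" using corner_point_data[OF q(2)] by blast
    note pd = pd1 pd2
    note D1 = point_dataD[OF pd(1)] and D2 = point_dataD[OF pd(2)]
    have "condition_C S q1 q2"
      by (rule condition_C_holds[OF le refl refl D1(1) D2(1) refl refl])
         (use neg[OF D1(2), of "ram_order S q1"] D1(6) in simp)
    then show ?thesis using corner_non_resonant[OF pd ne] by blast
  qed
  ultimately show ?thesis unfolding corner_admissible_def by blast
qed

text \<open>On a one-point face the edge polynomial is a monomial, without nonzero roots.\<close>

lemma face_two_elements:
  assumes m: "0 < m" and d: "d \<noteq> 0" "edge_poly bx by P m n d = 0"
  obtains s t where "s \<in> face m n A" "t \<in> face m n A" "s \<noteq> t"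
proof -
  have "wmin m n \<in> (\<lambda>s. m * fst s + n * snd s) ` A" unfolding wmin_def using A_nonempty by (intro Min_in) auto
  then obtain s where s: "s \<in> face m n A" unfolding face_iff by auto
  have "\<exists>t\<in>face m n A. s \<noteq> t"
  proof (rule ccontr)
    assume no: "\<not> ?thesis"
    have F: "face m n A = {s}"
    proof (rule equalityI; rule subsetI)
      fix t assume "t \<in> face m n A"
      then have "\<not> s \<noteq> t" using no by metis
      then show "t \<in> {s}" by simp
    next
      fix t assume "t \<in> {s}"
      then show "t \<in> face m n A" using s by simp
    qed
    have "s \<in> A" using s by (simp add: face_iff)
    then have "cof s \<noteq> 0" by (auto simp: lsupp_def)
    then show False using d unfolding edge_poly_def F by simp
  qed
  then show ?thesis using that s by blast
qed

end

text \<open>The corners \<open>(\<infinity>, 0)\<close> (for \<open>bx\<close>) and \<open>(0, \<infinity>)\<close>. The branches of inner normal \<open>(r, n)\<close> have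
  \<open>\<nu> = N / r\<close> with \<open>N = \<plusminus>(n - r)\<close>; the cone number \<open>\<kappa>\<close> collects those with
  \<open>1 / (\<kappa> + 1) < \<nu> < 1 / \<kappa>\<close>, and is spanned by the normals with \<open>(r, N) = (\<kappa>, 1)\<close> and \<open>(\<kappa> + 1, 1)\<close>.\<close>

locale mixed_corner = curve_corner P \<eta> S bx "by" dx dy
  for P :: poly_xy and \<eta> :: "'a \<Rightarrow> proj1 \<times> proj1" and S :: "'a spectral_curve"
    and bx "by" :: bool and dx dy :: nat +
  assumes mixed: "by = (\<not> bx)"
begin

definition nf :: "nat \<Rightarrow> nat" where
  "nf \<kappa> = (if bx then Suc \<kappa> else \<kappa> - 1)"

text \<open>At (0, \<infinity>) the index 0 would need the normal (0, -1), so that list of cones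
  starts at 1; at (\<infinity>, 0) it starts at 0.\<close>

definition proper :: "nat \<Rightarrow> bool" where
  "proper \<kappa> \<longleftrightarrow> bx \<or> 1 \<le> \<kappa>"

abbreviation "good_cone \<kappa> \<equiv> lattice_cone.cone_good A \<kappa> (nf \<kappa>) (Suc \<kappa>) (nf (Suc \<kappa>))"

lemma cone:
  assumes "proper \<kappa>"
  shows "lattice_cone A \<kappa> (nf \<kappa>) (Suc \<kappa>) (nf (Suc \<kappa>))"
proof
  show "\<bar>int \<kappa> * int (nf (Suc \<kappa>)) - int (Suc \<kappa>) * int (nf \<kappa>)\<bar> = 1"
    using assms by (auto simp: nf_def proper_def of_nat_diff algebra_simps)
qed (simp_all add: A_nonempty)

lemma cface:
  assumes "proper \<kappa>"
  shows "lattice_cone.cface A \<kappa> (nf \<kappa>) (Suc \<kappa>) (nf (Suc \<kappa>)) \<alpha> \<beta> =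
     face (\<alpha> * \<kappa> + \<beta> * Suc \<kappa>) (\<alpha> * nf \<kappa> + \<beta> * nf (Suc \<kappa>)) A"
  unfolding lattice_cone.cface_eq[OF cone[OF assms]] face_def ..

lemma order_at_cone:
  assumes "proper \<kappa>"
  shows "order_at (\<alpha> * \<kappa> + \<beta> * Suc \<kappa>) (\<alpha> * nf \<kappa> + \<beta> * nf (Suc \<kappa>)) = int \<alpha> + int \<beta>"
  using assms mixed unfolding order_at_def nf_def proper_def by (cases \<kappa>) (auto simp: algebra_simps)

text \<open>Division of r by N: \<kappa> is the quotient, \<beta> the remainder and \<alpha> = N -
  \<beta>. The remainder is nonzero because r and N are coprime and N \<ge> 2. As r and N determine
  n, the second component needs no computation.\<close>

lemma cone_coordinates:
  assumes r: "0 < r" and n: "0 < n" and cop: "coprime r n" and N: "2 \<le> order_at r n"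
  obtains \<kappa> \<alpha> \<beta> where "proper \<kappa>" "0 < \<alpha>" "0 < \<beta>" "coprime \<alpha> \<beta>"
    "r = \<alpha> * \<kappa> + \<beta> * Suc \<kappa>" "n = \<alpha> * nf \<kappa> + \<beta> * nf (Suc \<kappa>)"
proof -
  define M where "M = nat (order_at r n)"
  have M: "int M = order_at r n" "2 \<le> M" using N by (auto simp: M_def)
  have copM: "coprime M r" using order_at_coprime[of r n] cop by (simp flip: M(1))
  define \<kappa> \<beta> \<alpha> where "\<kappa> = r div M" and "\<beta> = r mod M" and "\<alpha> = M - \<beta>"
  have \<beta>M: "\<beta> < M" using M(2) by (simp add: \<beta>_def)
  have \<alpha>M: "\<alpha> + \<beta> = M" using \<beta>M by (simp add: \<alpha>_def)
  have \<alpha>0: "0 < \<alpha>" using \<beta>M by (simp add: \<alpha>_def)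
  have rM: "r = \<kappa> * M + \<beta>" by (simp add: \<kappa>_def \<beta>_def)
  have "coprime M \<beta>" using copM M(2) by (simp add: \<beta>_def coprime_mod_right_iff)
  then have \<beta>0: "0 < \<beta>" using M(2) by (intro Nat.gr0I) auto
  have "coprime (\<alpha> + \<beta>) \<beta>" using \<open>coprime M \<beta>\<close> \<alpha>M by simp
  then have c: "coprime \<alpha> \<beta>" by (simp add: coprime_iff_gcd_eq_1)
  have r': "r = \<alpha> * \<kappa> + \<beta> * Suc \<kappa>" unfolding rM \<alpha>M[symmetric] by (simp add: algebra_simps)
  have pr: "proper \<kappa>"
  proof (cases bx)
    case False
    then have "int M = int r - int n" using mixed M(1) unfolding order_at_def by simp
    then have "M \<le> r" by simp
    then have "1 \<le> \<kappa>" unfolding \<kappa>_def using M(2) by (simp add: div_greater_zero_iff Suc_leI)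
    then show ?thesis unfolding proper_def by simp
  next
    case True
    then show ?thesis unfolding proper_def by simp
  qed
  have "order_at r n = order_at r (\<alpha> * nf \<kappa> + \<beta> * nf (Suc \<kappa>))"
    unfolding order_at_cone[OF pr, of \<alpha> \<beta>, folded r'] M(1)[symmetric] \<alpha>M[symmetric] by simp
  then have "n = \<alpha> * nf \<kappa> + \<beta> * nf (Suc \<kappa>)"
    by (simp only: order_at_inject)
  then show ?thesis using that pr \<alpha>0 \<beta>0 c r' by blast
qed

text \<open>From r = \<kappa> N + \<beta> the gcd of N and r is that of \<alpha> + \<beta> and
  \<beta>, so coprime coordinates belong to primitive normals.\<close>

lemma cone_normal:
  assumes pr: "proper \<kappa>" and pos: "0 < \<alpha>" "0 < \<beta>" "coprime \<alpha> \<beta>"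
  defines "m \<equiv> \<alpha> * \<kappa> + \<beta> * Suc \<kappa>" and "n \<equiv> \<alpha> * nf \<kappa> + \<beta> * nf (Suc \<kappa>)"
  shows "0 < m" "0 < n" "coprime m n"
proof -
  show "0 < m" using pos by (simp add: m_def)
  show "0 < n" using pos pr by (auto simp: n_def nf_def proper_def)
  have "int m = int \<kappa> * (int \<alpha> + int \<beta>) + int \<beta>" by (simp add: m_def algebra_simps)
  then have "gcd (int \<alpha> + int \<beta>) (int m) = gcd (int \<alpha> + int \<beta>) (int \<beta>)" by (simp only: gcd_add_mult)
  also have "\<dots> = gcd (int \<alpha>) (int \<beta>)" by simp
  also have "\<dots> = 1" using pos(3) by (metis coprime_imp_gcd_eq_1 coprime_int_iff)
  finally have "coprime (order_at m n) (int m)"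
    unfolding m_def n_def order_at_cone[OF pr] by (simp add: coprime_iff_gcd_eq_1)
  then show "coprime m n" by (simp add: order_at_coprime)
qed

text \<open>In r = \<kappa> N + \<beta> with N = \<alpha> + \<beta>, \<beta> = 1 makes r congruent
  to 1 and \<alpha> = 1 makes r congruent to -1 modulo N. The good cone supplies one of the
  two.\<close>

lemma good_locally_admissible:
  assumes good: "\<And>\<kappa>. proper \<kappa> \<Longrightarrow> good_cone \<kappa>" and pd: "point_data q n d"
  shows "locally_admissible S q"
proof (cases "ram_order S q = 1")
  case False
  note D = point_dataD[OF pd]
  define r where "r = ram_order S q"
  have r2: "2 \<le> r" using False D(1) by (simp add: r_def)
  define N where "N = order_at r n"
  have cop: "coprime N (int r)" using order_at_coprime D(3) by (simp add: N_def r_def)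
  have N0: "N \<noteq> 0" using cop r2 by auto
  have "N \<le> - 1 \<or> N \<in> {1..int r + 1} \<and> ([int r = 1] (mod N) \<or> [int r = - 1] (mod N))"
  proof -
    consider "N \<le> -1" | "N = 1" | "2 \<le> N" using N0 by linarith
    then show ?thesis
    proof cases
      case 2
      then show ?thesis by (simp add: cong_def)
    next
      case 3
      obtain \<kappa> \<alpha> \<beta> where k: "proper \<kappa>" "0 < \<alpha>" "0 < \<beta>" "coprime \<alpha> \<beta>"
          "r = \<alpha> * \<kappa> + \<beta> * Suc \<kappa>" "n = \<alpha> * nf \<kappa> + \<beta> * nf (Suc \<kappa>)"
        using cone_coordinates[of r n] D(1-3) 3 by (auto simp: r_def N_def)
      interpret lattice_cone A \<kappa> "nf \<kappa>" "Suc \<kappa>" "nf (Suc \<kappa>)" by (rule cone[OF k(1)])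
      obtain s t where st: "s \<in> face r n A" "t \<in> face r n A" "s \<noteq> t"
        by (rule face_two_elements[OF D(1,4,5), folded r_def])
      have "\<alpha> = 1 \<or> \<beta> = 1"
        using good_coneD[OF good[OF k(1)] k(2-4), of s t] st unfolding cface[OF k(1)] k(5,6)[symmetric] by metis
      moreover have Nab: "N = int \<alpha> + int \<beta>" unfolding N_def k(5,6) by (rule order_at_cone[OF k(1)])
      moreover have rN: "int r = int \<kappa> * N + int \<beta>" unfolding Nab k(5) by (simp add: algebra_simps)
      \<comment> \<open>For \<kappa> = 0 the bound is attained: r = \<beta> \<ge> 2 forces \<alpha>
        = 1.\<close>
      moreover have "N \<le> int r + 1"
      proof (cases "\<kappa> = 0")
        case True
        then have "int \<beta> = int r" using rN by simp
        then show ?thesis using \<open>\<alpha> = 1 \<or> \<beta> = 1\<close> r2 Nab by auto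
      next
        case False
        then have "1 * N \<le> int \<kappa> * N" using 3 by (intro mult_right_mono) auto
        then show ?thesis using rN by simp
      qed
      moreover have "[int r = int \<beta>] (mod N)" unfolding rN cong_def by simp
      moreover have "[int \<beta> = -1] (mod N)" if "\<alpha> = 1"
        using that unfolding Nab cong_iff_dvd_diff by (simp add: add.commute)
      ultimately show ?thesis using 3 by (auto intro: cong_trans)
    qed simp
  qed
  then show ?thesis
    using locally_admissibleI[of S q N] r2 D(6,8) cop by (simp add: N_def r_def)
qed (simp add: locally_admissible_def)

text \<open>If both branches have N \<ge> 2, different \<kappa> give (C-i). In the same good cone
  both would belong to its only edge, whose two terms differ by r in the exponent of d; so d^r is
  determined and the points coincide.\<close>

lemma good_condition_C:
  assumes good: "\<And>\<kappa>. proper \<kappa> \<Longrightarrow> good_cone \<kappa>"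
    and pd: "point_data q1 n1 d1" "point_data q2 n2 d2" and ne: "q1 \<noteq> q2" and le: "nu S q1 \<le> nu S q2"
  shows "condition_C S q1 q2"
proof -
  note D1 = point_dataD[OF pd(1)] and D2 = point_dataD[OF pd(2)]
  define r1 r2 where "r1 = ram_order S q1" and "r2 = ram_order S q2"
  define N1 N2 where "N1 = sbar S q1" and "N2 = sbar S q2"
  have N: "N1 = order_at r1 n1" "N2 = order_at r2 n2" using D1(6) D2(6) by (simp_all add: N1_def N2_def r1_def r2_def)
  have pos: "0 < r1" "0 < r2" using D1(1) D2(1) by (simp_all add: r1_def r2_def)
  note hold = condition_C_holds[OF le r1_def r2_def pos N1_def N2_def]
  show ?thesis
  proof (cases "N1 \<le> 1 \<or> N2 \<le> 1")
    case True
    have "N1 \<le> 0 \<or> N1 = 1 \<or> N2 = 1"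
    proof (rule ccontr)
      assume "\<not> ?thesis"
      then have "2 \<le> N1" "N2 \<le> 0" using True by linarith+
      then have "nu S q1 > 0" "nu S q2 \<le> 0"
        using pos by (auto simp: nu_def r1_def r2_def N1_def N2_def divide_nonpos_pos)
      then show False using le by simp
    qed
    then show ?thesis by (intro hold[of 0 0 0 0]) blast
  next
    case False
    then have N12: "2 \<le> N1" "2 \<le> N2" by auto
    obtain \<kappa> \<alpha> \<beta> where k: "proper \<kappa>" "0 < \<alpha>" "0 < \<beta>" "coprime \<alpha> \<beta>"
        "r1 = \<alpha> * \<kappa> + \<beta> * Suc \<kappa>" "n1 = \<alpha> * nf \<kappa> + \<beta> * nf (Suc \<kappa>)"
      by (rule cone_coordinates[of r1 n1]) (use D1(1-3) N12 N in \<open>auto simp: r1_def\<close>)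
    obtain \<kappa>' \<alpha>' \<beta>' where k': "proper \<kappa>'" "0 < \<alpha>'" "0 < \<beta>'" "coprime \<alpha>' \<beta>'"
        "r2 = \<alpha>' * \<kappa>' + \<beta>' * Suc \<kappa>'" "n2 = \<alpha>' * nf \<kappa>' + \<beta>' * nf (Suc \<kappa>')"
      by (rule cone_coordinates[of r2 n2]) (use D2(1-3) N12 N in \<open>auto simp: r2_def\<close>)
    have Nab: "N1 = int \<alpha> + int \<beta>" "N2 = int \<alpha>' + int \<beta>'"
      unfolding N k(5,6) k'(5,6) by (rule order_at_cone[OF k(1)], rule order_at_cone[OF k'(1)])
    obtain s t where st: "s \<in> face r1 n1 A" "t \<in> face r1 n1 A" "s \<noteq> t"
      by (rule face_two_elements[OF D1(1,4,5), folded r1_def])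
    obtain s' t' where st': "s' \<in> face r2 n2 A" "t' \<in> face r2 n2 A" "s' \<noteq> t'"
      by (rule face_two_elements[OF D2(1,4,5), folded r2_def])
    have "\<kappa> \<noteq> \<kappa>'"
    proof
      assume kk: "\<kappa> = \<kappa>'"
      interpret lattice_cone A \<kappa> "nf \<kappa>" "Suc \<kappa>" "nf (Suc \<kappa>)" by (rule cone[OF k(1)])
      have c1: "s \<in> cface \<alpha> \<beta>" "t \<in> cface \<alpha> \<beta>" using st unfolding mixed_corner.cface[OF mixed_corner_axioms k(1)] k(5,6)[symmetric] by auto
      have c2: "s' \<in> cface \<alpha>' \<beta>'" "t' \<in> cface \<alpha>' \<beta>'"
        using st' unfolding mixed_corner.cface[OF mixed_corner_axioms k(1)] k'(5,6)[folded kk, symmetric] by auto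
      have ab: "\<alpha> = \<alpha>'" "\<beta> = \<beta>'"
        using good_cone_unique[OF good[OF k(1)] k(2-4) c1 st(3) k'(2-4) c2 st'(3)] by auto
      have rr: "r1 = r2" "n1 = n2" using k(5,6) k'(5,6) ab kk by simp_all
      obtain s0 t0 where f: "cface \<alpha> \<beta> = {s0, t0}" "s0 \<noteq> t0" "X s0 = 0" "Y s0 = \<alpha>" "X t0 = \<beta>" "Y t0 = 0"
        by (rule good_coneD[OF good[OF k(1)] k(2-4) c1 st(3)])
      have F: "face r1 n1 A = {s0, t0}"
        using f(1) unfolding mixed_corner.cface[OF mixed_corner_axioms k(1)] k(5,6)[symmetric] .
      have sA: "s0 \<in> A" "t0 \<in> A" using F by (auto simp: face_def)
      have "\<bar>int (snd s0) - int (snd t0)\<bar> = int (1 * (\<alpha> * \<kappa> + \<beta> * Suc \<kappa>))"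
        by (rule snd_diff[OF sA]) (simp_all add: f)
      then have df: "\<bar>int (snd s0) - int (snd t0)\<bar> = int r1" by (simp only: k(5) mult_1)
      have cn: "cof s0 \<noteq> 0" "cof t0 \<noteq> 0" using sA by (auto simp: lsupp_def)
      have root: "cof s0 * d ^ snd s0 + cof t0 * d ^ snd t0 = 0" if "edge_poly bx by P r1 n1 d = 0" for d
        using that f(2) unfolding edge_poly_def F by simp
      have e1: "edge_poly bx by P r1 n1 d1 = 0" "d1 \<noteq> 0" using D1(4,5) by (simp_all add: r1_def)
      have e2: "edge_poly bx by P r1 n1 d2 = 0" "d2 \<noteq> 0" using D2(4,5) rr by (simp_all add: r2_def)
      have "\<exists>c. \<forall>d. d \<noteq> 0 \<longrightarrow> edge_poly bx by P r1 n1 d = 0 \<longrightarrow> d ^ r1 = c"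
      proof (cases "snd s0 < snd t0")
        case True
        then have e: "snd t0 = snd s0 + r1" using df by linarith
        have "d ^ r1 = - cof s0 / cof t0" if "d \<noteq> 0" "edge_poly bx by P r1 n1 d = 0" for d
        proof -
          have "d ^ snd s0 * (cof s0 + cof t0 * d ^ r1) = 0"
            using root[OF that(2)] by (simp add: e power_add algebra_simps)
          then have "cof s0 + cof t0 * d ^ r1 = 0" using that(1) by simp
          then have "cof t0 * d ^ r1 = - cof s0" by (simp add: add_eq_0_iff)
          then show ?thesis using cn by (simp add: field_simps)
        qed
        then show ?thesis by blast
      next
        case False
        then have e: "snd s0 = snd t0 + r1" using df by linarith
        have "d ^ r1 = - cof t0 / cof s0" if "d \<noteq> 0" "edge_poly bx by P r1 n1 d = 0" for d
        proof -
          have "d ^ snd t0 * (cof t0 + cof s0 * d ^ r1) = 0"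
            using root[OF that(2)] by (simp add: e power_add algebra_simps)
          then have "cof t0 + cof s0 * d ^ r1 = 0" using that(1) by simp
          then have "cof s0 * d ^ r1 = - cof t0" by (simp add: add_eq_0_iff)
          then show ?thesis using cn by (simp add: field_simps)
        qed
        then show ?thesis by blast
      qed
      then have "d1 ^ r1 = d2 ^ r1" using e1 e2 by metis
      then show False
        using point_data_unique[OF pd(1) pd(2)[folded rr(2)]] rr(1) ne by (simp add: r1_def r2_def)
    qed
    then show ?thesis
      by (intro hold[of "int \<kappa>" "int \<beta>" "int \<kappa>'" "int \<beta>'"] disjI2 conjI)
         (use k k' Nab in \<open>simp_all add: algebra_simps\<close>)
  qed
qed

text \<open>Each outcome of \<open>bad_coneD\<close> violates one condition: \<open>big\<close>
  gives a branch with r not congruent to \<plusminus>1 modulo N, while \<open>long\<close> and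
  \<open>two\<close> give two branches with the same \<kappa>, to which
  \<open>condition_C_fails\<close> applies.\<close>

lemma bad_corner:
  assumes pr: "proper \<kappa>" and bad: "\<not> good_cone \<kappa>"
  shows "\<not> corner_admissible"
proof
  assume ok: corner_admissible
  interpret lattice_cone A \<kappa> "nf \<kappa>" "Suc \<kappa>" "nf (Suc \<kappa>)" by (rule cone[OF pr])
  note cf = mixed_corner.cface[OF mixed_corner_axioms pr]
  have branch: "\<exists>q d'. q \<in> corner_points \<and> ram_order S q = m \<and> point_data q n d' \<and> d' ^ m = d ^ m"
    if "0 < \<alpha>" "0 < \<beta>" "coprime \<alpha> \<beta>" "m = \<alpha> * \<kappa> + \<beta> * Suc \<kappa>" "n = \<alpha> * nf \<kappa> + \<beta> * nf (Suc \<kappa>)"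
      "d \<noteq> 0" "edge_poly bx by P m n d = 0" for \<alpha> \<beta> m n d
    using point_data_surjective[of m n d] cone_normal[OF pr that(1-3)] that unfolding corner_points_def by auto
  have root: "\<exists>d. d \<noteq> 0 \<and> edge_poly bx by P m n d = 0"
    if "0 < \<alpha>" "0 < \<beta>" "coprime \<alpha> \<beta>" "m = \<alpha> * \<kappa> + \<beta> * Suc \<kappa>" "n = \<alpha> * nf \<kappa> + \<beta> * nf (Suc \<kappa>)"
      "s \<in> face m n A" "t \<in> face m n A" "s \<noteq> t" for \<alpha> \<beta> m n s t
  proof -
    have mn: "0 < m" "coprime m n" using cone_normal[OF pr that(1-3)] that(4,5) by auto
    have "snd s \<noteq> snd t"
    proof
      assume "snd s = snd t"
      moreover from this have "fst s = fst t" using face_weight[OF that(6,7)] mn(1) by simp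
      ultimately show False using that(8) by (simp add: prod_eq_iff)
    qed
    then consider "snd s < snd t" | "snd t < snd s" by linarith
    then show ?thesis using edge_poly_root_exists[OF mn] that(6,7) by cases blast+
  qed
  have conflict: False
    if "q1 \<in> corner_points" "q2 \<in> corner_points" "q1 \<noteq> q2" "point_data q1 n1 d1" "point_data q2 n2 d2"
      "0 < \<alpha>" "0 < \<beta>" "ram_order S q1 = \<alpha> * \<kappa> + \<beta> * Suc \<kappa>" "n1 = \<alpha> * nf \<kappa> + \<beta> * nf (Suc \<kappa>)"
      "0 < \<alpha>'" "0 < \<beta>'" "ram_order S q2 = \<alpha>' * \<kappa> + \<beta>' * Suc \<kappa>" "n2 = \<alpha>' * nf \<kappa> + \<beta>' * nf (Suc \<kappa>)"
      "nu S q1 \<le> nu S q2"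
    for q1 q2 n1 n2 d1 d2 \<alpha> \<beta> \<alpha>' \<beta>'
  proof -
    note D1 = point_dataD[OF that(4)] and D2 = point_dataD[OF that(5)]
    have N: "sbar S q1 = int \<alpha> + int \<beta>" "sbar S q2 = int \<alpha>' + int \<beta>'"
      unfolding D1(6) D2(6) that(8,9,12,13) by (rule order_at_cone[OF pr])+
    have "\<not> condition_C S q1 q2"
      by (rule condition_C_fails[OF refl refl D1(1) D2(1) refl refl, of "int \<kappa>" "int \<beta>" "int \<beta>'"])
         (use N that in \<open>simp_all add: algebra_simps\<close>)
    then show False using ok that(1-3,14) unfolding corner_admissible_def by blast
  qed
  have conflict': False
    if "q1 \<in> corner_points" "q2 \<in> corner_points" "q1 \<noteq> q2" "point_data q1 n1 d1" "point_data q2 n2 d2"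
      "0 < \<alpha>" "0 < \<beta>" "ram_order S q1 = \<alpha> * \<kappa> + \<beta> * Suc \<kappa>" "n1 = \<alpha> * nf \<kappa> + \<beta> * nf (Suc \<kappa>)"
      "0 < \<alpha>'" "0 < \<beta>'" "ram_order S q2 = \<alpha>' * \<kappa> + \<beta>' * Suc \<kappa>" "n2 = \<alpha>' * nf \<kappa> + \<beta>' * nf (Suc \<kappa>)"
    for q1 q2 n1 n2 d1 d2 \<alpha> \<beta> \<alpha>' \<beta>'
    using conflict[OF that] conflict[OF that(2,1) that(3)[symmetric] that(5,4) that(10-13) that(6-9)] linear by blast
  from bad show False
  proof (cases rule: bad_coneD)
    case (big \<alpha> \<beta> s t)
    define m where "m = \<alpha> * \<kappa> + \<beta> * Suc \<kappa>"
    define n where "n = \<alpha> * nf \<kappa> + \<beta> * nf (Suc \<kappa>)"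
    have pos: "0 < \<alpha>" "0 < \<beta>" using big by auto
    have st: "s \<in> face m n A" "t \<in> face m n A" using big(4,5) unfolding cf m_def n_def .
    obtain d where "d \<noteq> 0" "edge_poly bx by P m n d = 0"
      using root[OF pos big(3) m_def n_def st big(6)] by blast
    then obtain q d' where q: "q \<in> corner_points" "ram_order S q = m" "point_data q n d'"
      using branch[OF pos big(3) m_def n_def] by blast
    note D = point_dataD[OF q(3)]
    have N: "order_at m n = int \<alpha> + int \<beta>" unfolding m_def n_def by (rule order_at_cone[OF pr])
    have m2: "2 \<le> m" using big by (simp add: m_def)
    have la: "locally_admissible S q" using ok q(1) unfolding corner_admissible_def by blast
    have sp: "s_param S q = Fin (int \<alpha> + int \<beta>)" using D(8) m2 by (simp add: q(2) N)
    have c: "[int m = 1] (mod int \<alpha> + int \<beta>) \<or> [int m = -1] (mod int \<alpha> + int \<beta>)"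
      using la m2 big(1,2) unfolding locally_admissible_def Let_def q(2) sp by auto
    have mm: "int m - 1 = int \<kappa> * (int \<alpha> + int \<beta>) + (int \<beta> - 1)"
      "int m - (- 1) = int \<kappa> * (int \<alpha> + int \<beta>) + (int \<beta> + 1)" by (simp_all add: m_def algebra_simps)
    \<comment> \<open>Since 2 \<le> \<beta> \<le> N - 2, both \<beta> - 1 and \<beta> + 1 lie
      strictly between 0 and N.\<close>
    have "(int \<alpha> + int \<beta>) dvd int \<beta> - 1 \<or> (int \<alpha> + int \<beta>) dvd int \<beta> + 1"
      using c unfolding cong_iff_dvd_diff mm dvd_add_times_triv_left_iff .
    then show False
      using big(1,2) zdvd_imp_le[of "int \<alpha> + int \<beta>" "int \<beta> - 1"] zdvd_imp_le[of "int \<alpha> + int \<beta>" "int \<beta> + 1"] by auto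
  next
    case (long \<alpha> \<beta> s t)
    define m where "m = \<alpha> * \<kappa> + \<beta> * Suc \<kappa>"
    define n where "n = \<alpha> * nf \<kappa> + \<beta> * nf (Suc \<kappa>)"
    have st: "s \<in> face m n A" "t \<in> face m n A" using long(4,5) unfolding cf m_def n_def .
    have mn: "0 < m" "coprime m n" using cone_normal[OF pr long(1-3)] by (simp_all only: m_def n_def)
    obtain d d' where d: "d \<noteq> 0" "d' \<noteq> 0" "edge_poly bx by P m n d = 0" "edge_poly bx by P m n d' = 0" "d ^ m \<noteq> d' ^ m"
      using edge_poly_two_roots[OF nondeg mn st] long(6) by (auto simp: m_def)
    obtain q1 d1 where q1: "q1 \<in> corner_points" "ram_order S q1 = m" "point_data q1 n d1" "d1 ^ m = d ^ m"
      using branch[OF long(1-3) m_def n_def d(1,3)] by blast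
    obtain q2 d2 where q2: "q2 \<in> corner_points" "ram_order S q2 = m" "point_data q2 n d2" "d2 ^ m = d' ^ m"
      using branch[OF long(1-3) m_def n_def d(2,4)] by blast
    \<comment> \<open>A point has one leading coefficient in its chosen coordinate, so roots with
      different m-th powers belong to different points.\<close>
    have "q1 \<noteq> q2"
    proof
      assume "q1 = q2"
      then obtain V e V' e' where "branch q1 (SOME c. standard_coord S q1 c) m n V e" "V 0 = d1"
          "branch q1 (SOME c. standard_coord S q1 c) m n V' e'" "V' 0 = d2"
        using q1 q2 unfolding point_data_def by auto
      then have "lead_at m d1 = lead_at m d2" using tau_branch(1) by metis
      then have "d1 = d2" using mn(1) by (auto simp: lead_at_def split: if_splits)
      then show False using q1(4) q2(4) d(5) by simp
    qed
    then show False
      using conflict'[OF q1(1) q2(1) _ q1(3) q2(3) long(1,2) _ n_def long(1,2) _ n_def] q1(2) q2(2) by (simp add: m_def)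
  next
    case (two \<alpha> \<beta> s t \<alpha>' \<beta>' s' t')
    define m where "m = \<alpha> * \<kappa> + \<beta> * Suc \<kappa>"
    define n where "n = \<alpha> * nf \<kappa> + \<beta> * nf (Suc \<kappa>)"
    define m' where "m' = \<alpha>' * \<kappa> + \<beta>' * Suc \<kappa>"
    define n' where "n' = \<alpha>' * nf \<kappa> + \<beta>' * nf (Suc \<kappa>)"
    have st: "s \<in> face m n A" "t \<in> face m n A" using two(4,5) unfolding cf m_def n_def .
    have st': "s' \<in> face m' n' A" "t' \<in> face m' n' A" using two(10,11) unfolding cf m'_def n'_def .
    obtain d where d: "d \<noteq> 0" "edge_poly bx by P m n d = 0"
      using root[OF two(1-3) m_def n_def st two(6)] by blast
    obtain d' where d': "d' \<noteq> 0" "edge_poly bx by P m' n' d' = 0"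
      using root[OF two(7-9) m'_def n'_def st' two(12)] by blast
    obtain q1 d1 where q1: "q1 \<in> corner_points" "ram_order S q1 = m" "point_data q1 n d1"
      using branch[OF two(1-3) m_def n_def d] by blast
    obtain q2 d2 where q2: "q2 \<in> corner_points" "ram_order S q2 = m'" "point_data q2 n' d2"
      using branch[OF two(7-9) m'_def n'_def d'] by blast
    \<comment> \<open>N and r determine \<beta> and then \<alpha>, so different normals belong to
      different points.\<close>
    have "q1 \<noteq> q2"
    proof
      assume qq: "q1 = q2"
      have "sbar S q1 = int \<alpha> + int \<beta>" "sbar S q2 = int \<alpha>' + int \<beta>'"
        unfolding point_dataD(6)[OF q1(3)] point_dataD(6)[OF q2(3)] q1(2) q2(2) m_def n_def m'_def n'_def
        by (rule order_at_cone[OF pr])+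
      then have N: "\<alpha> + \<beta> = \<alpha>' + \<beta>'" using qq by simp
      have "m = \<kappa> * (\<alpha> + \<beta>) + \<beta>" "m' = \<kappa> * (\<alpha>' + \<beta>') + \<beta>'" by (simp_all add: m_def m'_def algebra_simps)
      moreover have "m = m'" using q1(2) q2(2) qq by simp
      ultimately have "\<beta> = \<beta>'" using N by simp
      then show False using N two(13) by simp
    qed
    then show False
      using conflict'[OF q1(1) q2(1) _ q1(3) q2(3) two(1,2) _ n_def two(7,8) _ n'_def] q1(2) q2(2)
      by (simp add: m_def m'_def)
  qed
qed

lemma corner_admissible_iff: "corner_admissible \<longleftrightarrow> (\<forall>\<kappa>. proper \<kappa> \<longrightarrow> good_cone \<kappa>)"
proof
  assume good: "\<forall>\<kappa>. proper \<kappa> \<longrightarrow> good_cone \<kappa>"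
  have "locally_admissible S q" if "q \<in> corner_points" for q
    using good_locally_admissible good corner_point_data[OF that] by blast
  moreover have "non_resonant S q1 q2 \<and> condition_C S q1 q2"
    if q: "q1 \<in> corner_points" "q2 \<in> corner_points" and ne: "q1 \<noteq> q2" and le: "nu S q1 \<le> nu S q2" for q1 q2
  proof -
    obtain n1 d1 where pd1: "point_data q1 n1 d1" using corner_point_data[OF q(1)] by blast
    obtain n2 d2 where pd2: "point_data q2 n2 d2" using corner_point_data[OF q(2)] by blast
    note pd = pd1 pd2
    show ?thesis using corner_non_resonant[OF pd ne] good_condition_C[OF _ pd ne le] good by blast
  qed
  ultimately show corner_admissible unfolding corner_admissible_def by blast
qed (use bad_corner in blast)

text \<open>The origin is a witness if present, otherwise the unit point on the axis of
  \<open>f\<close>, otherwise the one on the axis of \<open>g\<close>. Here \<open>f\<close> is the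
  exponent of smaller weight in both generators of the cone, so that one computation covers both
  mixed corners.\<close>

lemma smooth_corner_good:
  assumes p: "p \<in> A" "fst p + snd p \<le> 1" and pr: "proper \<kappa>"
  shows "good_cone \<kappa>"
proof -
  interpret lattice_cone A \<kappa> "nf \<kappa>" "Suc \<kappa>" "nf (Suc \<kappa>)" by (rule cone[OF pr])
  have *: "\<exists>s\<in>A. \<forall>q\<in>A. \<forall>q'\<in>A. w1 s + w2 s \<le> w1 q + w2 q' + 1"
  proof -
    define l where "l = (if bx then \<kappa> else \<kappa> - 1)"
    define f g :: "nat \<times> nat \<Rightarrow> nat" where "f = (if bx then fst else snd)" and "g = (if bx then snd else fst)"
    have w: "w1 s = l * f s + Suc l * g s" "w2 s = Suc l * f s + Suc (Suc l) * g s" for s :: "nat \<times> nat"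
    proof -
      have "bx \<or> (\<exists>j. \<kappa> = Suc j)" using pr unfolding proper_def by (cases \<kappa>) auto
      then have "w1 s = l * f s + Suc l * g s \<and> w2 s = Suc l * f s + Suc (Suc l) * g s"
        unfolding w1_def w2_def unfolding l_def f_def g_def nf_def by (auto simp: add.commute)
      then show "w1 s = l * f s + Suc l * g s" "w2 s = Suc l * f s + Suc (Suc l) * g s" by blast+
    qed
    have fg: "f p + g p \<le> 1" using p(2) by (auto simp: f_def g_def)
    consider (0) s where "s \<in> A" "f s = 0" "g s = 0" | (1) s where "s \<in> A" "f s = 1" "g s = 0" "\<And>q. q \<in> A \<Longrightarrow> f q \<noteq> 0 \<or> g q \<noteq> 0"
      | (2) "f p = 0" "g p = 1" "\<And>q. q \<in> A \<Longrightarrow> 2 \<le> f q \<or> 1 \<le> g q"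
    proof -
      have "f p = 0 \<and> g p = 0 \<or> f p = 1 \<and> g p = 0 \<or> f p = 0 \<and> g p = 1" using fg by linarith
      moreover have "2 \<le> f q \<or> 1 \<le> g q \<or> f q = 0 \<and> g q = 0 \<or> f q = 1 \<and> g q = 0" for q by linarith
      ultimately show ?thesis using 0 1 2 p(1) by metis
    qed
    then show ?thesis
    proof cases
      case 0
      then show ?thesis by (intro bexI[of _ s]) (auto simp: w)
    next
      case 1
      have "l \<le> w1 q \<and> Suc l \<le> w2 q" if "q \<in> A" for q
        using 1(4)[OF that] unfolding w by (cases "f q"; cases "g q") auto
      moreover have "w1 s = l" "w2 s = Suc l" using 1(2,3) by (simp_all add: w)
      ultimately show ?thesis using 1(1) by (intro bexI[of _ s] ballI) (metis add_mono le_add1 order_trans)+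
    next
      case 2
      have "l \<le> w1 q \<and> Suc (Suc l) \<le> w2 q" if "q \<in> A" for q
      proof (cases "g q")
        case 0
        then have "2 \<le> f q" using 2(3)[OF that] by simp
        then have "l * 2 \<le> l * f q" by (rule mult_le_mono2)
        moreover have "w1 q = l * f q" "w2 q = f q + l * f q" by (simp_all add: w 0)
        ultimately show ?thesis using \<open>2 \<le> f q\<close> by linarith
      next
        case (Suc k)
        then show ?thesis unfolding w by auto
      qed
      note lower = this
      have "w1 p = Suc l" "w2 p = Suc (Suc l)" using 2(1,2) by (simp_all add: w)
      then have "w1 p + w2 p \<le> w1 q + w2 q' + 1" if "q \<in> A" "q' \<in> A" for q q'
        using lower[OF that(1)] lower[OF that(2)] by linarith
      then show ?thesis using p(1) by blast
    qed
  qed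
  then show ?thesis by (simp add: cone_good_def)
qed

end

text \<open>Reversing exponents turns local weights into functionals on the Newton polygon up to the
  constants \<open>c1\<close> and \<open>c2\<close>, which occur once on each side and
  cancel.\<close>

lemma good_newton_polygon_iff:
  fixes m1 n1 m2 n2 :: nat and bx "by" :: bool
  defines "f1 \<equiv> if bx then - real m1 else real m1" and "f2 \<equiv> if by then - real n1 else real n1"
    and "g1 \<equiv> if bx then - real m2 else real m2" and "g2 \<equiv> if by then - real n2 else real n2"
  shows "good (lin f1 f2) (lin g1 g2) (newton_polygon P) \<longleftrightarrow>
    (\<exists>p\<in>lsupp bx by P. \<forall>q\<in>lsupp bx by P. \<forall>q'\<in>lsupp bx by P.
      (m1 * fst p + n1 * snd p) + (m2 * fst p + n2 * snd p) \<le> (m1 * fst q + n1 * snd q) + (m2 * fst q' + n2 * snd q') + 1)"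
proof -
  let ?\<iota> = "\<lambda>s :: nat \<times> nat. (real (fst s), real (snd s))"
  define \<phi> where "\<phi> s = (lexp bx (deg_x P) (fst s), lexp by (deg_y P) (snd s))" for s
  define c1 where "c1 = (if bx then real m1 * deg_x P else 0) + (if by then real n1 * deg_y P else 0)"
  define c2 where "c2 = (if bx then real m2 * deg_x P else 0) + (if by then real n2 * deg_y P else 0)"
  have le: "fst s \<le> deg_x P" "snd s \<le> deg_y P" if "s \<in> support P" for s
    using support_le[of "fst s" "snd s" P] that by simp_all
  have A: "lsupp bx by P = \<phi> ` support P"
  proof
    show "\<phi> ` support P \<subseteq> lsupp bx by P"
      using le by (auto simp: \<phi>_def lexp_in_lsupp_iff)
    show "lsupp bx by P \<subseteq> \<phi> ` support P"
    proof
      fix t assume t: "t \<in> lsupp bx by P"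
      then have b: "fst t \<le> deg_x P" "snd t \<le> deg_y P" by (auto simp: lsupp_def)
      have "\<phi> t \<in> support P"
        using lexp_in_lsupp_iff[of "fst (\<phi> t)" P "snd (\<phi> t)" bx "by"] t b by (simp add: \<phi>_def)
      moreover have "t = \<phi> (\<phi> t)" using b by (simp add: \<phi>_def)
      ultimately show "t \<in> \<phi> ` support P" by (rule rev_image_eqI)
    qed
  qed
  have l1: "lin f1 f2 (?\<iota> s) = real (m1 * fst (\<phi> s) + n1 * snd (\<phi> s)) - c1" if "s \<in> support P" for s
    using le[OF that] by (auto simp: lin_def f1_def f2_def c1_def \<phi>_def lexp_def of_nat_diff algebra_simps)
  have l2: "lin g1 g2 (?\<iota> s) = real (m2 * fst (\<phi> s) + n2 * snd (\<phi> s)) - c2" if "s \<in> support P" for s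
    using le[OF that] by (auto simp: lin_def g1_def g2_def c2_def \<phi>_def lexp_def of_nat_diff algebra_simps)
  have V: "(\<lambda>(i, j). (real i, real j)) ` support P = ?\<iota> ` support P" by (simp add: split_beta)
  have e: "lin f1 f2 (?\<iota> s) + lin g1 g2 (?\<iota> s) \<le> lin f1 f2 (?\<iota> t) + lin g1 g2 (?\<iota> t') + 1 \<longleftrightarrow>
      (m1 * fst (\<phi> s) + n1 * snd (\<phi> s)) + (m2 * fst (\<phi> s) + n2 * snd (\<phi> s))
       \<le> (m1 * fst (\<phi> t) + n1 * snd (\<phi> t)) + (m2 * fst (\<phi> t') + n2 * snd (\<phi> t')) + 1"
    if "s \<in> support P" "t \<in> support P" "t' \<in> support P" for s t t'
    unfolding l1[OF that(1)] l1[OF that(2)] l2[OF that(1)] l2[OF that(3)] by linarith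
  have "good (lin f1 f2) (lin g1 g2) (newton_polygon P) \<longleftrightarrow>
     (\<exists>s\<in>support P. \<forall>t\<in>support P. \<forall>t'\<in>support P.
        lin f1 f2 (?\<iota> s) + lin g1 g2 (?\<iota> s) \<le> lin f1 f2 (?\<iota> t) + lin g1 g2 (?\<iota> t') + 1)"
    unfolding newton_polygon_def V good_convex_hull by (simp add: good_def)
  also have "\<dots> \<longleftrightarrow> (\<exists>s\<in>support P. \<forall>t\<in>support P. \<forall>t'\<in>support P.
      (m1 * fst (\<phi> s) + n1 * snd (\<phi> s)) + (m2 * fst (\<phi> s) + n2 * snd (\<phi> s))
       \<le> (m1 * fst (\<phi> t) + n1 * snd (\<phi> t)) + (m2 * fst (\<phi> t') + n2 * snd (\<phi> t')) + 1)"
    using e by (intro bex_cong ball_cong refl) blast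
  finally show ?thesis unfolding A by simp
qed

context mixed_corner
begin

text \<open>A smooth corner imposes no condition, and its cones are good anyway.\<close>

lemma singular_imp_admissible_iff:
  "(corner \<in> singular_points P \<longrightarrow> corner_admissible) \<longleftrightarrow> (\<forall>\<kappa>. proper \<kappa> \<longrightarrow> good_cone \<kappa>)"
proof (cases "corner \<in> singular_points P")
  case False
  then obtain p where "p \<in> A" "fst p + snd p \<le> 1" unfolding corner_singular_iff by force
  then show ?thesis using smooth_corner_good False by blast
qed (simp add: corner_admissible_iff)

lemma good_cone_iff:
  assumes "proper \<kappa>"
  shows "good_cone \<kappa> \<longleftrightarrow> good
    (lin (if bx then - real \<kappa> else real \<kappa>) (if by then - real (nf \<kappa>) else real (nf \<kappa>)))
    (lin (if bx then - real (Suc \<kappa>) else real (Suc \<kappa>)) (if by then - real (nf (Suc \<kappa>)) else real (nf (Suc \<kappa>))))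
    (newton_polygon P)"
  unfolding good_newton_polygon_iff lattice_cone.cone_good_def[OF cone[OF assms]]
    lattice_cone.w1_def[OF cone[OF assms]] lattice_cone.w2_def[OF cone[OF assms]] ..

end

text \<open>All singular points are corners, and each corner has its own instance. The corner (0, 0)
  is outside \<open>E_set\<close>, so it must not be singular at all; since the support meets both
  axes, both minima are 0 and this is the first inequality.\<close>

lemma globally_admissible_iff_admissible_polygon:
  fixes S :: "'a spectral_curve"
  assumes nondeg: "nondegenerate P" and ins: "inscribed dx dy (newton_polygon P)" and csc: "compact_spectral_curve P \<eta> S"
  shows "globally_admissible P \<eta> S \<longleftrightarrow> admissible_polygon (newton_polygon P)"
proof -
  interpret oo: curve_corner P \<eta> S False False dx dy by unfold_locales fact+
  interpret ii: curve_corner P \<eta> S True True dx dy by unfold_locales fact+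
  interpret io: mixed_corner P \<eta> S True False dx dy by unfold_locales (simp_all add: assms)
  interpret oi: mixed_corner P \<eta> S False True dx dy by unfold_locales (simp_all add: assms)
  define ok where "ok p \<longleftrightarrow> p \<in> E_set P \<and>
        (let F = {q \<in> topspace (surface S). \<eta> q = p} in
           (\<forall>q\<in>F. locally_admissible S q)
         \<and> (\<forall>q1\<in>F. \<forall>q2\<in>F. q1 \<noteq> q2 \<and> nu S q1 \<le> nu S q2 \<longrightarrow>
              non_resonant S q1 q2 \<and> condition_C S q1 q2))" for p
  have E: "(pt bx 0, pt by 0) \<in> E_set P \<longleftrightarrow> bx \<or> by" if "(pt bx 0, pt by 0) \<in> singular_points P" for bx "by"
  proof -
    have "lpoly bx by P 0 0 = 0"
      using that unfolding corner_singular_iff lpoly_alt by (intro sum.neutral) (force simp: power_0_left)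
    then have "(pt bx 0, pt by 0) \<in> proj_curve P" by (simp add: pt_in_proj_curve_iff)
    moreover have "homog 0 1 = pt False 0" by (simp add: pt_homog)
    ultimately show ?thesis by (auto simp: E_set_def proj_inf_eq pt_eq_pt_0_iff)
  qed
  have corners: "p \<in> singular_points P \<Longrightarrow> p \<in> {(pt bx 0, pt by 0) | bx by. True}" for p
    using singular_point_is_corner[OF nondeg ins io.deg_pos] by blast
  have ga: "globally_admissible P \<eta> S \<longleftrightarrow> (\<forall>bx by. (pt bx 0, pt by 0) \<in> singular_points P \<longrightarrow> ok (pt bx 0, pt by 0))"
    unfolding globally_admissible_def ok_def[symmetric] using corners by blast
  have okoo: "\<not> ok (pt False 0, pt False 0)" if "(pt False 0, pt False 0) \<in> singular_points P"
    using E[OF that] by (simp add: ok_def)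
  have okii: "ok (pt True 0, pt True 0)" if "(pt True 0, pt True 0) \<in> singular_points P"
    using E[OF that] ii.corner_admissible_infinity
    unfolding ok_def ii.corner_admissible_def ii.corner_points_def Let_def by simp
  have okio: "ok (pt True 0, pt False 0) \<longleftrightarrow> io.corner_admissible" if "(pt True 0, pt False 0) \<in> singular_points P"
    using E[OF that] unfolding ok_def io.corner_admissible_def io.corner_points_def Let_def by simp
  have okoi: "ok (pt False 0, pt True 0) \<longleftrightarrow> oi.corner_admissible" if "(pt False 0, pt True 0) \<in> singular_points P"
    using E[OF that] unfolding ok_def oi.corner_admissible_def oi.corner_points_def Let_def by simp
  have "globally_admissible P \<eta> S \<longleftrightarrow> (pt False 0, pt False 0) \<notin> singular_points P
      \<and> ((pt True 0, pt False 0) \<in> singular_points P \<longrightarrow> io.corner_admissible)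
      \<and> ((pt False 0, pt True 0) \<in> singular_points P \<longrightarrow> oi.corner_admissible)"
    unfolding ga all_bool_eq using okoo okii okio okoi by blast
  also have "(pt False 0, pt False 0) \<notin> singular_points P \<longleftrightarrow> good (lin 1 0) (lin 0 1) (newton_polygon P)"
  proof -
    obtain b0 a0 where ab: "(0, b0) \<in> oo.A" "(a0, 0) \<in> oo.A" using oo.axes by blast
    have "good (lin 1 0) (lin 0 1) (newton_polygon P) \<longleftrightarrow>
        (\<exists>p\<in>oo.A. \<forall>q\<in>oo.A. \<forall>q'\<in>oo.A. fst p + snd p \<le> fst q + snd q' + 1)"
      using good_newton_polygon_iff[of False 1 False 0 0 1 P] by simp
    also have "\<dots> \<longleftrightarrow> (\<exists>p\<in>oo.A. fst p + snd p \<le> 1)"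
    proof (intro iffI; elim bexE)
      fix p
      assume "p \<in> oo.A" and *: "\<forall>q\<in>oo.A. \<forall>q'\<in>oo.A. fst p + snd p \<le> fst q + snd q' + 1"
      have "fst p + snd p \<le> fst (0::nat, b0) + snd (a0, 0::nat) + 1" using * ab by blast
      then show "\<exists>p\<in>oo.A. fst p + snd p \<le> 1" using \<open>p \<in> oo.A\<close> by auto
    next
      fix p
      assume "p \<in> oo.A" "fst p + snd p \<le> 1"
      then show "\<exists>p\<in>oo.A. \<forall>q\<in>oo.A. \<forall>q'\<in>oo.A. fst p + snd p \<le> fst q + snd q' + 1"
        by (intro bexI[of _ p] ballI) linarith+
    qed
    finally show ?thesis unfolding corner_singular_iff by (force simp: not_le)
  qed
  also have "((pt True 0, pt False 0) \<in> singular_points P \<longrightarrow> io.corner_admissible) \<longleftrightarrow>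
      (\<forall>k. good (lin (- real k) (real (Suc k))) (lin (- real (Suc k)) (real (Suc (Suc k)))) (newton_polygon P))"
    unfolding io.singular_imp_admissible_iff using io.good_cone_iff by (simp add: io.proper_def io.nf_def)
  also have "((pt False 0, pt True 0) \<in> singular_points P \<longrightarrow> oi.corner_admissible) \<longleftrightarrow>
      (\<forall>k. good (lin (real (Suc k)) (- real k)) (lin (real (Suc (Suc k))) (- real (Suc k))) (newton_polygon P))"
  proof -
    have "(\<forall>\<kappa>. oi.proper \<kappa> \<longrightarrow> oi.good_cone \<kappa>) \<longleftrightarrow> (\<forall>k. oi.good_cone (Suc k))"
      by (simp add: oi.proper_def all_conj_distrib) (metis Suc_le_D Suc_le_mono le0 One_nat_def)
    moreover have "oi.good_cone (Suc k) \<longleftrightarrow>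
        good (lin (real (Suc k)) (- real k)) (lin (real (Suc (Suc k))) (- real (Suc k))) (newton_polygon P)" for k
      using oi.good_cone_iff[of "Suc k"] by (simp add: oi.proper_def oi.nf_def)
    ultimately show ?thesis unfolding oi.singular_imp_admissible_iff by simp
  qed
  finally show ?thesis by (simp only: admissible_polygon_def)
qed

theorem theorem4p30:
  fixes P P' :: "complex poly poly"
    and S :: "'a spectral_curve" and \<eta> :: "'a \<Rightarrow> proj1 \<times> proj1"
    and S' :: "'b spectral_curve" and \<eta>' :: "'b \<Rightarrow> proj1 \<times> proj1"
  assumes "irreducible P" and "irreducible P'"
    and "nondegenerate P" and "nondegenerate P'"
    and "strongly_equivalent (newton_polygon P) (newton_polygon P')"
    and "\<And>D. strongly_equivalent (newton_polygon P) D \<Longrightarrow> \<not> long_diagonal D"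
    and "compact_spectral_curve P \<eta> S"
    and "compact_spectral_curve P' \<eta>' S'"
  shows "globally_admissible P \<eta> S \<longleftrightarrow> globally_admissible P' \<eta>' S'"
proof -
  obtain dx dy dx' dy' where "inscribed dx dy (newton_polygon P)" "inscribed dx' dy' (newton_polygon P')"
    using assms(5) unfolding strongly_equivalent_def by blast
  then show ?thesis
    using globally_admissible_iff_admissible_polygon[OF assms(3) _ assms(7)]
      globally_admissible_iff_admissible_polygon[OF assms(4) _ assms(8)]
      admissible_polygon_strongly_equivalent[OF assms(5,6)] by blast
qed

end
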